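(* Let $H$ be a Tonelli Hamiltonian on $\mathrm{T}^*\mathbb{T}^n=\mathbb{T}^n\times\mathbb{R}^n$, and let $\tilde\Upsilon$ be the set of invariant Lagrangian graphs on which the Hamiltonian flow is topologically conjugated to an ergodic linear flow on $\mathbb{T}^n$. There exists a dense $G_\delta$-set $\mathcal{G}$ in the $C^0$ closure of $\tilde\Upsilon$ consisting of strictly ergodic invariant Lagrangian graphs. Any $\Lambda\in\mathcal{G}$ satisfies the following properties: (i) the invariant graph $\Lambda$ has a well-defined rotation vector $\rho(\Lambda)$ (i.e. all invariant probability measures supported on $\Lambda$ have the same rotation vector, denoted $\rho(\Lambda)$); (ii) any invariant Lagrangian graph that intersects $\Lambda$ coincides with $\Lambda$; (iii) any invariant Lagrangian graph that carries an invariant probability measure whose rotation vector is $\rho(\Lambda)$ coincides with $\Lambda$.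
   Context: A Tonelli Hamiltonian is a function $H$ of class $C^k$, $k\ge2$, such that $\partial^2H/\partial p^2(x,p)$ is positive definite for all $(x,p)$ and $\lim_{\|p\|\to\infty}H(x,p)/\|p\|=+\infty$ for each $x$. Its Lagrangian is $L(x,v)=\sup_p\{\langle p,v\rangle-H(x,p)\}$ and the Legendre transform $\mathcal{L}(x,v)=(x,\frac{\partial L}{\partial v}(x,v))$ conjugates the Euler-Lagrange flow of $L$ to the Hamiltonian flow of $H$. "Invariant" means invariant under these flows. A Lagrangian graph is a Lipschitz section of $\mathrm{T}^*\mathbb{T}^n$ which locally coincides with the graph of an exact differential. Lagrangian graphs are identified with elements of $\mathrm{Lip}(\mathbb{T}^n,\mathbb{R}^n)$, and the $C^0$ closure of $\tilde\Upsilon$ is its closure in the uniform topology (it consists of functions in $\mathrm{Lip}(\mathbb{T}^n,\mathbb{R}^n)$ whose graphs are invariant Lagrangian graphs); "dense $G_\delta$" refers to the $C^0$ topology on this closure. The set $\tilde\Upsilon$ may be empty. A linear flow on $\mathbb{T}^n$ is $x\mapsto x+t\alpha$ with $\alpha\in\mathbb{R}^n$; it is ergodic if it is ergodic for Lebesgue measure. An invariant graph $\Lambda$ is strictly ergodic if the restricted flow on $\Lambda$ has exactly one invariant probability measure, and this measure has support $\Lambda$. The rotation vector of an invariant probability measure $\mu$ on $\mathrm{T}\mathbb{T}^n$ is the element $\rho(\mu)\in \mathrm{H}_1(\mathbb{T}^n;\mathbb{R})=\mathbb{R}^n$ with $\int\langle\eta(x),v\rangle\,d\mu=\langle[\eta],\rho(\mu)\rangle$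 for all closed $1$-forms $\eta$; for an invariant probability measure $\mu^*$ on $\mathrm{T}^*\mathbb{T}^n$ it is that of $(\mathcal{L}^{-1})_*\mu^*$. *)

theory Defs
  imports "HOL-Analysis.Analysis"
begin

section \<open>The torus\<close>

definition int_lattice :: "(real ^ 'n) set" where
  "int_lattice = {x. \<forall>i. x $ i \<in> \<int>}"

lemma int_lattice_0: "0 \<in> int_lattice"
  by (simp add: int_lattice_def)

lemma int_lattice_add: "a \<in> int_lattice \<Longrightarrow> b \<in> int_lattice \<Longrightarrow> a + b \<in> int_lattice"
  by (simp add: int_lattice_def)

lemma int_lattice_minus: "- a \<in> int_lattice \<longleftrightarrow> a \<in> int_lattice"
  by (simp add: int_lattice_def minus_in_Ints_iff)

lemma int_lattice_diff: "a \<in> int_lattice \<Longrightarrow> b \<in> int_lattice \<Longrightarrow> a - b \<in> int_lattice"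
  by (simp add: int_lattice_def)

lemma closed_int_lattice: "closed (int_lattice :: (real ^ 'n) set)"
proof -
  have "closed (\<Inter>i. (\<lambda>x :: real ^ 'n. x $ i) -` \<int>)"
    by (intro closed_INT ballI closed_vimage closed_Ints continuous_intros)
  moreover have "(\<Inter>i. (\<lambda>x :: real ^ 'n. x $ i) -` \<int>) = int_lattice"
    by (auto simp: int_lattice_def)
  ultimately show ?thesis by simp
qed

lemma infdist_int_lattice_shift:
  fixes x y :: "real ^ 'n"
  assumes "x - y \<in> int_lattice"
  shows "infdist x int_lattice = infdist y int_lattice"
proof -
  have *: "infdist x int_lattice \<le> infdist y int_lattice"
    if xy: "x - y \<in> int_lattice" for x y :: "real ^ 'n"
  proof -
    obtain a where a: "a \<in> int_lattice" "infdist y int_lattice = dist y a"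
      using infdist_attains_inf[OF closed_int_lattice] int_lattice_0 by blast
    have "infdist x int_lattice \<le> dist x (a + (x - y))"
      using a xy by (intro infdist_le int_lattice_add)
    also have "\<dots> = dist y a" by (simp add: dist_norm algebra_simps)
    finally show ?thesis using a by simp
  qed
  have "y - x \<in> int_lattice" using assms int_lattice_minus[of "x - y"] by simp
  with * assms show ?thesis by (meson order_antisym)
qed

lemma infdist_int_lattice_add:
  fixes x y :: "real ^ 'n"
  shows "infdist (x + y) int_lattice \<le> infdist x int_lattice + infdist y int_lattice"
proof -
  obtain a where a: "a \<in> int_lattice" "infdist x int_lattice = dist x a"
    using infdist_attains_inf[OF closed_int_lattice] int_lattice_0 by blast
  obtain b where b: "b \<in> int_lattice" "infdist y int_lattice = dist y b"
    using infdist_attains_inf[OF closed_int_lattice] int_lattice_0 by blast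
  have "infdist (x + y) int_lattice \<le> dist (x + y) (a + b)"
    using a b by (intro infdist_le int_lattice_add)
  also have "\<dots> \<le> dist x a + dist y b" by (rule dist_triangle_add)
  finally show ?thesis using a b by simp
qed

lemma infdist_int_lattice_minus:
  fixes x :: "real ^ 'n"
  shows "infdist (- x) int_lattice = infdist x int_lattice"
proof -
  have *: "infdist (- x) int_lattice \<le> infdist x int_lattice" for x :: "real ^ 'n"
  proof -
    obtain a where a: "a \<in> int_lattice" "infdist x int_lattice = dist x a"
      using infdist_attains_inf[OF closed_int_lattice] int_lattice_0 by blast
    have "infdist (- x) int_lattice \<le> dist (- x) (- a)"
      using a by (intro infdist_le) (simp add: int_lattice_minus)
    with a show ?thesis by (simp add: dist_minus)
  qed
  from *[of x] *[of "- x"] show ?thesis by simp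
qed

quotient_type 'n torus = "real ^ 'n::finite" / "\<lambda>x y. x - y \<in> int_lattice"
proof (rule equivpI)
  show "reflp (\<lambda>x y :: real ^ 'n. x - y \<in> int_lattice)"
    by (simp add: reflp_def int_lattice_0)
  show "symp (\<lambda>x y :: real ^ 'n. x - y \<in> int_lattice)"
    by (metis (no_types, lifting) sympI int_lattice_minus minus_diff_eq)
  show "transp (\<lambda>x y :: real ^ 'n. x - y \<in> int_lattice)"
    by (metis (no_types, lifting) transpI int_lattice_add diff_add_cancel add_diff_eq)
qed

text \<open>The flat metric; it induces the quotient topology.\<close>

instantiation torus :: (finite) metric_space
begin

lift_definition dist_torus :: "'a torus \<Rightarrow> 'a torus \<Rightarrow> real"
  is "\<lambda>x y. infdist (x - y) int_lattice"
proof -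
  fix x x' y y' :: "real ^ 'a"
  assume "x - x' \<in> int_lattice" "y - y' \<in> int_lattice"
  then have "(x - x') - (y - y') \<in> int_lattice" by (rule int_lattice_diff)
  then show "infdist (x - y) int_lattice = infdist (x' - y') int_lattice"
    by (intro infdist_int_lattice_shift) (simp add: algebra_simps)
qed

definition uniformity_torus :: "('a torus \<times> 'a torus) filter" where
  "uniformity_torus = (INF e\<in>{0<..}. principal {(x, y). dist x y < e})"

definition open_torus :: "'a torus set \<Rightarrow> bool" where
  "open_torus U \<longleftrightarrow> (\<forall>x\<in>U. eventually (\<lambda>(x', y). x' = x \<longrightarrow> y \<in> U) uniformity)"

instance
proof
  show "uniformity = (INF e\<in>{0<..}. principal {(x :: 'a torus, y). dist x y < e})"
    by (rule uniformity_torus_def)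
  show "open U \<longleftrightarrow> (\<forall>x\<in>U. eventually (\<lambda>(x', y). x' = x \<longrightarrow> y \<in> U) uniformity)"
    for U :: "'a torus set"
    by (rule open_torus_def)
  show "dist x y = 0 \<longleftrightarrow> x = y" for x y :: "'a torus"
  proof transfer
    fix x y :: "real ^ 'a"
    show "infdist (x - y) int_lattice = 0 \<longleftrightarrow> x - y \<in> int_lattice"
      using in_closed_iff_infdist_zero[OF closed_int_lattice] int_lattice_0 by blast
  qed
  show "dist x y \<le> dist x z + dist y z" for x y z :: "'a torus"
  proof transfer
    fix x y z :: "real ^ 'a"
    show "infdist (x - y) int_lattice
        \<le> infdist (x - z) int_lattice + infdist (y - z) int_lattice"
      using infdist_int_lattice_add[of "x - z" "- (y - z)"]
      by (simp add: infdist_int_lattice_minus del: minus_diff_eq)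
  qed
qed

end

lift_definition torus_proj :: "real ^ 'n \<Rightarrow> 'n::finite torus" is "\<lambda>x. x" .

lift_definition torus_shift :: "real ^ 'n \<Rightarrow> 'n::finite torus \<Rightarrow> 'n torus" is "\<lambda>a x. x + a"
  by simp

definition torus_lebesgue :: "'n::finite torus measure" where
  "torus_lebesgue = distr (uniform_measure lborel (cbox 0 (\<chi> i. 1))) borel torus_proj"


section \<open>Differentiability\<close>

text \<open>On a Euclidean space, having continuous iterated directional derivatives up to order
  \<open>k\<close> is the same as being of class \<open>C\<^sup>k\<close>.\<close>

primrec class_C :: "nat \<Rightarrow> ('a::euclidean_space \<Rightarrow> 'b::real_normed_vector) \<Rightarrow> bool" where
  "class_C 0 f \<longleftrightarrow> continuous_on UNIV f"
| "class_C (Suc k) f \<longleftrightarrow>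
     (\<forall>x. f differentiable (at x)) \<and> (\<forall>v. class_C k (\<lambda>x. frechet_derivative f (at x) v))"

definition gradient :: "('a::real_inner \<Rightarrow> real) \<Rightarrow> 'a \<Rightarrow> 'a" where
  "gradient f x = (THE D. GDERIV f x :> D)"


section \<open>Tonelli Hamiltonians\<close>

type_synonym 'n phase = "'n torus \<times> (real ^ 'n)"

definition lift_fun :: "('n::finite phase \<Rightarrow> real) \<Rightarrow> (real ^ 'n) \<times> (real ^ 'n) \<Rightarrow> real" where
  "lift_fun H = (\<lambda>(x, p). H (torus_proj x, p))"

definition tonelli :: "nat \<Rightarrow> ('n::finite phase \<Rightarrow> real) \<Rightarrow> bool" where
  "tonelli k H \<longleftrightarrow> k \<ge> 2 \<and> class_C k (lift_fun H) \<and>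
     (\<forall>q p v. v \<noteq> 0 \<longrightarrow>
        frechet_derivative (\<lambda>p'. frechet_derivative (\<lambda>p''. H (q, p'')) (at p') v) (at p) v > 0) \<and>
     (\<forall>q. filterlim (\<lambda>p. H (q, p) / norm p) at_top at_infinity)"

definition lagrangian :: "('n::finite phase \<Rightarrow> real) \<Rightarrow> 'n phase \<Rightarrow> real" where
  "lagrangian H = (\<lambda>(q, v). SUP p. p \<bullet> v - H (q, p))"

definition legendre :: "('n::finite phase \<Rightarrow> real) \<Rightarrow> 'n phase \<Rightarrow> 'n phase" where
  "legendre H = (\<lambda>(q, v). (q, gradient (\<lambda>w. lagrangian H (q, w)) v))"

definition ham_field ::
  "('n::finite phase \<Rightarrow> real) \<Rightarrow> (real ^ 'n) \<times> (real ^ 'n) \<Rightarrow> (real ^ 'n) \<times> (real ^ 'n)" where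
  "ham_field H = (\<lambda>(x, p).
     (gradient (\<lambda>p'. lift_fun H (x, p')) p, - gradient (\<lambda>x'. lift_fun H (x', p)) x))"

definition lifted_ham_flow ::
  "('n::finite phase \<Rightarrow> real) \<Rightarrow> real \<Rightarrow> (real ^ 'n) \<times> (real ^ 'n) \<Rightarrow> (real ^ 'n) \<times> (real ^ 'n)" where
  "lifted_ham_flow H t z =
     (THE \<gamma>. \<gamma> 0 = z \<and> (\<forall>s. (\<gamma> has_vector_derivative ham_field H (\<gamma> s)) (at s))) t"

text \<open>The flow of a Tonelli Hamiltonian is complete, since \<open>H\<close> is a first integral with compact
  sublevel sets. The lifted flow commutes with integer translations in \<open>x\<close>, so the chosen
  representative \<open>rep_torus q\<close> does not matter.\<close>

definition ham_flow :: "('n::finite phase \<Rightarrow> real) \<Rightarrow> real \<Rightarrow> 'n phase \<Rightarrow> 'n phase" where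
  "ham_flow H t = (\<lambda>(q, p). apfst torus_proj (lifted_ham_flow H t (rep_torus q, p)))"


section \<open>Lagrangian graphs\<close>

text \<open>Sections of the cotangent bundle are elements of the space of (bounded) continuous functions
  with the supremum metric; the torus being compact, this contains every Lipschitz map, and its
  topology is the uniform one.\<close>

type_synonym 'n covector_field = "'n torus \<Rightarrow>\<^sub>C (real ^ 'n)"

definition graph_of :: "'n::finite covector_field \<Rightarrow> 'n phase set" where
  "graph_of u = range (\<lambda>q. (q, apply_bcontfun u q))"

definition lagrangian_graph :: "'n::finite covector_field \<Rightarrow> bool" where
  "lagrangian_graph u \<longleftrightarrow>
     (\<exists>C. C-lipschitz_on UNIV (apply_bcontfun u)) \<and>
     (\<forall>x. \<exists>U f. open U \<and> x \<in> U \<and> (\<forall>y\<in>U. GDERIV f y :> apply_bcontfun u (torus_proj y)))"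

definition invariant_lagrangian_graph :: "('n::finite phase \<Rightarrow> real) \<Rightarrow> 'n covector_field \<Rightarrow> bool" where
  "invariant_lagrangian_graph H u \<longleftrightarrow>
     lagrangian_graph u \<and> (\<forall>t. ham_flow H t ` graph_of u = graph_of u)"

definition ergodic_linear_flow :: "real ^ 'n::finite \<Rightarrow> bool" where
  "ergodic_linear_flow \<alpha> \<longleftrightarrow>
     (\<forall>A \<in> sets borel. (\<forall>t. torus_shift (t *\<^sub>R \<alpha>) -` A = A) \<longrightarrow>
        emeasure torus_lebesgue A = 0 \<or> emeasure torus_lebesgue (- A) = 0)"

definition conjugated_to_linear_flow ::
  "('n::finite phase \<Rightarrow> real) \<Rightarrow> 'n covector_field \<Rightarrow> real ^ 'n \<Rightarrow> bool" where
  "conjugated_to_linear_flow H u \<alpha> \<longleftrightarrow>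
     (\<exists>h g. homeomorphism (graph_of u) UNIV h g \<and>
        (\<forall>t. \<forall>z \<in> graph_of u. h (ham_flow H t z) = torus_shift (t *\<^sub>R \<alpha>) (h z)))"

definition Upsilon :: "('n::finite phase \<Rightarrow> real) \<Rightarrow> 'n covector_field set" where
  "Upsilon H = {u. invariant_lagrangian_graph H u \<and>
     (\<exists>\<alpha>. ergodic_linear_flow \<alpha> \<and> conjugated_to_linear_flow H u \<alpha>)}"


section \<open>Invariant measures and rotation vectors\<close>

definition measure_support :: "'a::topological_space measure \<Rightarrow> 'a set" where
  "measure_support \<mu> = {x. \<forall>U. open U \<longrightarrow> x \<in> U \<longrightarrow> emeasure \<mu> U > 0}"

text \<open>Invariant Borel probability measures of the flow restricted to the graph, viewed as measures
  on the whole cotangent bundle.\<close>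

definition invariant_measures_on ::
  "('n::finite phase \<Rightarrow> real) \<Rightarrow> 'n covector_field \<Rightarrow> 'n phase measure set" where
  "invariant_measures_on H u = {\<mu>. sets \<mu> = sets borel \<and> emeasure \<mu> UNIV = 1 \<and>
     emeasure \<mu> (graph_of u) = 1 \<and> (\<forall>t. distr \<mu> borel (ham_flow H t) = \<mu>)}"

definition strictly_ergodic :: "('n::finite phase \<Rightarrow> real) \<Rightarrow> 'n covector_field \<Rightarrow> bool" where
  "strictly_ergodic H u \<longleftrightarrow>
     (\<exists>\<mu>. invariant_measures_on H u = {\<mu>} \<and> measure_support \<mu> = graph_of u)"

definition closed_one_form :: "('n::finite torus \<Rightarrow> real ^ 'n) \<Rightarrow> bool" where
  "closed_one_form \<eta> \<longleftrightarrow> (\<forall>k. class_C k (\<lambda>x. \<eta> (torus_proj x))) \<and>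
     (\<forall>x v w. frechet_derivative (\<lambda>y. \<eta> (torus_proj y)) (at x) v \<bullet> w =
              frechet_derivative (\<lambda>y. \<eta> (torus_proj y)) (at x) w \<bullet> v)"

text \<open>The class of a closed form, identified with the vector of its periods over the standard basis
  loops; those loops form the basis identifying the first homology with \<open>real ^ 'n\<close>, and the
  duality pairing becomes the inner product.\<close>

definition cohomology_class :: "('n::finite torus \<Rightarrow> real ^ 'n) \<Rightarrow> real ^ 'n" where
  "cohomology_class \<eta> =
     (\<chi> i. integral {0..1} (\<lambda>t. \<eta> (torus_proj (t *\<^sub>R axis i 1)) $ i))"

definition has_rotation_vector :: "'n::finite phase measure \<Rightarrow> real ^ 'n \<Rightarrow> bool" where
  "has_rotation_vector \<mu> \<rho> \<longleftrightarrow>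
     (\<forall>\<eta>. closed_one_form \<eta> \<longrightarrow>
        integrable \<mu> (\<lambda>(q, v). \<eta> q \<bullet> v) \<and>
        (LINT (q, v)|\<mu>. \<eta> q \<bullet> v) = cohomology_class \<eta> \<bullet> \<rho>)"

definition has_rotation_vector_dual ::
  "('n::finite phase \<Rightarrow> real) \<Rightarrow> 'n phase measure \<Rightarrow> real ^ 'n \<Rightarrow> bool" where
  "has_rotation_vector_dual H \<mu> \<rho> \<longleftrightarrow> has_rotation_vector (distr \<mu> borel (inv (legendre H))) \<rho>"

definition graph_has_rotation_vector ::
  "('n::finite phase \<Rightarrow> real) \<Rightarrow> 'n covector_field \<Rightarrow> real ^ 'n \<Rightarrow> bool" where
  "graph_has_rotation_vector H u \<rho> \<longleftrightarrow>
     (\<forall>\<mu> \<in> invariant_measures_on H u. has_rotation_vector_dual H \<mu> \<rho>)"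

end

theory Submission
  imports Defs "HOL-Probability.Helly_Selection" "HOL-Probability.Probability_Mass_Function"
begin

text \<open>
  Write \<open>f\<close> for a primitive on Euclidean space of the lift of an invariant Lagrangian graph \<open>u\<close>.

  The closure of \<open>Upsilon H\<close> consists of invariant Lagrangian graphs. Closedness and invariance
  pass to uniform limits; what has to be controlled is the Lipschitz constant. The function \<open>f\<close>
  solves the Hamilton-Jacobi equation \<open>H (x, \<nabla>f x) = const\<close> (lemma \<open>hamilton_jacobi\<close>), and the
  orbits in the graph calibrate it: with the Lagrangian normalised by the energy of the graph,
  \<open>f\<close> grows along an orbit by exactly the action, along any other curve by at most the action.
  Comparing the orbit that ends at \<open>x\<close>, and the orbit that starts at \<open>x\<close>, with their images
  under the shear that moves \<open>x\<close> to \<open>y\<close> shows that \<open>f\<close> differs from its first order expansion by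
  at most \<open>K \<bar>y - x\<bar>\<^sup>2\<close>, and \<open>K\<close> depends only on \<open>H\<close> and on a bound of \<open>u\<close> (lemma
  \<open>first_order_estimate\<close>). This gives a uniform Lipschitz bound, so the invariant Lagrangian
  graphs form a closed set (lemma \<open>invariant_lagrangian_graphs_closed\<close>).

  The generic set is cut out by a finite form of strict ergodicity. A graph is
  \<open>\<epsilon>\<close>-equidistributed if there are finitely many times \<open>t\<^sub>i\<close> and points \<open>y\<^sub>i\<close> such that the
  \<open>y\<^sub>i\<close> are \<open>\<epsilon>\<close>-dense and the points of every orbit at the times \<open>t\<^sub>i\<close> agree with the \<open>y\<^sub>i\<close>, up
  to a permutation and errors below \<open>\<epsilon>\<close>. Only finitely many times are involved, so this is an
  open condition in the uniform topology (lemma \<open>open_equidistributed\<close>). A graph in \<open>Upsilon H\<close>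
  satisfies it for every \<open>\<epsilon>\<close>: the orbits of an ergodic linear flow are dense, so the times can
  be chosen such that the flow approximates the translations by the points of a fine grid, and a
  translation permutes the grid up to the mesh size (lemma \<open>Upsilon_equidistributed\<close>). If a
  graph is \<open>\<epsilon>\<close>-equidistributed for every \<open>\<epsilon>\<close>, then the averages over the \<open>y\<^sub>i\<close> converge to the
  integral for any invariant measure, so there is at most one; a weak limit of these averages is
  invariant, so there is one; and finitely many preimages of any ball cover the torus, so its
  support is the whole graph (lemma \<open>equidistributed_strictly_ergodic\<close>).

  The three properties of such a graph follow. The pairing of a closed form with the velocity of
  the flow integrates, for an invariant measure, to the pairing of the class of the form with
  the mean velocity; so the rotation vector of an invariant measure exists and is its mean
  velocity. Two invariant graphs that meet share an orbit, and if this orbit is dense, they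
  coincide. Finally, let \<open>u\<close> and \<open>v\<close> carry invariant measures with the same rotation vector. The
  excess of \<open>H\<close> at \<open>v\<close> over the linearisation of \<open>H\<close> at \<open>u\<close> is nonnegative by convexity; by the
  Hamilton-Jacobi equation its integral depends only on energies, cohomology classes and the
  rotation vector, and it changes sign when \<open>u\<close> and \<open>v\<close> are exchanged. Hence it vanishes, and
  strict convexity forces the graphs to meet (lemma \<open>equal_rotation_vectors_meet\<close>).
\<close>

section \<open>Ordinary differential equations\<close>

lemma continuous_antiderivative:
  fixes h :: "real \<Rightarrow> 'a::euclidean_space"
  assumes "continuous_on UNIV h"
  obtains A where "A 0 = 0" "\<And>t. (A has_vector_derivative h t) (at t)"
proof -
  \<comment> \<open>for each \<open>t\<close> one of the two intervals is empty or a point, so that \<open>?A\<close> is an oriented integral\<close>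
  let ?A = "\<lambda>t. integral {0..t} h - integral {t..0} h"
  have A0: "?A 0 = 0" by simp
  have ii: "h integrable_on {a..b}" for a b
    using assms continuous_on_subset by (intro integrable_continuous_real) blast
  have "(?A has_vector_derivative h t) (at t)" for t
  proof -
    define N where "N = \<bar>t\<bar> + 1"
    have eq: "?A s = integral {-N..s} h - integral {-N..0} h" if "s \<in> {-N<..<N}" for s
    proof (cases "s \<ge> 0")
      case True
      then have "integral {-N..0} h + integral {0..s} h = integral {-N..s} h"
        by (intro Henstock_Kurzweil_Integration.integral_combine ii) (auto simp: N_def)
      moreover have "integral {s..0} h = 0" using True by (cases "s = 0") auto
      ultimately show ?thesis by (simp add: algebra_simps)
    next
      case False
      then have "integral {-N..s} h + integral {s..0} h = integral {-N..0} h"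
        using that by (intro Henstock_Kurzweil_Integration.integral_combine ii) auto
      moreover have "integral {0..s} h = 0" using False by auto
      ultimately show ?thesis by (simp add: algebra_simps)
    qed
    have t: "t \<in> {-N<..<N}" unfolding N_def by auto
    have "((\<lambda>u. integral {-N..u} h) has_vector_derivative h t) (at t within {-N..N})"
      using assms continuous_on_subset t by (intro integral_has_vector_derivative) (blast, auto)
    then have "((\<lambda>u. integral {-N..u} h) has_vector_derivative h t) (at t)"
      using t by (subst (asm) at_within_interior) auto
    then have "((\<lambda>u. integral {-N..u} h - integral {-N..0} h) has_vector_derivative h t) (at t)"
      by (auto intro!: derivative_eq_intros)
    then show ?thesis
      by (rule has_vector_derivative_transform_within_open[where S="{-N<..<N}"]) (use t eq in auto)
  qed
  with A0 show thesis by (rule that)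
qed

lemma reversed_curve:
  assumes "\<And>s. (\<gamma> has_vector_derivative V s) (at s)"
  shows "((\<lambda>s. \<gamma> (- s)) has_vector_derivative - V (- s)) (at s)"
proof -
  have "((\<lambda>t. - t) has_vector_derivative (- 1 :: real)) (at s)"
    by (auto intro!: derivative_eq_intros simp flip: has_real_derivative_iff_has_vector_derivative)
  from vector_diff_chain_at[OF this assms] show ?thesis by (simp add: o_def)
qed

text \<open>The case of negative \<open>t\<close> is the case of positive \<open>t\<close> for the reversed curve. With the weight
  \<open>exp (k \<bar>t\<bar>)\<close> integration gains a factor \<open>1 / k\<close>, which makes the Picard operator below a
  contraction on the whole real line at once.\<close>

lemma exponential_growth_of_antiderivative:
  fixes A h :: "real \<Rightarrow> 'a::euclidean_space"
  assumes A: "A 0 = 0" "\<And>t. (A has_vector_derivative h t) (at t)"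
    and k: "k > 0" and h: "\<And>t. norm (h t) \<le> C * exp (k * \<bar>t\<bar>)"
  shows "norm (A t) \<le> C / k * exp (k * \<bar>t\<bar>)"
proof -
  have pos: "norm (A t) \<le> C / k * exp (k * t)"
    if A: "A 0 = 0" "\<And>t. (A has_vector_derivative h t) (at t)"
    and h: "\<And>t. norm (h t) \<le> C * exp (k * \<bar>t\<bar>)" and t: "t \<ge> 0"
    for A h :: "real \<Rightarrow> 'a" and t
  proof (cases "t = 0")
    case True
    have "0 \<le> C" using order_trans[OF norm_ge_zero h[of 0]] by simp
    then show ?thesis using A True k by simp
  next
    case False
    have "norm (A t - A 0) \<le> C / k * exp (k * t) - C / k * exp (k * 0)"
    proof (rule differentiable_bound_general[where f' = h and \<phi>' = "\<lambda>s. C * exp (k * s)"])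
      show "0 < t" using False t by simp
      show "continuous_on {0..t} A"
        using A(2) by (meson continuous_at_imp_continuous_on has_vector_derivative_continuous)
      show "continuous_on {0..t} (\<lambda>t. C / k * exp (k * t))" by (intro continuous_intros)
      show "((\<lambda>t. C / k * exp (k * t)) has_vector_derivative C * exp (k * x)) (at x)" for x
        unfolding has_real_derivative_iff_has_vector_derivative[symmetric]
        using k by (auto intro!: derivative_eq_intros)
      show "norm (h x) \<le> C * exp (k * x)" if "0 < x" "x < t" for x using h[of x] that by simp
    qed (use A in auto)
    moreover have "0 \<le> C / k" using order_trans[OF norm_ge_zero h[of 0]] k by simp
    ultimately show ?thesis using A k by simp
  qed
  show ?thesis
  proof (cases "t \<ge> 0")
    case True
    then show ?thesis using pos[OF A h, of t] by simp
  next
    case False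
    have "norm (A (- (- t))) \<le> C / k * exp (k * (- t))"
      using A h False by (intro pos[of "\<lambda>t. A (- t)" "\<lambda>t. - h (- t)"] reversed_curve) (auto, metis abs_minus_cancel)
    with False show ?thesis by simp
  qed
qed

text \<open>Picard iteration for \<open>exp (- k \<bar>t\<bar>) \<gamma> t\<close> in the space of bounded continuous functions, with
  \<open>k > 2 C\<close>. The bound on the field keeps the iterates in this space.\<close>

theorem bounded_lipschitz_field_has_global_flow:
  fixes X :: "'a::euclidean_space \<Rightarrow> 'a"
  assumes lip: "C-lipschitz_on UNIV X" and M: "\<And>x. norm (X x) \<le> M"
  obtains \<gamma> where "\<gamma> 0 = z" "\<And>t. (\<gamma> has_vector_derivative X (\<gamma> t)) (at t)"
proof -
  define k where "k = 2 * C + 1"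
  have C: "C \<ge> 0" using lip by (rule lipschitz_on_nonneg)
  have k: "k > 0" "C / k \<le> 1 / 2" using C by (auto simp: k_def field_simps)
  have M0: "M \<ge> 0" using M norm_ge_zero order_trans by blast
  define orb where "orb g t = exp (k * \<bar>t\<bar>) *\<^sub>R apply_bcontfun g t" for g :: "real \<Rightarrow>\<^sub>C 'a" and t
  have cX: "continuous_on UNIV (\<lambda>t. X (orb g t))" for g
  proof -
    have "continuous_on UNIV X" using lip by (rule lipschitz_on_continuous_on)
    moreover have "continuous_on UNIV (orb g)" unfolding orb_def by (intro continuous_intros) auto
    ultimately show ?thesis by (metis continuous_on_compose2 subset_UNIV)
  qed
  have "\<exists>A. A 0 = 0 \<and> (\<forall>t. (A has_vector_derivative X (orb g t)) (at t))" for g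
    using continuous_antiderivative[OF cX[of g]] by metis
  then obtain A where A0: "\<And>g. A g 0 = 0"
    and A: "\<And>g t. (A g has_vector_derivative X (orb g t)) (at t)" by metis
  define T where "T g = Bcontfun (\<lambda>t. exp (- (k * \<bar>t\<bar>)) *\<^sub>R (z + A g t))" for g
  have cA: "continuous_on UNIV (A g)" for g
    using A by (meson continuous_at_imp_continuous_on has_vector_derivative_continuous)
  have bA: "norm (A g t) \<le> M / k * exp (k * \<bar>t\<bar>)" for g t
  proof (rule exponential_growth_of_antiderivative[OF A0 A k(1)])
    show "norm (X (orb g t)) \<le> M * exp (k * \<bar>t\<bar>)" for t
      using M[of "orb g t"] mult_left_mono[of 1 "exp (k * \<bar>t\<bar>)" M] M0 k(1)
      by (simp del: mult_le_cancel_left1) 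
  qed
  have T: "apply_bcontfun (T g) t = exp (- (k * \<bar>t\<bar>)) *\<^sub>R (z + A g t)" for g t
  proof -
    have "(\<lambda>t. exp (- (k * \<bar>t\<bar>)) *\<^sub>R (z + A g t)) \<in> bcontfun"
    proof (rule bcontfun_normI)
      show "continuous_on UNIV (\<lambda>t. exp (- (k * \<bar>t\<bar>)) *\<^sub>R (z + A g t))"
        by (intro continuous_intros cA)
      show "norm (exp (- (k * \<bar>t\<bar>)) *\<^sub>R (z + A g t)) \<le> norm z + M / k" for t
      proof -
        have "norm (exp (- (k * \<bar>t\<bar>)) *\<^sub>R (z + A g t))
           \<le> exp (- (k * \<bar>t\<bar>)) * (norm z + M / k * exp (k * \<bar>t\<bar>))"
          using norm_triangle_ineq[of z "A g t"] bA[of g t] by (simp add: mult_left_mono)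
        also have "\<dots> = exp (- (k * \<bar>t\<bar>)) * norm z + M / k"
          by (simp add: distrib_left exp_minus)
        also have "\<dots> \<le> norm z + M / k"
          using k(1) by (auto intro!: mult_left_le_one_le)
        finally show ?thesis .
      qed
    qed
    then show ?thesis unfolding T_def by (simp add: Bcontfun_inverse)
  qed
  have contr: "dist (T g) (T h) \<le> 1 / 2 * dist g h" for g h
  proof (rule dist_bound)
    fix t
    have "norm (A g t - A h t) \<le> (C * dist g h) / k * exp (k * \<bar>t\<bar>)"
    proof (rule exponential_growth_of_antiderivative[where h = "\<lambda>t. X (orb g t) - X (orb h t)"])
      show "((\<lambda>t. A g t - A h t) has_vector_derivative X (orb g t) - X (orb h t)) (at t)" for t
        using A by (intro derivative_intros)
      show "norm (X (orb g t) - X (orb h t)) \<le> C * dist g h * exp (k * \<bar>t\<bar>)" for t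
      proof -
        have "norm (X (orb g t) - X (orb h t)) \<le> C * dist (orb g t) (orb h t)"
          using lip by (auto simp: lipschitz_on_def dist_norm)
        also have "dist (orb g t) (orb h t) = exp (k * \<bar>t\<bar>) * dist (apply_bcontfun g t) (apply_bcontfun h t)"
          by (simp add: orb_def dist_norm flip: scaleR_diff_right)
        also have "\<dots> \<le> exp (k * \<bar>t\<bar>) * dist g h" by (intro mult_left_mono dist_bounded) auto
        finally have "norm (X (orb g t) - X (orb h t)) \<le> C * (exp (k * \<bar>t\<bar>) * dist g h)"
          using C by (meson mult_left_mono order_trans)
        then show ?thesis by (simp add: mult_ac)
      qed
    qed (use A0 k in auto)
    then have "exp (- (k * \<bar>t\<bar>)) * norm (A g t - A h t) \<le> exp (- (k * \<bar>t\<bar>)) * ((C * dist g h) / k * exp (k * \<bar>t\<bar>))"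
      by (intro mult_left_mono) auto
    also have "\<dots> = C / k * dist g h" by (simp add: exp_minus field_simps)
    also have "\<dots> \<le> 1 / 2 * dist g h" using k by (intro mult_right_mono) auto
    finally show "dist (apply_bcontfun (T g) t) (apply_bcontfun (T h) t) \<le> 1 / 2 * dist g h"
      by (simp add: T dist_norm flip: scaleR_diff_right)
  qed
  obtain g where g: "T g = g"
    using banach_fix_type[of "1/2" T] contr by auto
  have orb: "orb g t = z + A g t" for t
    using T[of g t] by (simp add: g orb_def exp_minus)
  show thesis
  proof
    show "(\<lambda>t. z + A g t) 0 = z" by (simp add: A0)
    show "((\<lambda>t. z + A g t) has_vector_derivative X ((\<lambda>t. z + A g t) t)) (at t)" for t
      using A[of g t] by (auto simp: orb intro!: derivative_eq_intros)
  qed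
qed

text \<open>The function \<open>\<bar>\<gamma> s - \<delta> s\<bar>\<^sup>2 exp (- 2 C s)\<close> has nonpositive derivative.\<close>

lemma gronwall:
  fixes \<gamma> \<delta> :: "real \<Rightarrow> 'a::euclidean_space"
  assumes t: "0 \<le> t"
    and d: "\<And>s. s \<in> {0..t} \<Longrightarrow> (\<gamma> has_vector_derivative \<gamma>' s) (at s)"
      "\<And>s. s \<in> {0..t} \<Longrightarrow> (\<delta> has_vector_derivative \<delta>' s) (at s)"
    and lip: "\<And>s. s \<in> {0..t} \<Longrightarrow> norm (\<gamma>' s - \<delta>' s) \<le> C * norm (\<gamma> s - \<delta> s)"
  shows "norm (\<gamma> t - \<delta> t) \<le> exp (C * t) * norm (\<gamma> 0 - \<delta> 0)"
proof -
  define e where "e s = \<gamma> s - \<delta> s" for s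
  define w where "w s = (e s \<bullet> e s) * exp (- (2 * C * s))" for s
  have de: "(e has_vector_derivative \<gamma>' s - \<delta>' s) (at s)" if "s \<in> {0..t}" for s
    unfolding e_def using d that by (intro derivative_intros)
  have "w t \<le> w 0"
  proof (rule DERIV_nonpos_imp_nonincreasing[OF t])
    fix s assume s: "0 \<le> s" "s \<le> t"
    have "(w has_real_derivative (2 * (e s \<bullet> (\<gamma>' s - \<delta>' s)) - 2 * C * (e s \<bullet> e s)) * exp (- (2 * C * s))) (at s)"
      unfolding w_def has_field_derivative_def
      using de[of s, unfolded has_vector_derivative_def] s
      by (auto intro!: derivative_eq_intros simp: fun_eq_iff inner_commute algebra_simps)
    moreover have "e s \<bullet> (\<gamma>' s - \<delta>' s) \<le> C * (e s \<bullet> e s)"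
    proof -
      have "e s \<bullet> (\<gamma>' s - \<delta>' s) \<le> norm (e s) * norm (\<gamma>' s - \<delta>' s)" by (rule norm_cauchy_schwarz)
      also have "\<dots> \<le> norm (e s) * (C * norm (e s))"
        using lip[of s] s by (intro mult_left_mono) (auto simp: e_def)
      finally show ?thesis by (simp add: dot_square_norm power2_eq_square mult_ac)
    qed
    then have "(2 * (e s \<bullet> (\<gamma>' s - \<delta>' s)) - 2 * C * (e s \<bullet> e s)) * exp (- (2 * C * s)) \<le> 0"
      by (intro mult_nonpos_nonneg) (auto simp: algebra_simps)
    ultimately show "\<exists>y. (w has_real_derivative y) (at s) \<and> y \<le> 0" by blast
  qed
  then have "(e t \<bullet> e t) * exp (- (2 * C * t)) \<le> e 0 \<bullet> e 0" by (simp add: w_def)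
  then have "(e t \<bullet> e t) * exp (- (2 * C * t)) * exp (2 * C * t) \<le> (e 0 \<bullet> e 0) * exp (2 * C * t)"
    by (intro mult_right_mono) auto
  then have "e t \<bullet> e t \<le> (e 0 \<bullet> e 0) * exp (2 * C * t)"
    by (simp add: mult.assoc flip: exp_add)
  also have "exp (2 * C * t) = (exp (C * t))\<^sup>2"
    by (simp add: exp_double mult.assoc)
  finally have "(norm (e t))\<^sup>2 \<le> (exp (C * t) * norm (e 0))\<^sup>2"
    by (simp add: power_mult_distrib dot_square_norm mult_ac)
  then have "norm (e t) \<le> exp (C * t) * norm (e 0)"
    by (rule power2_le_imp_le) auto
  then show ?thesis by (simp add: e_def)
qed

section \<open>The torus as a quotient of Euclidean space\<close>

lemma torus_proj_eq_iff: "torus_proj x = torus_proj y \<longleftrightarrow> x - y \<in> int_lattice"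
  by transfer simp

lemma torus_proj_add_lattice: "a \<in> int_lattice \<Longrightarrow> torus_proj (x + a) = torus_proj x"
  by (simp add: torus_proj_eq_iff)

lemma torus_proj_rep [simp]: "torus_proj (rep_torus q) = q"
  using Quotient3_abs_rep[OF Quotient3_torus, of q] unfolding torus_proj_def by simp

lemma torus_cases: obtains x where "q = torus_proj x"
  using torus_proj_rep by metis

lemma torus_shift_proj: "torus_shift a (torus_proj x) = torus_proj (x + a)"
  by transfer (simp add: int_lattice_0)

lemma dist_torus_proj: "dist (torus_proj x) (torus_proj y) = infdist (x - y) int_lattice"
  by transfer simp

lemma dist_torus_proj_le: "dist (torus_proj x) (torus_proj y) \<le> dist x y"
  using infdist_le[OF int_lattice_0, of "x - y"] by (simp add: dist_torus_proj dist_norm)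

lemma dist_torus_shift: "dist (torus_shift a q) (torus_shift a q') = dist q q'"
proof -
  obtain x where "q = torus_proj x" by (rule torus_cases)
  moreover obtain y where "q' = torus_proj y" by (rule torus_cases)
  ultimately show ?thesis by (simp add: torus_shift_proj dist_torus_proj)
qed

text \<open>The infimum that defines the flat distance is attained because the lattice is closed. Hence
  the projection is locally isometric, and continuity on the torus can be tested on lifts.\<close>

lemma nearest_lift:
  obtains y where "torus_proj y = q" "dist x y = dist (torus_proj x) q"
proof -
  obtain y where y: "q = torus_proj y" by (rule torus_cases)
  obtain a where a: "a \<in> int_lattice" "infdist (x - y) int_lattice = dist (x - y) a"
    using infdist_attains_inf[OF closed_int_lattice] int_lattice_0 by blast
  show thesis
  proof (rule that[of "y + a"])
    show "torus_proj (y + a) = q" using a y by (simp add: torus_proj_add_lattice)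
    show "dist x (y + a) = dist (torus_proj x) q"
      using a y by (simp add: dist_torus_proj dist_norm algebra_simps)
  qed
qed

lemma continuous_on_torus_proj: "continuous_on S torus_proj"
  by (rule continuous_on_subset[of UNIV])
    (auto simp: continuous_on_iff intro: le_less_trans[OF dist_torus_proj_le])

lemma continuous_on_torus_proj' [continuous_intros]:
  "continuous_on S f \<Longrightarrow> continuous_on S (\<lambda>x. torus_proj (f x))"
  using continuous_on_compose[OF _ continuous_on_torus_proj] by (simp add: o_def)

lemma lift_to_unit_box:
  obtains x where "q = torus_proj x" "x \<in> cbox 0 (\<chi> i. 1)"
proof -
  obtain y where y: "q = torus_proj y" by (rule torus_cases)
  let ?a = "\<chi> i. - real_of_int \<lfloor>y $ i\<rfloor>"
  have "?a \<in> int_lattice" by (auto simp: int_lattice_def)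
  then have "q = torus_proj (y + ?a)" by (simp add: y torus_proj_add_lattice)
  moreover have "y + ?a \<in> cbox 0 (\<chi> i. 1)"
    by (auto simp: mem_box_cart, linarith+)
  ultimately show thesis by (rule that)
qed

lemma compact_torus: "compact (UNIV :: 'n::finite torus set)"
proof -
  have "(UNIV :: 'n torus set) = torus_proj ` cbox 0 (\<chi> i. 1)"
    using lift_to_unit_box by (metis UNIV_eq_I image_eqI)
  then show ?thesis
    by (metis compact_cbox compact_continuous_image continuous_on_torus_proj)
qed

lemma continuous_on_torusI:
  fixes f :: "'n::finite torus \<Rightarrow> 'a::metric_space"
  assumes "continuous_on UNIV (\<lambda>x. f (torus_proj x))"
  shows "continuous_on UNIV f"
  unfolding continuous_on_iff
proof (intro ballI allI impI)
  fix q :: "'n torus" and e :: real assume "e > 0"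
  obtain x where x: "q = torus_proj x" by (rule torus_cases)
  obtain d where d: "d > 0" "\<And>y. dist y x < d \<Longrightarrow> dist (f (torus_proj y)) (f (torus_proj x)) < e"
    using assms \<open>e > 0\<close> unfolding continuous_on_iff by (metis UNIV_I)
  have "dist (f q') (f q) < e" if "dist q' q < d" for q'
  proof -
    obtain y where "torus_proj y = q'" "dist x y = dist (torus_proj x) q'" by (rule nearest_lift)
    with d(2)[of y] that x show ?thesis by (simp add: dist_commute)
  qed
  with d(1) show "\<exists>d>0. \<forall>x'\<in>UNIV. dist x' q < d \<longrightarrow> dist (f x') (f q) < e" by blast
qed

lemma continuous_on_torus_timesI:
  fixes f :: "'n::finite torus \<times> 'b::metric_space \<Rightarrow> 'a::metric_space"
  assumes "continuous_on UNIV (\<lambda>(x, p). f (torus_proj x, p))"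
  shows "continuous_on UNIV f"
  unfolding continuous_on_iff
proof (intro ballI allI impI)
  fix z :: "'n torus \<times> 'b" and e :: real assume "e > 0"
  obtain x p where z: "z = (torus_proj x, p)" by (metis surj_pair torus_proj_rep)
  obtain d where d: "d > 0"
    "\<And>y. dist y (x, p) < d \<Longrightarrow> dist (f (torus_proj (fst y), snd y)) (f (torus_proj x, p)) < e"
    using assms[unfolded continuous_on_iff, rule_format, of "(x, p)" e] \<open>e > 0\<close>
    by (auto simp: case_prod_beta)
  have "dist (f z') (f z) < e" if "dist z' z < d" for z'
  proof -
    obtain y where y: "torus_proj y = fst z'" "dist x y = dist (torus_proj x) (fst z')"
      by (rule nearest_lift)
    have "dist (y, snd z') (x, p) = dist z' z"
      using y by (simp add: z dist_prod_def dist_commute)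
    with d(2)[of "(y, snd z')"] that y z show ?thesis by simp
  qed
  with d(1) show "\<exists>d>0. \<forall>x'\<in>UNIV. dist x' z < d \<longrightarrow> dist (f x') (f z) < e" by blast
qed

lemma axis_in_int_lattice [simp]: "axis i 1 \<in> int_lattice"
  by (simp add: int_lattice_def axis_def)

text \<open>Used to pass from invariance under the coordinate translations to invariance under the whole
  lattice.\<close>

lemma int_lattice_generated_by_axes:
  fixes S :: "(real ^ 'n) set"
  assumes "0 \<in> S" and add: "\<And>a b. a \<in> S \<Longrightarrow> b \<in> S \<Longrightarrow> a + b \<in> S" and minus: "\<And>a. a \<in> S \<Longrightarrow> - a \<in> S"
    and ax: "\<And>i. axis i 1 \<in> S"
  shows "int_lattice \<subseteq> S"
proof
  fix a :: "real ^ 'n" assume a: "a \<in> int_lattice"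
  have nat: "real k *\<^sub>R axis i 1 \<in> S" for k i
    by (induction k) (auto simp: assms(1) algebra_simps intro: add ax)
  have int: "of_int k *\<^sub>R axis i 1 \<in> S" for k i
    using nat[of "nat k" i] minus[OF nat[of "nat (- k)" i]]
    by (cases "k \<ge> 0") auto
  have coord: "a $ i *\<^sub>R axis i 1 \<in> S" for i
    using a int by (auto simp: int_lattice_def elim!: Ints_cases dest: spec[of _ i])
  have "(\<Sum>i\<in>I. a $ i *\<^sub>R axis i 1) \<in> S" if "finite I" for I
    using that by (induction I) (auto simp: assms(1) intro: add coord)
  moreover have "(\<Sum>i\<in>UNIV. a $ i *\<^sub>R axis i 1) = a"
    using basis_expansion[of a] by (simp add: scalar_mult_eq_scaleR)
  ultimately show "a \<in> S" by (metis finite_class.finite_UNIV)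
qed

lemma periodic_descends:
  fixes f :: "real ^ 'n::finite \<Rightarrow> 'a"
  assumes "\<And>x a. a \<in> int_lattice \<Longrightarrow> f (x + a) = f x"
  obtains F where "\<And>x. F (torus_proj x) = f x"
proof
  show "f (rep_torus (torus_proj x)) = f x" for x
    using assms[of "rep_torus (torus_proj x) - x" x] by (simp flip: torus_proj_eq_iff)
qed

section \<open>Primitives of vector fields\<close>

text \<open>The value at \<open>x\<close> of the line integral of \<open>u\<close> along the segment from the origin. It depends
  continuously on \<open>u\<close>, so primitives chosen in this way converge along with their gradients.\<close>

definition radial_primitive :: "('a::euclidean_space \<Rightarrow> 'a) \<Rightarrow> 'a \<Rightarrow> real" where
  "radial_primitive u x = integral {0..1} (\<lambda>t. u (t *\<^sub>R x) \<bullet> x)"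

lemma GDERIV_along_curve:
  assumes "GDERIV f (\<gamma> s) :> D" "(\<gamma> has_vector_derivative v) (at s within S)"
  shows "((\<lambda>s. f (\<gamma> s)) has_real_derivative D \<bullet> v) (at s within S)"
proof -
  have "((\<lambda>s. f (\<gamma> s)) has_derivative (\<lambda>h. (h *\<^sub>R v) \<bullet> D)) (at s within S)"
    using has_derivative_compose[of \<gamma> "\<lambda>h. h *\<^sub>R v" s S f "\<lambda>h. h \<bullet> D"] assms
    unfolding gderiv_def has_vector_derivative_def by blast
  then show ?thesis
    unfolding has_field_derivative_def
    by (rule has_derivative_eq_rhs) (auto simp: fun_eq_iff inner_commute)
qed

lemma GDERIV_mean_value:
  fixes f :: "'a::real_inner \<Rightarrow> real"
  assumes "\<And>s. s \<in> {0..1} \<Longrightarrow> GDERIV f (a + s *\<^sub>R (b - a)) :> g (a + s *\<^sub>R (b - a))"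
  obtains s where "s \<in> {0<..<1}" "f b - f a = g (a + s *\<^sub>R (b - a)) \<bullet> (b - a)"
proof -
  let ?h = "\<lambda>s. f (a + s *\<^sub>R (b - a))"
  have d: "(?h has_real_derivative g (a + s *\<^sub>R (b - a)) \<bullet> (b - a)) (at s)" if "s \<in> {0..1}" for s
    by (intro GDERIV_along_curve assms that) (auto intro!: derivative_eq_intros)
  obtain s where "0 < s" "s < 1" "?h 1 - ?h 0 = (1 - 0) * (g (a + s *\<^sub>R (b - a)) \<bullet> (b - a))"
    using MVT2[of 0 1 ?h "\<lambda>s. g (a + s *\<^sub>R (b - a)) \<bullet> (b - a)"] d by auto
  then show thesis by (intro that[of s]) auto
qed

lemma first_order_remainder:
  fixes f :: "'a::real_inner \<Rightarrow> real"
  assumes "\<And>s. s \<in> {0..1} \<Longrightarrow> GDERIV f (a + s *\<^sub>R (b - a)) :> g (a + s *\<^sub>R (b - a))"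
    and L: "\<And>s. s \<in> {0..1} \<Longrightarrow> norm (g (a + s *\<^sub>R (b - a)) - g a) \<le> L * norm (b - a)"
  shows "\<bar>f b - f a - g a \<bullet> (b - a)\<bar> \<le> L * (norm (b - a))\<^sup>2"
proof -
  obtain s where s: "s \<in> {0<..<1}" "f b - f a = g (a + s *\<^sub>R (b - a)) \<bullet> (b - a)"
    using GDERIV_mean_value[OF assms(1)] by blast
  then have "\<bar>f b - f a - g a \<bullet> (b - a)\<bar> = \<bar>(g (a + s *\<^sub>R (b - a)) - g a) \<bullet> (b - a)\<bar>"
    by (simp add: inner_diff_left)
  also have "\<dots> \<le> norm (g (a + s *\<^sub>R (b - a)) - g a) * norm (b - a)"
    by (rule Cauchy_Schwarz_ineq2)
  also have "\<dots> \<le> (L * norm (b - a)) * norm (b - a)"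
    using s by (intro mult_right_mono L) auto
  finally show ?thesis by (simp add: power2_eq_square mult_ac)
qed

text \<open>Test the estimate on the triangle \<open>x\<close>, \<open>y\<close>, \<open>y + w\<close>, where \<open>w\<close> has the direction of
  \<open>g y - g x\<close> and the length of \<open>x - y\<close>; the three remainders are at most \<open>K d\<^sup>2\<close>, \<open>K d\<^sup>2\<close>
  and \<open>4 K d\<^sup>2\<close>.\<close>

lemma lipschitz_of_first_order_remainder:
  fixes f :: "'a::real_inner \<Rightarrow> real"
  assumes "\<And>a b. \<bar>f b - f a - g a \<bullet> (b - a)\<bar> \<le> K * (norm (b - a))\<^sup>2"
  shows "norm (g x - g y) \<le> 6 * K * norm (x - y)"
proof (cases "g x = g y")
  case True
  have "K * (norm (x - y))\<^sup>2 \<ge> 0" using assms[of x y] by linarith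
  then have "x \<noteq> y \<Longrightarrow> K \<ge> 0" by (simp add: zero_le_mult_iff)
  then have "K * norm (x - y) \<ge> 0" by (cases "x = y") auto
  then show ?thesis using True by simp
next
  case False
  define d where "d = norm (x - y)"
  define e where "e = g y - g x"
  define w where "w = (d / norm e) *\<^sub>R e"
  have e: "norm e > 0" using False by (simp add: e_def)
  have w: "norm w = d" using e by (simp add: w_def d_def)
  have K0: "x \<noteq> y \<Longrightarrow> K \<ge> 0"
    using assms[of x y] order_trans[OF abs_ge_zero assms[of x y]] by (simp add: zero_le_mult_iff)
  have xy: "x \<noteq> y"
  proof
    assume "x = y" then show False using False by simp
  qed
  have "norm (y + w - x) \<le> 2 * d"
    using norm_triangle_ineq[of "y - x" w] w by (simp add: d_def norm_minus_commute algebra_simps)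
  then have "(norm (y + w - x))\<^sup>2 \<le> (2 * d)\<^sup>2" by (rule power_mono) simp
  then have 4: "K * (norm (y + w - x))\<^sup>2 \<le> K * (4 * d\<^sup>2)"
    using K0[OF xy] by (intro mult_left_mono) (auto simp: power_mult_distrib)
  have "g y \<bullet> w \<le> f (y + w) - f y + K * d\<^sup>2"
    using assms[where a = y and b = "y + w"] w by (simp add: abs_le_iff)
  moreover have "f (y + w) - f x \<le> g x \<bullet> (y + w - x) + K * (4 * d\<^sup>2)"
    using assms[where a = x and b = "y + w"] 4 by (simp add: abs_le_iff)
  moreover have "g x \<bullet> (y - x) - K * d\<^sup>2 \<le> f y - f x"
    using assms[where a = x and b = y] by (simp add: abs_le_iff d_def norm_minus_commute)
  ultimately have "e \<bullet> w \<le> 6 * K * d\<^sup>2"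
    by (simp add: e_def inner_diff_left inner_diff_right inner_add_right)
  moreover have "e \<bullet> w = norm e * d"
    using e by (simp add: w_def dot_square_norm power2_eq_square)
  ultimately have "norm e * d \<le> (6 * K * d) * d" by (simp add: power2_eq_square mult_ac)
  then have "norm e \<le> 6 * K * d" using xy by (simp add: d_def)
  then show ?thesis by (simp add: e_def d_def norm_minus_commute)
qed

lemma fundamental_theorem_along_ray:
  assumes ab: "a \<le> b" and f: "\<And>t. t \<in> {a..b} \<Longrightarrow> GDERIV f (t *\<^sub>R y) :> u (t *\<^sub>R y)"
  shows "((\<lambda>t. u (t *\<^sub>R y) \<bullet> y) has_integral f (b *\<^sub>R y) - f (a *\<^sub>R y)) {a..b}"
proof (rule fundamental_theorem_of_calculus[OF ab])
  fix t assume "t \<in> {a..b}"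
  then show "((\<lambda>t. f (t *\<^sub>R y)) has_vector_derivative u (t *\<^sub>R y) \<bullet> y) (at t within {a..b})"
    unfolding has_real_derivative_iff_has_vector_derivative[symmetric]
    by (intro GDERIV_along_curve f) (auto intro!: derivative_eq_intros)
qed

text \<open>Cover the segment from \<open>0\<close> to \<open>x\<close> by finitely many balls of the same radius on which \<open>u\<close> has
  primitives. For \<open>y\<close> near \<open>x\<close> the integral over the segment from \<open>0\<close> to \<open>y\<close> is a sum of increments
  of these primitives, and in the sum of their derivatives at \<open>x\<close> the intermediate terms
  \<open>s u (s x)\<close> cancel. The induction is over the number of subintervals.\<close>

theorem radial_primitive_of_local_gradient:
  fixes u :: "'a::euclidean_space \<Rightarrow> 'a"
  assumes cont: "continuous_on UNIV u"
    and loc: "\<And>x. \<exists>U f. open U \<and> x \<in> U \<and> (\<forall>y\<in>U. GDERIV f y :> u y)"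
  shows "GDERIV (radial_primitive u) x :> u x"
proof -
  define \<C> where "\<C> = {U. open U \<and> (\<exists>f. \<forall>y\<in>U. GDERIV f y :> u y)}"
  have "compact ((\<lambda>t. t *\<^sub>R x) ` {0..1})" by (intro compact_continuous_image continuous_intros) auto
  moreover have "(\<lambda>t. t *\<^sub>R x) ` {0..1} \<subseteq> \<Union>\<C>" using loc unfolding \<C>_def by blast
  moreover have "open U" if "U \<in> \<C>" for U using that unfolding \<C>_def by blast
  ultimately obtain e where e: "e > 0" "\<And>z. z \<in> (\<lambda>t. t *\<^sub>R x) ` {0..1} \<Longrightarrow> \<exists>U\<in>\<C>. ball z e \<subseteq> U"
    by (rule Heine_Borel_lemma) blast+
  \<comment> \<open>the points \<open>t *\<^sub>R y\<close> with \<open>t\<close> in a subinterval of length \<open>1 / N\<close> then stay in one ball of the cover\<close>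
  obtain N :: nat where N: "N > 0" "norm x / N < e / 2"
  proof -
    obtain N :: nat where "real N > 2 * norm x / e" using reals_Archimedean2 by blast
    moreover have "2 * norm x / e \<ge> 0" using e by simp
    ultimately have "real N > 0" "2 * norm x < real N * e"
      using e(1) by (linarith, simp add: pos_divide_less_eq)
    then show thesis by (intro that[of N]) (simp_all add: field_simps)
  qed
  have ii: "(\<lambda>t. u (t *\<^sub>R y) \<bullet> y) integrable_on {a..b}" for a b y
    using continuous_on_subset[OF cont]
    by (intro integrable_continuous_real continuous_intros continuous_on_compose2[OF cont]) auto
  have "k \<le> N \<Longrightarrow> GDERIV (\<lambda>y. integral {0..real k / N} (\<lambda>t. u (t *\<^sub>R y) \<bullet> y)) x
          :> (real k / N) *\<^sub>R u ((real k / N) *\<^sub>R x)" for k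
  proof (induction k)
    case 0
    then show ?case by (simp add: gderiv_def)
  next
    case (Suc k)
    let ?s = "real k / N" and ?t = "real (Suc k) / N"
    have st: "0 \<le> ?s" "?s \<le> ?t" "?t \<le> 1" "?t - ?s = 1 / N"
      using Suc.prems N(1) by (auto simp: field_simps)
    obtain U f where U: "ball (?s *\<^sub>R x) e \<subseteq> U" "\<And>y. y \<in> U \<Longrightarrow> GDERIV f y :> u y"
    proof -
      have "?s *\<^sub>R x \<in> (\<lambda>t. t *\<^sub>R x) ` {0..1}" using st by (intro imageI) auto
      from e(2)[OF this] show thesis using that unfolding \<C>_def by blast
    qed
    have inU: "t *\<^sub>R y \<in> U" if y: "y \<in> ball x (e / 2)" and t: "t \<in> {?s..?t}" for t y
    proof -
      have t01: "0 \<le> t" "t \<le> 1" using t st(1,3) unfolding atLeastAtMost_iff by linarith+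
      have ts: "\<bar>t - ?s\<bar> \<le> ?t - ?s" using t unfolding atLeastAtMost_iff by linarith
      have "dist (?s *\<^sub>R x) (t *\<^sub>R y) \<le> norm (t *\<^sub>R (y - x)) + norm ((t - ?s) *\<^sub>R x)"
        unfolding dist_norm by (rule order_trans[OF _ norm_triangle_ineq], rule eq_refl,
          subst norm_minus_commute) (simp add: algebra_simps)
      also have "norm (t *\<^sub>R (y - x)) \<le> 1 * norm (y - x)"
        unfolding norm_scaleR using t01 by (intro mult_right_mono) auto
      also have "norm ((t - ?s) *\<^sub>R x) \<le> (1 / N) * norm x"
        unfolding norm_scaleR st(4)[symmetric] using ts by (intro mult_right_mono) auto
      also have "1 * norm (y - x) + 1 / N * norm x < e"
        using y add_strict_mono[of "norm (y - x)" "e / 2" "norm x / N" "e / 2"] N(2)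
        by (simp add: dist_norm norm_minus_commute)
      finally show ?thesis using U(1) by (auto simp: mem_ball)
    qed
    have fU: "GDERIV f (t *\<^sub>R y) :> u (t *\<^sub>R y)" if "y \<in> ball x (e / 2)" "t \<in> {?s..?t}" for t y
      using inU[OF that] U(2) by blast
    have split: "integral {0..?t} (\<lambda>t. u (t *\<^sub>R y) \<bullet> y)
        = integral {0..?s} (\<lambda>t. u (t *\<^sub>R y) \<bullet> y) + (f (?t *\<^sub>R y) - f (?s *\<^sub>R y))"
      if y: "y \<in> ball x (e / 2)" for y
    proof -
      have "((\<lambda>t. u (t *\<^sub>R y) \<bullet> y) has_integral f (?t *\<^sub>R y) - f (?s *\<^sub>R y)) {?s..?t}"
        using st y by (intro fundamental_theorem_along_ray fU) auto
      then show ?thesis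
        using Henstock_Kurzweil_Integration.integral_combine[OF st(1,2) ii, of y]
        by (simp add: integral_unique)
    qed
    have scaled: "((\<lambda>y. f (t *\<^sub>R y)) has_derivative (\<lambda>h. h \<bullet> (t *\<^sub>R u (t *\<^sub>R x)))) (at x)" if "t \<in> {?s..?t}" for t
    proof -
      have "(f has_derivative (\<lambda>h. h \<bullet> u (t *\<^sub>R x))) (at (t *\<^sub>R x))"
        using fU[of x t] that e by (simp add: gderiv_def)
      from has_derivative_compose[of "\<lambda>y. t *\<^sub>R y" "\<lambda>h. t *\<^sub>R h" x UNIV f,
          OF bounded_linear_imp_has_derivative[OF bounded_linear_scaleR_right] this]
      show ?thesis by simp
    qed
    have "((\<lambda>y. integral {0..?s} (\<lambda>t. u (t *\<^sub>R y) \<bullet> y) + (f (?t *\<^sub>R y) - f (?s *\<^sub>R y)))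
        has_derivative (\<lambda>h. h \<bullet> (?s *\<^sub>R u (?s *\<^sub>R x)) + (h \<bullet> (?t *\<^sub>R u (?t *\<^sub>R x)) - h \<bullet> (?s *\<^sub>R u (?s *\<^sub>R x))))) (at x)"
      using Suc st by (intro has_derivative_add has_derivative_diff scaled) (auto simp: gderiv_def)
    then have "((\<lambda>y. integral {0..?t} (\<lambda>t. u (t *\<^sub>R y) \<bullet> y))
        has_derivative (\<lambda>h. h \<bullet> (?s *\<^sub>R u (?s *\<^sub>R x)) + (h \<bullet> (?t *\<^sub>R u (?t *\<^sub>R x)) - h \<bullet> (?s *\<^sub>R u (?s *\<^sub>R x))))) (at x)"
      by (rule has_derivative_transform_within_open[OF _ open_ball[of x "e / 2"]]) (use e split in auto)
    then show ?case unfolding gderiv_def by simp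
  qed
  from this[of N] show ?thesis using N by (simp add: radial_primitive_def[abs_def])
qed

text \<open>The Poincare lemma. Differentiation under the integral and symmetry of the derivative turn the
  integrand into the derivative of \<open>t \<mapsto> t \<eta> (t x)\<close>.\<close>

theorem radial_primitive_of_closed_form:
  fixes \<eta> :: "'a::euclidean_space \<Rightarrow> 'a"
  assumes d: "\<And>x. (\<eta> has_derivative D x) (at x)"
    and contD: "\<And>v. continuous_on UNIV (\<lambda>x. D x v)"
    and sym: "\<And>x v w. D x v \<bullet> w = D x w \<bullet> v"
  shows "GDERIV (radial_primitive \<eta>) x :> \<eta> x"
proof -
  have cont: "continuous_on UNIV \<eta>"
    using d by (meson continuous_at_imp_continuous_on has_derivative_continuous)
  have lin: "linear (D x)" for x using d has_derivative_linear by blast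
  have Dsum: "D y x = (\<Sum>b\<in>Basis. (x \<bullet> b) *\<^sub>R D y b)" for x y
    using lin[of y] by (subst euclidean_representation[of x, symmetric])
      (simp add: linear_sum linear_cmul)
  define V where "V x t = t *\<^sub>R D (t *\<^sub>R x) x + \<eta> (t *\<^sub>R x)" for x t
  have "((\<lambda>x. integral (cbox 0 1) (\<lambda>t. \<eta> (t *\<^sub>R x) \<bullet> x)) has_derivative
      blinfun_apply (integral (cbox 0 1) (\<lambda>t. blinfun_inner_right (V x t)))) (at x within UNIV)"
  proof (rule leibniz_rule)
    show "((\<lambda>x. \<eta> (t *\<^sub>R x) \<bullet> x) has_derivative blinfun_apply (blinfun_inner_right (V x t))) (at x within UNIV)"
      if "t \<in> cbox 0 1" for x t
    proof -
      have "((\<lambda>x. \<eta> (t *\<^sub>R x)) has_derivative (\<lambda>h. D (t *\<^sub>R x) (t *\<^sub>R h))) (at x)"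
        using has_derivative_compose[of "\<lambda>y. t *\<^sub>R y" "\<lambda>h. t *\<^sub>R h" x UNIV \<eta>,
            OF bounded_linear_imp_has_derivative[OF bounded_linear_scaleR_right] d] .
      then have "((\<lambda>x. \<eta> (t *\<^sub>R x) \<bullet> x) has_derivative (\<lambda>h. \<eta> (t *\<^sub>R x) \<bullet> h + D (t *\<^sub>R x) (t *\<^sub>R h) \<bullet> x)) (at x)"
        by (intro has_derivative_inner has_derivative_ident)
      moreover have "\<eta> (t *\<^sub>R x) \<bullet> h + D (t *\<^sub>R x) (t *\<^sub>R h) \<bullet> x = V x t \<bullet> h" for h
        using sym[of "t *\<^sub>R x" h x] linear_cmul[OF lin[of "t *\<^sub>R x"], of t h]
        by (simp add: V_def inner_add_left)
      ultimately show ?thesis by simp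
    qed
    show "(\<lambda>t. \<eta> (t *\<^sub>R x) \<bullet> x) integrable_on cbox 0 1" for x
      by (intro integrable_continuous continuous_intros continuous_on_compose2[OF cont]) auto
    show "continuous_on (UNIV \<times> cbox 0 1) (\<lambda>(x, t). blinfun_inner_right (V x t))"
      unfolding case_prod_beta V_def Dsum[of _ "fst _"]
      by (intro bounded_linear.continuous_on[OF bounded_linear_blinfun_inner_right] continuous_intros
          continuous_on_compose2[OF cont] continuous_on_compose2[OF contD]) auto
  qed auto
  moreover have "blinfun_apply (integral (cbox 0 1) (\<lambda>t. blinfun_inner_right (V x t))) h = h \<bullet> \<eta> x" for h
  proof -
    have cV: "continuous_on (cbox 0 1) (\<lambda>t. V x t)"
      unfolding V_def Dsum[of _ x]
      by (intro continuous_intros continuous_on_compose2[OF cont] continuous_on_compose2[OF contD]) auto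
    have "blinfun_apply (integral (cbox 0 1) (\<lambda>t. blinfun_inner_right (V x t))) h
        = integral (cbox 0 1) (\<lambda>t. V x t \<bullet> h)"
      by (subst blinfun_apply_integral, intro integrable_continuous
          bounded_linear.continuous_on[OF bounded_linear_blinfun_inner_right] cV) simp
    also have "((\<lambda>t. V x t \<bullet> h) has_integral (1 *\<^sub>R \<eta> (1 *\<^sub>R x) \<bullet> h - 0 *\<^sub>R \<eta> (0 *\<^sub>R x) \<bullet> h)) {0..1}"
    proof (rule fundamental_theorem_of_calculus)
      fix t :: real
      have "((\<lambda>t. \<eta> (t *\<^sub>R x)) has_derivative (\<lambda>h. D (t *\<^sub>R x) (h *\<^sub>R x))) (at t within {0..1})"
        using has_derivative_compose[of "\<lambda>t. t *\<^sub>R x" "\<lambda>h. h *\<^sub>R x" t "{0..1}" \<eta>,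
            OF bounded_linear_imp_has_derivative[OF bounded_linear_scaleR_left] d] .
      then show "((\<lambda>t. t *\<^sub>R \<eta> (t *\<^sub>R x) \<bullet> h) has_vector_derivative V x t \<bullet> h) (at t within {0..1})"
        unfolding has_vector_derivative_def V_def
        by (auto intro!: derivative_eq_intros ext simp: linear_cmul[OF lin] inner_add_left distrib_left)
    qed simp
    then have "integral (cbox 0 1) (\<lambda>t. V x t \<bullet> h) = \<eta> x \<bullet> h" by (simp add: integral_unique)
    finally show ?thesis by (simp add: inner_commute)
  qed
  then have "blinfun_apply (integral (cbox 0 1) (\<lambda>t. blinfun_inner_right (V x t))) = (\<lambda>h. h \<bullet> \<eta> x)"
    by (rule ext)
  ultimately show ?thesis
    unfolding gderiv_def radial_primitive_def[abs_def] by simp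
qed

lemma radial_primitive_limit:
  fixes u :: "'a::euclidean_space \<Rightarrow> 'a"
  assumes lim: "uniform_limit UNIV U u sequentially"
    and cont: "\<And>k. continuous_on UNIV (U k)"
  shows "(\<lambda>k. radial_primitive (U k) x) \<longlonglongrightarrow> radial_primitive u x"
proof -
  have ul: "uniform_limit (cbox 0 1) (\<lambda>k t. U k (t *\<^sub>R x) \<bullet> x) (\<lambda>t. u (t *\<^sub>R x) \<bullet> x) sequentially"
  proof -
    have "uniform_limit (cbox 0 1) (\<lambda>k t. U k (t *\<^sub>R x)) (\<lambda>t. u (t *\<^sub>R x)) sequentially"
      using uniform_limit_compose'[OF lim, of "\<lambda>t. t *\<^sub>R x" "cbox 0 1"] by auto
    then show ?thesis
      by (rule bounded_linear.uniform_limit[OF bounded_linear_inner_left])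
  qed
  have ci: "continuous_on (cbox 0 1) (\<lambda>t. U k (t *\<^sub>R x) \<bullet> x)" for k
    by (intro continuous_intros continuous_on_compose2[OF cont]) auto
  obtain I J where I: "\<And>k. ((\<lambda>t. U k (t *\<^sub>R x) \<bullet> x) has_integral I k) (cbox 0 1)"
    and J: "((\<lambda>t. u (t *\<^sub>R x) \<bullet> x) has_integral J) (cbox 0 1)" and IJ: "I \<longlonglongrightarrow> J"
    using uniform_limit_integral_cbox[OF ul ci] by auto
  have "radial_primitive (U k) x = I k" for k
    using I[of k] by (simp add: radial_primitive_def integral_unique)
  moreover have "radial_primitive u x = J"
    using J by (simp add: radial_primitive_def integral_unique)
  ultimately show ?thesis using IJ by simp
qed

section \<open>First and second derivatives of a Tonelli Hamiltonian\<close>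

lemma class_C_continuous: "class_C j f \<Longrightarrow> continuous_on UNIV f"
proof (cases j)
  case (Suc i)
  then show "class_C j f \<Longrightarrow> continuous_on UNIV f"
    using differentiable_imp_continuous_within
    by (auto simp: continuous_on_eq_continuous_within)
qed simp

lemma GDERIV_unique_gradient:
  assumes "GDERIV f x :> D"
  shows "gradient f x = D"
  unfolding gradient_def
proof (rule the_equality)
  fix D' assume "GDERIV f x :> D'"
  with assms have "(\<lambda>h. h \<bullet> D) = (\<lambda>h. h \<bullet> D')"
    unfolding gderiv_def by (rule has_derivative_unique)
  then show "D' = D" using vector_eq_ldot by metis
qed fact

lemma norm_segment_le:
  fixes p q :: "'a::real_normed_vector"
  assumes "norm p \<le> r" "norm q \<le> r" "0 \<le> s" "s \<le> 1"
  shows "norm (q + s *\<^sub>R (p - q)) \<le> r"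
proof -
  have "(1 - s) *\<^sub>R q + s *\<^sub>R p \<in> cball 0 r"
    using assms by (intro convexD[OF convex_cball]) auto
  then show ?thesis by (simp add: algebra_simps)
qed

locale tonelli_hamiltonian =
  fixes H :: "'n::finite phase \<Rightarrow> real" and k :: nat
  assumes tonelli: "tonelli k H"
begin

text \<open>The full gradient of the lifted Hamiltonian and its derivative, written in coordinates so that
  continuity and linearity are those of iterated directional derivatives.\<close>

definition gradH :: "(real ^ 'n) \<times> (real ^ 'n) \<Rightarrow> (real ^ 'n) \<times> (real ^ 'n)" where
  "gradH z = (\<Sum>b\<in>Basis. frechet_derivative (lift_fun H) (at z) b *\<^sub>R b)"

definition hessH :: "(real ^ 'n) \<times> (real ^ 'n) \<Rightarrow> (real ^ 'n) \<times> (real ^ 'n) \<Rightarrow> (real ^ 'n) \<times> (real ^ 'n)" where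
  "hessH z w = (\<Sum>b\<in>Basis.
     frechet_derivative (\<lambda>z. frechet_derivative (lift_fun H) (at z) b) (at z) w *\<^sub>R b)"

abbreviation Hx :: "real ^ 'n \<Rightarrow> real ^ 'n \<Rightarrow> real ^ 'n" where "Hx x p \<equiv> fst (gradH (x, p))"
abbreviation Hp :: "real ^ 'n \<Rightarrow> real ^ 'n \<Rightarrow> real ^ 'n" where "Hp x p \<equiv> snd (gradH (x, p))"

lemma class_C_H:
  shows H_differentiable: "lift_fun H differentiable (at z)"
    and DH_differentiable: "(\<lambda>z. frechet_derivative (lift_fun H) (at z) v) differentiable (at z)"
    and DDH_continuous:
      "continuous_on UNIV (\<lambda>z. frechet_derivative (\<lambda>z. frechet_derivative (lift_fun H) (at z) v) (at z) w)"
proof -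
  obtain j where "k = Suc (Suc j)" using tonelli unfolding tonelli_def
    by (metis One_nat_def Suc_1 Suc_le_D Suc_le_mono)
  then have *: "class_C (Suc (Suc j)) (lift_fun H)" using tonelli by (simp add: tonelli_def)
  then show "lift_fun H differentiable (at z)"
    "(\<lambda>z. frechet_derivative (lift_fun H) (at z) v) differentiable (at z)"
    unfolding class_C.simps by blast+
  from * have "class_C j (\<lambda>z. frechet_derivative (\<lambda>z. frechet_derivative (lift_fun H) (at z) v) (at z) w)"
    unfolding class_C.simps by blast
  then show "continuous_on UNIV (\<lambda>z. frechet_derivative (\<lambda>z. frechet_derivative (lift_fun H) (at z) v) (at z) w)"
    by (rule class_C_continuous)
qed

lemma GDERIV_H: "GDERIV (lift_fun H) z :> gradH z"
  unfolding gderiv_def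
proof (rule has_derivative_eq_rhs)
  show D: "(lift_fun H has_derivative frechet_derivative (lift_fun H) (at z)) (at z)"
    using H_differentiable frechet_derivative_works by blast
  show "frechet_derivative (lift_fun H) (at z) = (\<lambda>h. h \<bullet> gradH z)"
  proof
    fix h
    have lin: "linear (frechet_derivative (lift_fun H) (at z))" using D has_derivative_linear by blast
    have "frechet_derivative (lift_fun H) (at z) h
        = frechet_derivative (lift_fun H) (at z) (\<Sum>b\<in>Basis. (h \<bullet> b) *\<^sub>R b)"
      by (simp add: euclidean_representation)
    also have "\<dots> = h \<bullet> gradH z"
      by (simp add: linear_sum[OF lin] linear_cmul[OF lin] gradH_def inner_sum_right mult.commute)
    finally show "frechet_derivative (lift_fun H) (at z) h = h \<bullet> gradH z" .
  qed
qed

lemma gradH_has_derivative: "(gradH has_derivative hessH z) (at z)"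
proof -
  have "((\<lambda>z. frechet_derivative (lift_fun H) (at z) b) has_derivative
      frechet_derivative (\<lambda>z. frechet_derivative (lift_fun H) (at z) b) (at z)) (at z)" for b
    using DH_differentiable frechet_derivative_works by blast
  then show ?thesis
    unfolding gradH_def[abs_def] hessH_def[abs_def]
    by (intro has_derivative_sum has_derivative_scaleR_left)
qed

lemma continuous_on_gradH: "continuous_on S gradH"
  using gradH_has_derivative by (meson continuous_at_imp_continuous_on has_derivative_continuous)

lemma continuous_on_gradH' [continuous_intros]:
  "continuous_on S f \<Longrightarrow> continuous_on S (\<lambda>x. gradH (f x))"
  using continuous_on_compose[OF _ continuous_on_gradH] by (simp add: o_def)

lemma continuous_on_liftH: "continuous_on S (lift_fun H)"
  using GDERIV_H unfolding gderiv_def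
  by (meson continuous_at_imp_continuous_on has_derivative_continuous)

lemma continuous_on_hessH: "continuous_on UNIV (\<lambda>z. hessH z w)"
  unfolding hessH_def by (intro continuous_intros DDH_continuous)

lemma hessH_sum: "hessH z w = (\<Sum>b\<in>Basis. (w \<bullet> b) *\<^sub>R hessH z b)"
proof -
  have "linear (hessH z)" using gradH_has_derivative has_derivative_linear by blast
  then show ?thesis
    by (subst euclidean_representation[of w, symmetric]) (simp add: linear_sum linear_cmul)
qed

lemma gradH_partial_p: "GDERIV (\<lambda>p. lift_fun H (x, p)) p :> Hp x p"
proof -
  have "((\<lambda>p. (x, p)) has_derivative (\<lambda>h. (0, h))) (at p)"
    by (auto intro!: derivative_eq_intros)
  from has_derivative_compose[OF this GDERIV_H[unfolded gderiv_def]]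
  show ?thesis unfolding gderiv_def by (simp add: inner_prod_def)
qed

lemma gradH_partial_x: "GDERIV (\<lambda>x. lift_fun H (x, p)) x :> Hx x p"
proof -
  have "((\<lambda>x. (x, p)) has_derivative (\<lambda>h. (h, 0))) (at x)"
    by (auto intro!: derivative_eq_intros)
  from has_derivative_compose[OF this GDERIV_H[unfolded gderiv_def]]
  show ?thesis unfolding gderiv_def by (simp add: inner_prod_def)
qed

lemma ham_field_eq: "ham_field H (x, p) = (Hp x p, - Hx x p)"
  unfolding ham_field_def
  using GDERIV_unique_gradient[OF gradH_partial_p[of x p]] GDERIV_unique_gradient[OF gradH_partial_x[of p x]]
  by simp

text \<open>The Tonelli condition differentiates in the momentum alone; both derivatives there are
  restrictions of derivatives of the lift.\<close>

lemma hessH_positive: "v \<noteq> 0 \<Longrightarrow> hessH (x, p) (0, v) \<bullet> (0, v) > 0"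
proof -
  assume v: "v \<noteq> 0"
  have inner: "frechet_derivative (\<lambda>p. H (torus_proj x, p)) (at p') v = gradH (x, p') \<bullet> (0, v)" for p'
    using frechet_derivative_at[OF gradH_partial_p[unfolded gderiv_def, of x p']]
    by (simp add: lift_fun_def inner_prod_def) (metis inner_commute)
  have "((\<lambda>p. (x, p)) has_derivative (\<lambda>h. (0, h))) (at p)"
    by (auto intro!: derivative_eq_intros)
  from has_derivative_inner_left[OF has_derivative_compose[OF this gradH_has_derivative], of "(0, v)"]
  have "((\<lambda>p'. gradH (x, p') \<bullet> (0, v)) has_derivative (\<lambda>h. hessH (x, p) (0, h) \<bullet> (0, v))) (at p)" .
  from frechet_derivative_at[OF this]
  have "frechet_derivative (\<lambda>p'. frechet_derivative (\<lambda>p''. H (torus_proj x, p'')) (at p') v) (at p) v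
      = hessH (x, p) (0, v) \<bullet> (0, v)"
    unfolding inner by (rule fun_cong[OF sym])
  moreover have "\<forall>q p v. v \<noteq> 0 \<longrightarrow>
      frechet_derivative (\<lambda>p'. frechet_derivative (\<lambda>p''. H (q, p'')) (at p') v) (at p) v > 0"
    using tonelli unfolding tonelli_def by (elim conjE)
  ultimately show ?thesis using v by metis
qed

lemma liftH_periodic: "a \<in> int_lattice \<Longrightarrow> lift_fun H (x + a, p) = lift_fun H (x, p)"
  by (simp add: lift_fun_def torus_proj_add_lattice)

lemma gradH_periodic:
  assumes a: "a \<in> int_lattice"
  shows "gradH (x + a, p) = gradH (x, p)"
proof -
  have "((\<lambda>z. z + (a, 0)) has_derivative (\<lambda>h. h)) (at (x, p))"
    by (auto intro!: derivative_eq_intros)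
  from has_derivative_compose[OF this GDERIV_H[unfolded gderiv_def]]
  have "GDERIV (\<lambda>z. lift_fun H (z + (a, 0))) (x, p) :> gradH (x + a, p)"
    unfolding gderiv_def by simp
  moreover have "(\<lambda>z. lift_fun H (z + (a, 0))) = lift_fun H"
    using a by (auto simp: fun_eq_iff liftH_periodic)
  ultimately show ?thesis
    using GDERIV_unique_gradient GDERIV_H by metis
qed

lemma hessH_periodic:
  assumes a: "a \<in> int_lattice"
  shows "hessH (x + a, p) = hessH (x, p)"
proof -
  have "((\<lambda>z. z + (a, 0)) has_derivative (\<lambda>h. h)) (at (x, p))"
    by (auto intro!: derivative_eq_intros)
  from has_derivative_compose[OF this gradH_has_derivative]
  have "((\<lambda>z. gradH (z + (a, 0))) has_derivative hessH (x + a, p)) (at (x, p))" by simp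
  moreover have "(\<lambda>z. gradH (z + (a, 0))) = gradH"
    using a by (auto simp: fun_eq_iff gradH_periodic)
  ultimately show ?thesis
    using gradH_has_derivative has_derivative_unique by metis
qed

lemma reduce_to_unit_box:
  obtains a where "a \<in> int_lattice" "x + a \<in> cbox 0 (\<chi> i. 1)"
proof -
  obtain y where "torus_proj x = torus_proj y" "y \<in> cbox 0 (\<chi> i. 1)"
    using lift_to_unit_box[of "torus_proj x"] by metis
  then show thesis
    by (intro that[of "y - x"]) (auto simp: torus_proj_eq_iff int_lattice_minus[of "x - y", simplified])
qed

text \<open>By periodicity a bound on the compact set of base points in the unit box and momenta in the
  ball suffices.\<close>

lemma periodic_bounded:
  fixes \<phi> :: "(real ^ 'n) \<times> (real ^ 'n) \<Rightarrow> 'b::real_normed_vector"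
  assumes "continuous_on UNIV \<phi>" and per: "\<And>x p a. a \<in> int_lattice \<Longrightarrow> \<phi> (x + a, p) = \<phi> (x, p)"
  obtains M where "M \<ge> 0" "\<And>x p. norm p \<le> r \<Longrightarrow> norm (\<phi> (x, p)) \<le> M"
proof -
  have "bounded (\<phi> ` (cbox 0 (\<chi> i. 1) \<times> cball 0 r))"
    using assms(1) continuous_on_subset
    by (intro compact_imp_bounded compact_continuous_image compact_Times) auto
  then obtain M where M: "M > 0" "\<And>z. z \<in> cbox 0 (\<chi> i. 1) \<times> cball 0 r \<Longrightarrow> norm (\<phi> z) \<le> M"
    unfolding bounded_pos by blast
  have "norm (\<phi> (x, p)) \<le> M" if "norm p \<le> r" for x p
  proof -
    obtain a where "a \<in> int_lattice" "x + a \<in> cbox 0 (\<chi> i. 1)" by (rule reduce_to_unit_box)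
    then show ?thesis using M(2)[of "(x + a, p)"] per[of a x p] that by simp
  qed
  with M(1) show thesis by (intro that[of M]) auto
qed

lemma gradH_bounded:
  obtains M where "M \<ge> 0" "\<And>x p. norm p \<le> r \<Longrightarrow> norm (gradH (x, p)) \<le> M"
  by (rule periodic_bounded[of gradH r]) (auto simp: continuous_on_gradH gradH_periodic)

lemma gradH_lipschitz:
  obtains C where "C \<ge> 0" "\<And>x p y q. norm p \<le> r \<Longrightarrow> norm q \<le> r \<Longrightarrow>
     norm (gradH (x, p) - gradH (y, q)) \<le> C * norm ((x, p) - (y, q))"
proof -
  have "\<exists>M\<ge>0. \<forall>x p. norm p \<le> r \<longrightarrow> norm (hessH (x, p) b) \<le> M" for b
  proof -
    obtain M where "M \<ge> 0" "\<And>x p. norm p \<le> r \<Longrightarrow> norm (hessH (x, p) b) \<le> M"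
      by (rule periodic_bounded[of "\<lambda>z. hessH z b" r]) (auto simp: continuous_on_hessH hessH_periodic)
    then show ?thesis by blast
  qed
  then obtain M where M: "\<And>b. M b \<ge> 0" "\<And>b x p. norm p \<le> r \<Longrightarrow> norm (hessH (x, p) b) \<le> M b"
    by metis
  define C where "C = (\<Sum>b\<in>Basis. M b)"
  \<comment> \<open>the columns of the Hessian are bounded, so its operator norm is\<close>
  have on: "onorm (hessH (x, p)) \<le> C" if "norm p \<le> r" for x p
  proof (rule onorm_bound)
    show "0 \<le> C" unfolding C_def by (intro sum_nonneg M)
    fix w :: "(real ^ 'n) \<times> (real ^ 'n)"
    have "norm (hessH (x, p) w) \<le> (\<Sum>b\<in>Basis. norm ((w \<bullet> b) *\<^sub>R hessH (x, p) b))"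
      by (subst hessH_sum) (rule norm_sum)
    also have "\<dots> \<le> (\<Sum>b\<in>Basis. norm w * M b)"
      using M that by (intro sum_mono) (auto intro!: mult_mono simp: Basis_le_norm)
    finally show "norm (hessH (x, p) w) \<le> C * norm w"
      by (simp add: C_def sum_distrib_left mult.commute)
  qed
  show thesis
  proof (rule that)
    show "C \<ge> 0" unfolding C_def by (intro sum_nonneg M)
    show "norm (gradH (x, p) - gradH (y, q)) \<le> C * norm ((x, p) - (y, q))"
      if "norm p \<le> r" "norm q \<le> r" for x p y q
    proof (rule differentiable_bound[where S = "UNIV \<times> cball 0 r" and f' = hessH])
      show "convex (UNIV \<times> cball 0 r :: ((real ^ 'n) \<times> (real ^ 'n)) set)"
        by (intro convex_Times convex_UNIV convex_cball)
      show "(gradH has_derivative hessH z) (at z within UNIV \<times> cball 0 r)" for z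
        using gradH_has_derivative by (rule has_derivative_at_withinI)
    qed (use that on in auto)
  qed
qed

text \<open>The minimum of the Hessian over the unit sphere and over the compact set of base points in the
  unit box and momenta in the ball.\<close>

lemma strictly_positive_hessian:
  obtains m where "m > 0" "\<And>x p v. norm p \<le> r \<Longrightarrow> hessH (x, p) (0, v) \<bullet> (0, v) \<ge> m * (norm v)\<^sup>2"
proof -
  let ?K = "((cbox 0 (\<chi> i. 1) \<times> cball 0 (max r 0)) \<times> sphere 0 1) :: (((real ^ 'n) \<times> (real ^ 'n)) \<times> (real ^ 'n)) set"
  let ?Q = "\<lambda>(z, v). hessH z (0, v) \<bullet> (0, v)"
  have "continuous_on ?K ?Q"
    unfolding case_prod_beta
    by (subst hessH_sum) (intro continuous_intros continuous_on_compose2[OF continuous_on_hessH], auto)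
  moreover have "compact ?K" by (intro compact_Times compact_cbox compact_cball compact_sphere)
  moreover have "?K \<noteq> {}"
  proof -
    have "(0, 0) \<in> (cbox 0 (\<chi> i. 1) :: (real ^ 'n) set) \<times> (cball 0 (max r 0) :: (real ^ 'n) set)" by (auto simp: mem_box_cart)
    moreover have "axis undefined 1 \<in> (sphere 0 1 :: (real ^ 'n) set)" by simp
    ultimately show ?thesis by blast
  qed
  ultimately obtain k0 where k0: "k0 \<in> ?K" "\<And>k. k \<in> ?K \<Longrightarrow> ?Q k0 \<le> ?Q k"
    using continuous_attains_inf[of ?K ?Q] by blast
  define m where "m = ?Q k0"
  have "m > 0"
    using k0(1) hessH_positive[of "snd k0" "fst (fst k0)" "snd (fst k0)"] norm_zero
    unfolding m_def by (cases k0) force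
  moreover have "hessH (x, p) (0, v) \<bullet> (0, v) \<ge> m * (norm v)\<^sup>2" if "norm p \<le> r" for x p v
  proof (cases "v = 0")
    case False
    obtain a where a: "a \<in> int_lattice" "x + a \<in> cbox 0 (\<chi> i. 1)" by (rule reduce_to_unit_box)
    define e where "e = v /\<^sub>R norm v"
    have ve: "(0, v) = norm v *\<^sub>R (0 :: real ^ 'n, e)" using False by (simp add: e_def)
    have "((x + a, p), e) \<in> ?K" using a that False by (auto simp: e_def)
    then have "m \<le> hessH (x + a, p) (0, e) \<bullet> (0, e)" using k0(2) unfolding m_def by fastforce
    also have "\<dots> = hessH (x, p) (0, e) \<bullet> (0, e)" using a by (simp add: hessH_periodic)
    finally have "m * (norm v)\<^sup>2 \<le> (norm v)\<^sup>2 * (hessH (x, p) (0, e) \<bullet> (0, e))"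
      by (subst mult.commute[of "(norm v)\<^sup>2"]) (rule mult_right_mono, auto)
    moreover have "linear (hessH (x, p))" using gradH_has_derivative has_derivative_linear by blast
    ultimately show ?thesis
      unfolding ve by (simp only: linear_cmul inner_scaleR_left inner_scaleR_right) (simp add: power2_eq_square mult_ac)
  qed (auto simp: zero_prod_def[symmetric])
  ultimately show thesis by (rule that)
qed

lemma strong_monotonicity:
  assumes m: "\<And>x p v. norm p \<le> r \<Longrightarrow> hessH (x, p) (0, v) \<bullet> (0, v) \<ge> m * (norm v)\<^sup>2"
    and pq: "norm p \<le> r" "norm q \<le> r"
  shows "(Hp x p - Hp x q) \<bullet> (p - q) \<ge> m * (norm (p - q))\<^sup>2"
proof -
  let ?v = "p - q"
  let ?g = "\<lambda>s. gradH (x, q + s *\<^sub>R ?v) \<bullet> (0, ?v)"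
  have d: "(?g has_real_derivative hessH (x, q + s *\<^sub>R ?v) (0, ?v) \<bullet> (0, ?v)) (at s)" for s
  proof -
    have "((\<lambda>s. (x, q + s *\<^sub>R ?v)) has_derivative (\<lambda>h. h *\<^sub>R (0, ?v))) (at s)"
      by (auto intro!: derivative_eq_intros)
    from has_derivative_inner_left[OF has_derivative_compose[OF this gradH_has_derivative], of "(0, ?v)"]
    show ?thesis
      unfolding has_field_derivative_def
      by (rule has_derivative_eq_rhs)
        (simp add: fun_eq_iff linear_cmul[OF has_derivative_linear[OF gradH_has_derivative]] del: scaleR_Pair)
  qed
  obtain s where s: "0 < s" "s < 1" "?g 1 - ?g 0 = (1 - 0) * (hessH (x, q + s *\<^sub>R ?v) (0, ?v) \<bullet> (0, ?v))"
    using MVT2[of 0 1 ?g "\<lambda>s. hessH (x, q + s *\<^sub>R ?v) (0, ?v) \<bullet> (0, ?v)"] d by auto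
  have "norm (q + s *\<^sub>R ?v) \<le> r" using norm_segment_le[OF pq] s(1,2) by simp
  then show ?thesis
    using m[of "q + s *\<^sub>R ?v" ?v x] s(3) by (simp add: inner_prod_def inner_diff_left)
qed

lemma strong_convexity:
  assumes m: "\<And>x p v. norm p \<le> r \<Longrightarrow> hessH (x, p) (0, v) \<bullet> (0, v) \<ge> m * (norm v)\<^sup>2"
    and pq: "norm p \<le> r" "norm q \<le> r"
  shows "lift_fun H (x, p) \<ge> lift_fun H (x, q) + Hp x q \<bullet> (p - q) + m / 2 * (norm (p - q))\<^sup>2"
proof -
  let ?v = "p - q"
  define \<phi> where "\<phi> s = lift_fun H (x, q + s *\<^sub>R ?v) - s * (Hp x q \<bullet> ?v) - m / 2 * s\<^sup>2 * (norm ?v)\<^sup>2" for s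
  have "\<phi> 0 \<le> \<phi> 1"
  proof (rule DERIV_nonneg_imp_nondecreasing[of 0 1 \<phi>])
    fix s :: real assume s: "0 \<le> s" "s \<le> 1"
    have d: "((\<lambda>s. lift_fun H (x, q + s *\<^sub>R ?v)) has_real_derivative Hp x (q + s *\<^sub>R ?v) \<bullet> ?v) (at s)"
      by (rule GDERIV_along_curve[OF gradH_partial_p]) (auto intro!: derivative_eq_intros)
    have "(\<phi> has_real_derivative Hp x (q + s *\<^sub>R ?v) \<bullet> ?v - Hp x q \<bullet> ?v - m * s * (norm ?v)\<^sup>2) (at s)"
      unfolding \<phi>_def by (rule derivative_eq_intros d refl | simp)+
    moreover have "Hp x (q + s *\<^sub>R ?v) \<bullet> ?v - Hp x q \<bullet> ?v - m * s * (norm ?v)\<^sup>2 \<ge> 0"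
    proof (cases "s = 0")
      case False
      have "norm (q + s *\<^sub>R ?v) \<le> r" by (rule norm_segment_le[OF pq s])
      then have "(Hp x (q + s *\<^sub>R ?v) - Hp x q) \<bullet> (s *\<^sub>R ?v) \<ge> m * (norm (s *\<^sub>R ?v))\<^sup>2"
        using strong_monotonicity[OF m, where p = "q + s *\<^sub>R ?v" and q = q and x = x] pq by simp
      then have "s * ((Hp x (q + s *\<^sub>R ?v) - Hp x q) \<bullet> ?v) \<ge> s * (m * s * (norm ?v)\<^sup>2)"
        by (simp add: power_mult_distrib power2_eq_square mult_ac)
      then show ?thesis using s False by (simp add: inner_diff_left)
    qed simp
    ultimately show "\<exists>y. (\<phi> has_real_derivative y) (at s) \<and> y \<ge> 0" by blast
  qed simp
  then show ?thesis by (simp add: \<phi>_def)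
qed

lemma tangent_inequality: "lift_fun H (x, p) \<ge> lift_fun H (x, q) + Hp x q \<bullet> (p - q)"
proof -
  define r where "r = max (norm p) (norm q)"
  obtain m where m: "m > 0" "\<And>x p v. norm p \<le> r \<Longrightarrow> hessH (x, p) (0, v) \<bullet> (0, v) \<ge> m * (norm v)\<^sup>2"
    using strictly_positive_hessian[of r] by blast
  have "lift_fun H (x, p) \<ge> lift_fun H (x, q) + Hp x q \<bullet> (p - q) + m / 2 * (norm (p - q))\<^sup>2"
    by (rule strong_convexity[OF m(2)]) (auto simp: r_def)
  moreover have "m / 2 * (norm (p - q))\<^sup>2 \<ge> 0" using m(1) by simp
  ultimately show ?thesis by linarith
qed

text \<open>A combination of the tangent inequality at \<open>s p\<close>, tested at \<open>0\<close> and at \<open>p\<close>; the sign of the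
  slope in the direction \<open>p\<close> decides which of the two bounds the value at \<open>s p\<close>.\<close>

lemma convex_H:
  assumes s: "0 \<le> s" "s \<le> 1"
  shows "lift_fun H (x, s *\<^sub>R p) \<le> max (lift_fun H (x, 0)) (lift_fun H (x, p))"
proof -
  let ?q = "s *\<^sub>R p"
  have "Hp x ?q \<bullet> (p - ?q) = (1 - s) * (Hp x ?q \<bullet> p)" "Hp x ?q \<bullet> (0 - ?q) = - s * (Hp x ?q \<bullet> p)"
    by (simp_all add: algebra_simps)
  then have 1: "lift_fun H (x, p) \<ge> lift_fun H (x, ?q) + (1 - s) * (Hp x ?q \<bullet> p)"
    and 2: "lift_fun H (x, 0) \<ge> lift_fun H (x, ?q) - s * (Hp x ?q \<bullet> p)"
    using tangent_inequality[of x ?q p] tangent_inequality[of x ?q 0] by auto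
  show ?thesis
  proof (cases "Hp x ?q \<bullet> p \<ge> 0")
    case True
    then have "(1 - s) * (Hp x ?q \<bullet> p) \<ge> 0" using s by simp
    then show ?thesis using 1 by (simp add: le_max_iff_disj)
  next
    case False
    then have "s * (Hp x ?q \<bullet> p) \<le> 0" using s by (simp add: mult_nonneg_nonpos)
    then show ?thesis using 2 by (simp add: le_max_iff_disj)
  qed
qed

lemma superlinear_at_point:
  obtains b where "\<And>p. norm p \<ge> b \<Longrightarrow> lift_fun H (x, p) \<ge> A * norm p"
proof -
  have "filterlim (\<lambda>p. H (torus_proj x, p) / norm p) at_top at_infinity"
    using tonelli by (simp add: tonelli_def)
  then have "eventually (\<lambda>p. A \<le> H (torus_proj x, p) / norm p) at_infinity"
    by (simp add: filterlim_at_top)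
  then obtain b where b: "\<And>p. norm p \<ge> b \<Longrightarrow> A \<le> H (torus_proj x, p) / norm p"
    by (auto simp: eventually_at_infinity)
  show thesis
  proof (rule that[of "max b 1"])
    fix p :: "real ^ 'n" assume "norm p \<ge> max b 1"
    then have "norm p > 0" "A \<le> H (torus_proj x, p) / norm p"
      using b[of p] by auto
    then show "lift_fun H (x, p) \<ge> A * norm p"
      by (simp add: lift_fun_def pos_le_divide_eq)
  qed
qed

text \<open>Superlinear growth is assumed at each base point separately. If points \<open>(x\<^sub>j, p\<^sub>j)\<close> with
  \<open>\<bar>p\<^sub>j\<bar> \<rightarrow> \<infinity>\<close> had bounded energy, convexity would bound the energy along the whole segments from
  \<open>(x\<^sub>j, 0)\<close> to \<open>(x\<^sub>j, p\<^sub>j)\<close>, hence along a full ray over a limit point of the \<open>x\<^sub>j\<close>.\<close>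

theorem uniformly_coercive: "\<exists>R>0. \<forall>x p. norm p \<ge> R \<longrightarrow> lift_fun H (x, p) > E"
proof (rule ccontr)
  assume neg: "\<not> ?thesis"
  have "\<exists>x p. x \<in> cbox 0 (\<chi> i. 1) \<and> norm p \<ge> real (Suc j) \<and> lift_fun H (x, p) \<le> E" for j
  proof -
    obtain x p where xp: "norm p \<ge> real (Suc j)" "lift_fun H (x, p) \<le> E"
      using neg of_nat_0_less_iff[where 'a = real, of "Suc j"] by (meson not_less zero_less_Suc)
    obtain a where "a \<in> int_lattice" "x + a \<in> cbox 0 (\<chi> i. 1)" by (rule reduce_to_unit_box)
    then show ?thesis using xp liftH_periodic by metis
  qed
  then obtain X P where X: "\<And>j. X j \<in> cbox 0 (\<chi> i. 1)"
    and P: "\<And>j. norm (P j) \<ge> real (Suc j)" and E: "\<And>j. lift_fun H (X j, P j) \<le> E"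
    by metis
  define e where "e j = P j /\<^sub>R norm (P j)" for j
  have P0: "norm (P j) > 0" for j by (rule less_le_trans[OF _ P]) simp
  have "seq_compact (cbox 0 (\<chi> i. 1) \<times> sphere (0 :: real ^ 'n) 1 :: ((real ^ 'n) \<times> _) set)"
    by (intro compact_imp_seq_compact compact_Times compact_cbox compact_sphere)
  moreover have "\<forall>j. (X j, e j) \<in> cbox 0 (\<chi> i. 1) \<times> sphere 0 1"
    using X P0 by (auto simp: e_def)
  ultimately obtain l \<sigma> where l: "l \<in> cbox 0 (\<chi> i. 1) \<times> sphere 0 1" and \<sigma>: "strict_mono \<sigma>"
    and lim: "((\<lambda>j. (X j, e j)) \<circ> \<sigma>) \<longlonglongrightarrow> l"
    by (rule seq_compactE)
  obtain x0 e0 where l0: "l = (x0, e0)" "norm e0 = 1" using l by (cases l) auto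
  obtain B where B: "B \<ge> 0" "\<And>x p. norm p \<le> 0 \<Longrightarrow> norm (lift_fun H (x, p)) \<le> B"
    by (rule periodic_bounded[of "lift_fun H" 0]) (auto simp: continuous_on_liftH liftH_periodic)
  have bnd: "lift_fun H (x0, r *\<^sub>R e0) \<le> max B E" if r: "r > 0" for r
  proof (rule LIMSEQ_le_const2)
    have "(\<lambda>j. (X (\<sigma> j), r *\<^sub>R e (\<sigma> j))) \<longlonglongrightarrow> (x0, r *\<^sub>R e0)"
      using tendsto_fst[OF lim] tendsto_snd[OF lim] l0
      by (intro tendsto_Pair tendsto_intros) (simp_all add: o_def)
    then show "(\<lambda>j. lift_fun H (X (\<sigma> j), r *\<^sub>R e (\<sigma> j))) \<longlonglongrightarrow> lift_fun H (x0, r *\<^sub>R e0)"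
      using continuous_on_tendsto_compose[OF continuous_on_liftH[of UNIV]] by auto
    obtain J :: nat where J: "real J > r" using reals_Archimedean2 by blast
    have "lift_fun H (X (\<sigma> j), r *\<^sub>R e (\<sigma> j)) \<le> max B E" if "j \<ge> J" for j
    proof -
      have "real j \<le> real (\<sigma> j)" using seq_suble[OF \<sigma>, of j] by simp
      then have "r \<le> norm (P (\<sigma> j))" using P[of "\<sigma> j"] J that by simp
      then have "lift_fun H (X (\<sigma> j), (r / norm (P (\<sigma> j))) *\<^sub>R P (\<sigma> j))
          \<le> max (lift_fun H (X (\<sigma> j), 0)) (lift_fun H (X (\<sigma> j), P (\<sigma> j)))"
        using r P0[of "\<sigma> j"] by (intro convex_H) auto
      also have "\<dots> \<le> max B E"
        using B(2)[of 0 "X (\<sigma> j)"] E[of "\<sigma> j"] by auto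
      finally show ?thesis by (simp add: e_def divide_inverse)
    qed
    then show "\<exists>N. \<forall>n\<ge>N. lift_fun H (X (\<sigma> n), r *\<^sub>R e (\<sigma> n)) \<le> max B E" by blast
  qed
  obtain b where b: "\<And>p. norm p \<ge> b \<Longrightarrow> lift_fun H (x0, p) \<ge> (max B E + 1) * norm p"
    using superlinear_at_point by blast
  define r where "r = max b 1"
  have "r > 0" by (simp add: r_def)
  have "(max B E + 1) * r \<le> max B E"
    using b[of "r *\<^sub>R e0"] bnd[OF \<open>r > 0\<close>] l0(2) by (auto simp: r_def)
  moreover have "(max B E + 1) * r \<ge> (max B E + 1) * 1"
    using B(1) by (intro mult_left_mono) (auto simp: r_def)
  ultimately show False by simp
qed

section \<open>The Hamiltonian flow\<close>

lemma ham_field_lipschitz: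
  obtains C where "C \<ge> 0" "\<And>z w. norm (snd z) \<le> r \<Longrightarrow> norm (snd w) \<le> r \<Longrightarrow>
     norm (ham_field H z - ham_field H w) \<le> C * norm (z - w)"
proof -
  obtain C where C: "C \<ge> 0" "\<And>x p y q. norm p \<le> r \<Longrightarrow> norm q \<le> r \<Longrightarrow>
     norm (gradH (x, p) - gradH (y, q)) \<le> C * norm ((x, p) - (y, q))"
    using gradH_lipschitz[of r] by blast
  have swap: "norm (ham_field H z - ham_field H w) = norm (gradH z - gradH w)" for z w
  proof -
    have "norm (ham_field H z - ham_field H w)
        = norm (snd (gradH z - gradH w), - fst (gradH z - gradH w))"
      by (cases z, cases w) (simp add: ham_field_eq)
    also have "\<dots> = norm (gradH z - gradH w)"
      unfolding norm_prod_def by (simp add: norm_minus_commute add.commute)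
    finally show ?thesis .
  qed
  show thesis
  proof (rule that[OF C(1)])
    fix z w :: "(real ^ 'n) \<times> (real ^ 'n)" assume "norm (snd z) \<le> r" "norm (snd w) \<le> r"
    with C(2)[of "snd z" "snd w" "fst z" "fst w"]
    show "norm (ham_field H z - ham_field H w) \<le> C * norm (z - w)" by (simp add: swap)
  qed
qed

lemma energy_derivative:
  assumes "(\<gamma> has_vector_derivative c *\<^sub>R ham_field H (\<gamma> s)) (at s within S)"
  shows "((\<lambda>s. lift_fun H (\<gamma> s)) has_real_derivative 0) (at s within S)"
proof -
  have "gradH (\<gamma> s) \<bullet> (c *\<^sub>R ham_field H (\<gamma> s)) = 0"
    by (cases "\<gamma> s") (simp add: ham_field_eq inner_prod_def inner_commute)
  with GDERIV_along_curve[OF GDERIV_H assms] show ?thesis by (simp only:)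
qed

text \<open>Up to the first time at which the momentum reaches norm \<open>R\<close> the curve is a reparametrised orbit,
  so its energy is constant; but at momenta of norm \<open>R\<close> the energy is larger. The constant \<open>c\<close> is \<open>1\<close> for
  forward and \<open>- 1\<close> for reversed orbits.\<close>

lemma energy_barrier:
  assumes d: "\<And>s. (\<gamma> has_vector_derivative c *\<^sub>R X (\<gamma> s)) (at s)"
    and X: "\<And>z. norm (snd z) \<le> R \<Longrightarrow> X z = ham_field H z"
    and R: "\<And>x p. norm p \<ge> R \<Longrightarrow> lift_fun H (x, p) > lift_fun H (\<gamma> 0)"
    and t: "t \<ge> 0"
  shows "norm (snd (\<gamma> t)) < R"
proof (rule ccontr)
  assume neg: "\<not> ?thesis"
  define S where "S = {0..t} \<inter> (\<lambda>s. norm (snd (\<gamma> s))) -` {R..}"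
  have c\<gamma>: "continuous_on T \<gamma>" for T
    using d by (meson continuous_at_imp_continuous_on has_vector_derivative_continuous)
  have "closed S"
    unfolding S_def by (intro closed_Int closed_atLeastAtMost closed_vimage closed_atLeast continuous_intros c\<gamma>)
  moreover have "bounded S" unfolding S_def by (rule bounded_subset[OF bounded_closed_interval]) auto
  moreover have "t \<in> S" using neg t by (auto simp: S_def)
  ultimately have "compact S" "S \<noteq> {}" by (auto simp: compact_eq_bounded_closed)
  from compact_attains_inf[OF this] obtain s0 where s0: "s0 \<in> S" "\<And>s. s \<in> S \<Longrightarrow> s0 \<le> s"
    by blast
  have s0': "0 \<le> s0" "s0 \<le> t" "norm (snd (\<gamma> s0)) \<ge> R" using s0(1) by (auto simp: S_def)
  have below: "norm (snd (\<gamma> s)) < R" if "0 \<le> s" "s < s0" for s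
    using s0(2)[of s] that s0' by (force simp: S_def)
  have "lift_fun H (\<gamma> s0) = lift_fun H (\<gamma> 0)"
  proof (cases "s0 = 0")
    case False
    show ?thesis
    proof (rule DERIV_isconst2[of 0 s0 _ s0])
      show "continuous_on {0..s0} (\<lambda>s. lift_fun H (\<gamma> s))"
        by (rule continuous_on_compose2[OF continuous_on_liftH c\<gamma>]) auto
      show "((\<lambda>s. lift_fun H (\<gamma> s)) has_real_derivative 0) (at s)" if "0 < s" "s < s0" for s
        using d[of s] X[of "\<gamma> s"] below[of s] that by (intro energy_derivative[of \<gamma> c]) auto
    qed (use False s0' in auto)
  qed simp
  moreover have "lift_fun H (\<gamma> s0) > lift_fun H (\<gamma> 0)"
    using R[OF s0'(3), of "fst (\<gamma> s0)"] by simp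
  ultimately show False by simp
qed

text \<open>Replacing the momentum by its projection to a large ball makes the Hamiltonian field bounded
  and Lipschitz, and by the energy barrier the orbit never meets the modified region.\<close>

lemma flow_exists: "\<exists>\<gamma>. \<gamma> 0 = z \<and> (\<forall>s. (\<gamma> has_vector_derivative ham_field H (\<gamma> s)) (at s))"
proof -
  obtain R where R: "R > 0" "\<And>x p. norm p \<ge> R \<Longrightarrow> lift_fun H (x, p) > lift_fun H z"
    using uniformly_coercive by blast
  define P where "P = closest_point (cball (0 :: real ^ 'n) R)"
  have P: "norm (P p) \<le> R" for p
    using closest_point_in_set[of "cball (0 :: real ^ 'n) R" p] R(1) by (auto simp: P_def)
  have P_id: "P p = p" if "norm p \<le> R" for p
    using closest_point_self[of p "cball 0 R"] that by (simp add: P_def)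
  have P_lip: "norm (P p - P q) \<le> norm (p - q)" for p q
    using closest_point_lipschitz[of "cball (0 :: real ^ 'n) R" p q] R(1) by (simp add: P_def dist_norm)
  define X where "X w = ham_field H (fst w, P (snd w))" for w
  obtain C where C: "C \<ge> 0" "\<And>z w. norm (snd z) \<le> R \<Longrightarrow> norm (snd w) \<le> R \<Longrightarrow>
     norm (ham_field H z - ham_field H w) \<le> C * norm (z - w)"
    using ham_field_lipschitz[of R] by blast
  have "C-lipschitz_on UNIV X"
  proof (rule lipschitz_onI)
    fix z w :: "(real ^ 'n) \<times> (real ^ 'n)"
    have "dist (X z) (X w) \<le> C * norm ((fst z, P (snd z)) - (fst w, P (snd w)))"
      unfolding X_def dist_norm by (intro C) (auto simp: P)
    also have "norm ((fst z, P (snd z)) - (fst w, P (snd w))) \<le> norm (z - w)"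
      by (cases z, cases w) (auto simp: norm_Pair intro!: power_mono P_lip)
    finally show "dist (X z) (X w) \<le> C * dist z w" using C(1) by (simp add: dist_norm mult_left_mono)
  qed (rule C)
  moreover obtain M where "M \<ge> 0" and M: "\<And>x p. norm p \<le> R \<Longrightarrow> norm (gradH (x, p)) \<le> M"
    using gradH_bounded[of R] by blast
  have "norm (X w) \<le> M" for w
  proof -
    have "norm (X w) = norm (gradH (fst w, P (snd w)))"
      unfolding X_def ham_field_eq norm_prod_def by (simp add: add.commute)
    then show ?thesis using M P by simp
  qed
  ultimately obtain \<gamma> where \<gamma>: "\<gamma> 0 = z" "\<And>t. (\<gamma> has_vector_derivative X (\<gamma> t)) (at t)"
    using bounded_lipschitz_field_has_global_flow[of C X M z] by blast
  have XH: "X w = ham_field H w" if "norm (snd w) \<le> R" for w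
    using that by (simp add: X_def P_id)
  have "norm (snd (\<gamma> t)) < R" if "t \<ge> 0" for t
    using energy_barrier[of \<gamma> 1 X R t] \<gamma> XH R(2) that by simp
  moreover have "norm (snd (\<gamma> (- t))) < R" if "t \<ge> 0" for t
    using energy_barrier[of "\<lambda>s. \<gamma> (- s)" "-1" X R t] reversed_curve[OF \<gamma>(2)] \<gamma>(1) XH R(2) that by simp
  ultimately have "norm (snd (\<gamma> t)) < R" for t
    by (metis linear minus_minus neg_0_le_iff_le)
  then show ?thesis using \<gamma> XH by (metis less_imp_le)
qed

lemma energy_constant:
  assumes "\<And>s. (\<gamma> has_vector_derivative ham_field H (\<gamma> s)) (at s)"
  shows "lift_fun H (\<gamma> t) = lift_fun H (\<gamma> 0)"
proof -
  have "((\<lambda>s. lift_fun H (\<gamma> s)) has_real_derivative 0) (at s)" for s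
    using assms[of s] by (intro energy_derivative[of \<gamma> 1]) simp
  then show ?thesis using DERIV_isconst_all[of "\<lambda>s. lift_fun H (\<gamma> s)" t 0] by blast
qed

lemma orbits_confined:
  obtains R where "\<And>\<gamma> t. (\<And>s. (\<gamma> has_vector_derivative ham_field H (\<gamma> s)) (at s)) \<Longrightarrow>
    norm (snd (\<gamma> 0)) \<le> r \<Longrightarrow> norm (snd (\<gamma> t)) \<le> R"
proof -
  obtain B where B: "\<And>x p. norm p \<le> r \<Longrightarrow> norm (lift_fun H (x, p)) \<le> B"
    by (rule periodic_bounded[of "lift_fun H" r]) (auto simp: continuous_on_liftH liftH_periodic)
  obtain R where R: "\<And>x p. norm p \<ge> R \<Longrightarrow> lift_fun H (x, p) > B"
    using uniformly_coercive by blast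
  show thesis
  proof (rule that[of R])
    fix \<gamma> :: "real \<Rightarrow> (real ^ 'n) \<times> (real ^ 'n)" and t
    assume d: "\<And>s. (\<gamma> has_vector_derivative ham_field H (\<gamma> s)) (at s)" and "norm (snd (\<gamma> 0)) \<le> r"
    then have "lift_fun H (\<gamma> 0) \<le> B" using B[of "snd (\<gamma> 0)" "fst (\<gamma> 0)"] by simp
    then have "lift_fun H (\<gamma> t) \<le> B" using energy_constant[OF d, of t] by simp
    then show "norm (snd (\<gamma> t)) \<le> R" using R[of "snd (\<gamma> t)" "fst (\<gamma> t)"] by fastforce
  qed
qed

lemma flow_dependence:
  obtains C where "C \<ge> 0" "\<And>\<gamma> \<delta> t. (\<And>s. (\<gamma> has_vector_derivative ham_field H (\<gamma> s)) (at s)) \<Longrightarrow>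
    (\<And>s. (\<delta> has_vector_derivative ham_field H (\<delta> s)) (at s)) \<Longrightarrow>
    norm (snd (\<gamma> 0)) \<le> r \<Longrightarrow> norm (snd (\<delta> 0)) \<le> r \<Longrightarrow>
    norm (\<gamma> t - \<delta> t) \<le> exp (C * \<bar>t\<bar>) * norm (\<gamma> 0 - \<delta> 0)"
proof -
  obtain R where R: "\<And>\<gamma> t. (\<And>s. (\<gamma> has_vector_derivative ham_field H (\<gamma> s)) (at s)) \<Longrightarrow>
    norm (snd (\<gamma> 0)) \<le> r \<Longrightarrow> norm (snd (\<gamma> t)) \<le> R"
    using orbits_confined[of r] by blast
  obtain C where C: "C \<ge> 0" "\<And>z w. norm (snd z) \<le> R \<Longrightarrow> norm (snd w) \<le> R \<Longrightarrow>
     norm (ham_field H z - ham_field H w) \<le> C * norm (z - w)"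
    using ham_field_lipschitz[of R] by blast
  show thesis
  proof (rule that[OF C(1)])
    fix \<gamma> \<delta> :: "real \<Rightarrow> (real ^ 'n) \<times> (real ^ 'n)" and t
    assume d: "\<And>s. (\<gamma> has_vector_derivative ham_field H (\<gamma> s)) (at s)"
        "\<And>s. (\<delta> has_vector_derivative ham_field H (\<delta> s)) (at s)"
      and r: "norm (snd (\<gamma> 0)) \<le> r" "norm (snd (\<delta> 0)) \<le> r"
    have lip: "norm (ham_field H (\<gamma> s) - ham_field H (\<delta> s)) \<le> C * norm (\<gamma> s - \<delta> s)" for s
      by (intro C R d r)
    show "norm (\<gamma> t - \<delta> t) \<le> exp (C * \<bar>t\<bar>) * norm (\<gamma> 0 - \<delta> 0)"
    proof (cases "t \<ge> 0")
      case True
      then show ?thesis using gronwall[OF True d lip] by simp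
    next
      case False
      have lip': "norm (- ham_field H (\<gamma> (- s)) - - ham_field H (\<delta> (- s))) \<le> C * norm (\<gamma> (- s) - \<delta> (- s))" for s
        using lip[of "- s"] by (metis minus_diff_minus norm_minus_cancel)
      have "norm (\<gamma> (- (- t)) - \<delta> (- (- t))) \<le> exp (C * (- t)) * norm (\<gamma> (- 0) - \<delta> (- 0))"
        by (rule gronwall[OF _ reversed_curve[OF d(1)] reversed_curve[OF d(2)] lip']) (use False in simp)
      then show ?thesis using False by simp
    qed
  qed
qed

lemma flow_unique:
  assumes "\<And>s. (\<gamma> has_vector_derivative ham_field H (\<gamma> s)) (at s)"
    and "\<And>s. (\<delta> has_vector_derivative ham_field H (\<delta> s)) (at s)" and "\<gamma> 0 = \<delta> 0"
  shows "\<gamma> t = \<delta> t"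
proof -
  obtain C where "norm (\<gamma> t - \<delta> t) \<le> exp (C * \<bar>t\<bar>) * norm (\<gamma> 0 - \<delta> 0)"
    using flow_dependence[of "norm (snd (\<gamma> 0))"] assms by (metis order_refl)
  with assms(3) show ?thesis by simp
qed

abbreviation \<Phi> where "\<Phi> \<equiv> lifted_ham_flow H"

text \<open>Existence and uniqueness of orbits show that the definite description in the definition of the
  flow denotes the orbit.\<close>

lemma flow_zero_derivative:
  shows flow_0: "\<Phi> 0 z = z"
    and flow_derivative: "((\<lambda>s. \<Phi> s z) has_vector_derivative ham_field H (\<Phi> s z)) (at s)"
proof -
  let ?sol = "\<lambda>\<gamma>. \<gamma> 0 = z \<and> (\<forall>s. (\<gamma> has_vector_derivative ham_field H (\<gamma> s)) (at s))"
  have "\<exists>!\<gamma>. ?sol \<gamma>"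
  proof -
    obtain \<gamma> where g: "?sol \<gamma>" using flow_exists by blast
    show ?thesis
    proof (rule ex1I[of ?sol, OF g])
      fix \<delta> assume "?sol \<delta>"
      show "\<delta> = \<gamma>"
      proof
        fix t show "\<delta> t = \<gamma> t" by (rule flow_unique[of \<delta> \<gamma> t]) (use g \<open>?sol \<delta>\<close> in auto)
      qed
    qed
  qed
  from theI'[OF this] show "\<Phi> 0 z = z"
      "((\<lambda>s. \<Phi> s z) has_vector_derivative ham_field H (\<Phi> s z)) (at s)"
    unfolding lifted_ham_flow_def by blast+
qed

lemma flow_eqI:
  assumes "\<And>s. (\<gamma> has_vector_derivative ham_field H (\<gamma> s)) (at s)" "\<gamma> 0 = z"
  shows "\<Phi> t z = \<gamma> t"
  by (rule flow_unique[OF flow_derivative assms(1)]) (simp add: assms flow_0)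

lemma flow_add: "\<Phi> (s + t) z = \<Phi> s (\<Phi> t z)"
proof -
  have "((\<lambda>s. \<Phi> (s + t) z) has_vector_derivative ham_field H (\<Phi> (s + t) z)) (at s)" for s
  proof -
    have "((\<lambda>s. s + t) has_vector_derivative 1) (at s)"
      by (auto intro!: derivative_eq_intros simp flip: has_real_derivative_iff_has_vector_derivative)
    from vector_diff_chain_at[OF this flow_derivative] show ?thesis by (simp add: o_def)
  qed
  from flow_eqI[OF this, of "\<Phi> t z" s] show ?thesis by simp
qed

lemma ham_field_periodic: "a \<in> int_lattice \<Longrightarrow> ham_field H (x + a, p) = ham_field H (x, p)"
  by (simp add: ham_field_eq gradH_periodic)

lemma flow_lattice:
  assumes a: "a \<in> int_lattice"
  shows "\<Phi> t (x + a, p) = \<Phi> t (x, p) + (a, 0)"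
proof (rule flow_eqI)
  show "((\<lambda>t. \<Phi> t (x, p) + (a, 0)) has_vector_derivative ham_field H (\<Phi> s (x, p) + (a, 0))) (at s)" for s
  proof -
    have "ham_field H (\<Phi> s (x, p) + (a, 0)) = ham_field H (\<Phi> s (x, p))"
      using ham_field_periodic[OF a] by (cases "\<Phi> s (x, p)") simp
    then show ?thesis using flow_derivative[of "(x, p)" s] by (auto intro!: derivative_eq_intros)
  qed
qed (simp add: flow_0)

lemma flow_energy: "lift_fun H (\<Phi> t z) = lift_fun H z"
  using energy_constant[of "\<lambda>s. \<Phi> s z" t, OF flow_derivative] by (simp add: flow_0)

lemma flow_lipschitz:
  obtains C where "C \<ge> 0" "\<And>z w t. norm (snd z) \<le> r \<Longrightarrow> norm (snd w) \<le> r \<Longrightarrow>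
    norm (\<Phi> t z - \<Phi> t w) \<le> exp (C * \<bar>t\<bar>) * norm (z - w)"
proof -
  obtain C where C: "C \<ge> 0" "\<And>\<gamma> \<delta> t. (\<And>s. (\<gamma> has_vector_derivative ham_field H (\<gamma> s)) (at s)) \<Longrightarrow>
    (\<And>s. (\<delta> has_vector_derivative ham_field H (\<delta> s)) (at s)) \<Longrightarrow>
    norm (snd (\<gamma> 0)) \<le> r \<Longrightarrow> norm (snd (\<delta> 0)) \<le> r \<Longrightarrow>
    norm (\<gamma> t - \<delta> t) \<le> exp (C * \<bar>t\<bar>) * norm (\<gamma> 0 - \<delta> 0)"
    using flow_dependence[of r] by blast
  show thesis
    using C(2)[OF flow_derivative flow_derivative] by (intro that[OF C(1)]) (simp add: flow_0)
qed

lemma continuous_on_flow: "continuous_on UNIV (\<Phi> t)"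
proof -
  have "isCont (\<Phi> t) z" for z
  proof -
    obtain C where "C \<ge> 0" and C': "\<And>z' w t. norm (snd z') \<le> norm (snd z) + 1 \<Longrightarrow>
      norm (snd w) \<le> norm (snd z) + 1 \<Longrightarrow> norm (\<Phi> t z' - \<Phi> t w) \<le> exp (C * \<bar>t\<bar>) * norm (z' - w)"
      using flow_lipschitz[of "norm (snd z) + 1"] by blast
    have near: "norm (snd y) \<le> norm (snd z) + 1" if "y \<in> ball z 1" for y
      using dist_snd_le[of z y] that norm_triangle_ineq2[of "snd y" "snd z"]
      by (simp add: dist_norm norm_minus_commute)
    have C: "dist (\<Phi> t z') (\<Phi> t w) \<le> exp (C * \<bar>t\<bar>) * dist z' w"
      if "z' \<in> ball z 1" "w \<in> ball z 1" for z' w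
      using C'[OF near near, OF that] by (simp add: dist_norm)
    have "(exp (C * \<bar>t\<bar>))-lipschitz_on (ball z 1) (\<Phi> t)" by (rule lipschitz_onI) (use C in auto)
    then have "continuous_on (ball z 1) (\<Phi> t)" by (rule lipschitz_on_continuous_on)
    then show ?thesis by (simp add: continuous_on_eq_continuous_at)
  qed
  then show ?thesis by (simp add: continuous_at_imp_continuous_on)
qed

text \<open>Any lift of the base point computes the flow, because the lifted flow commutes with lattice
  translations.\<close>

lemma ham_flow_proj: "ham_flow H t (torus_proj x, p) = apfst torus_proj (\<Phi> t (x, p))"
proof -
  define a where "a = rep_torus (torus_proj x) - x"
  have a: "a \<in> int_lattice" unfolding a_def by (simp flip: torus_proj_eq_iff)
  have "\<Phi> t (rep_torus (torus_proj x), p) = \<Phi> t (x, p) + (a, 0)"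
    using flow_lattice[OF a, of t x p] by (simp add: a_def)
  then show ?thesis
    by (cases "\<Phi> t (x, p)") (simp add: ham_flow_def torus_proj_add_lattice[OF a])
qed

lemma ham_flow_0: "ham_flow H 0 z = z"
proof -
  obtain x p where "z = (torus_proj x, p)" by (metis surj_pair torus_proj_rep)
  then show ?thesis by (simp add: ham_flow_proj flow_0)
qed

lemma ham_flow_add: "ham_flow H (s + t) z = ham_flow H s (ham_flow H t z)"
proof -
  obtain x p where z: "z = (torus_proj x, p)" by (metis surj_pair torus_proj_rep)
  obtain y q where "\<Phi> t (x, p) = (y, q)" by (metis surj_pair)
  then show ?thesis by (simp add: z ham_flow_proj flow_add)
qed

lemma continuous_on_ham_flow: "continuous_on S (ham_flow H t)"
proof -
  have "continuous_on UNIV (ham_flow H t)"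
  proof (rule continuous_on_torus_timesI)
    have "continuous_on UNIV (\<lambda>z. (torus_proj (fst (\<Phi> t z)), snd (\<Phi> t z)))"
      by (intro continuous_intros continuous_on_flow)
    then show "continuous_on UNIV (\<lambda>(x, p). ham_flow H t (torus_proj x, p))"
      by (simp add: ham_flow_proj apfst_def map_prod_def case_prod_beta)
  qed
  then show ?thesis by (rule continuous_on_subset) simp
qed

end

section \<open>Invariant Lagrangian graphs\<close>

lemma GDERIV_of_first_order_remainder:
  fixes f :: "'a::real_inner \<Rightarrow> real"
  assumes "\<And>y. \<bar>f y - f x - D \<bullet> (y - x)\<bar> \<le> K * (norm (y - x))\<^sup>2"
  shows "GDERIV f x :> D"
  unfolding gderiv_def
proof (rule has_derivativeI_sandwich[where e = 1 and H = "\<lambda>y. K * norm (y - x)"])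
  show "bounded_linear (\<lambda>h. h \<bullet> D)" by (rule bounded_linear_inner_left)
  show "norm (f y - f x - (y - x) \<bullet> D) / norm (y - x) \<le> K * norm (y - x)" if "y \<noteq> x" for y
    using assms[of y] that by (simp add: divide_le_eq power2_eq_square inner_commute mult_ac)
  have "((\<lambda>y. K * norm (y - x)) \<longlongrightarrow> K * norm (x - x)) (at x within UNIV)" by (intro tendsto_intros)
  then show "((\<lambda>y. K * norm (y - x)) \<longlongrightarrow> 0) (at x within UNIV)" by simp
qed simp

text \<open>Such a function has derivative zero everywhere.\<close>

lemma quadratic_variation_imp_constant:
  fixes f :: "'a::real_inner \<Rightarrow> real"
  assumes "\<And>x y. \<bar>f y - f x\<bar> \<le> K * (norm (y - x))\<^sup>2"
  shows "f x = f y"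
proof -
  have d: "GDERIV f x :> 0" for x
    using assms by (intro GDERIV_of_first_order_remainder[where K = K]) simp
  obtain s where "f x - f y = 0 \<bullet> (x - y)"
    using GDERIV_mean_value[of f y x "\<lambda>_. 0"] d by blast
  then show ?thesis by simp
qed

lemma norm_snd_diff_le: "norm (snd a - snd b) \<le> norm (a - b)"
  using dist_snd_le[of a b] by (simp add: dist_norm)

lemma tendsto_apply_bcontfun:
  fixes U :: "nat \<Rightarrow> 'a::metric_space \<Rightarrow>\<^sub>C 'b::real_normed_vector"
  assumes U: "U \<longlonglongrightarrow> u" and q: "Q \<longlonglongrightarrow> q"
  shows "(\<lambda>k. U k (Q k)) \<longlonglongrightarrow> u q"
proof (rule Lim_transform)
  show "(\<lambda>k. u (Q k)) \<longlonglongrightarrow> u q"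
    by (rule continuous_on_tendsto_compose[OF continuous_on_apply_bcontfun[of UNIV] q]) auto
  show "(\<lambda>k. U k (Q k) - u (Q k)) \<longlonglongrightarrow> 0"
  proof (rule Lim_null_comparison)
    show "eventually (\<lambda>k. norm (U k (Q k) - u (Q k)) \<le> dist (U k) u) sequentially"
      by (simp add: dist_bounded flip: dist_norm)
    show "(\<lambda>k. dist (U k) u) \<longlonglongrightarrow> 0" using U by (subst tendsto_dist_iff[symmetric])
  qed
qed

abbreviation lift_field :: "'n::finite covector_field \<Rightarrow> real ^ 'n \<Rightarrow> real ^ 'n" where
  "lift_field u x \<equiv> u (torus_proj x)"

abbreviation field_primitive :: "'n::finite covector_field \<Rightarrow> real ^ 'n \<Rightarrow> real" where
  "field_primitive u \<equiv> radial_primitive (lift_field u)"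

lemma continuous_on_lift_field: "continuous_on S (lift_field u)"
  by (rule continuous_on_compose2[OF continuous_on_apply_bcontfun[where T = UNIV] continuous_on_torus_proj]) simp

lemma lift_field_lipschitz:
  assumes "lagrangian_graph u"
  obtains L where "L \<ge> 0" "\<And>x y. norm (lift_field u x - lift_field u y) \<le> L * norm (x - y)"
proof -
  obtain L where L: "L-lipschitz_on UNIV (apply_bcontfun u)"
    using assms unfolding lagrangian_graph_def by blast
  show thesis
  proof (rule that[of L])
    show L0: "L \<ge> 0" using L by (rule lipschitz_on_nonneg)
    show "norm (lift_field u x - lift_field u y) \<le> L * norm (x - y)" for x y
      using lipschitz_onD[OF L, of "torus_proj x" "torus_proj y"] mult_left_mono[OF dist_torus_proj_le[of x y] L0]
      by (simp add: dist_norm)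
  qed
qed

lemma lipschitz_on_torusI:
  fixes u :: "'n::finite covector_field"
  assumes L: "L \<ge> 0" "\<And>x y. norm (lift_field u x - lift_field u y) \<le> L * norm (x - y)"
  shows "L-lipschitz_on UNIV (apply_bcontfun u)"
proof (rule lipschitz_onI)
  fix q q' :: "'n torus"
  obtain x where x: "q = torus_proj x" by (rule torus_cases)
  obtain y where y: "torus_proj y = q'" "dist x y = dist (torus_proj x) q'" by (rule nearest_lift)
  show "dist (u q) (u q') \<le> L * dist q q'"
    using L(2)[of x y] y(2) unfolding x y(1)[symmetric] by (simp add: dist_norm)
qed (rule L)

lemma GDERIV_field_primitive:
  assumes "lagrangian_graph u"
  shows "GDERIV (field_primitive u) x :> lift_field u x"
  by (rule radial_primitive_of_local_gradient[OF continuous_on_lift_field])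
    (use assms in \<open>simp add: lagrangian_graph_def\<close>)

lemma in_graph_of_iff: "(q, p) \<in> graph_of u \<longleftrightarrow> p = u q"
  unfolding graph_of_def by auto

context tonelli_hamiltonian
begin

text \<open>Inclusion in one direction for all times is enough, since the flow is a group.\<close>

lemma invariant_iff:
  "invariant_lagrangian_graph H u \<longleftrightarrow> lagrangian_graph u \<and>
     (\<forall>t x. snd (\<Phi> t (x, lift_field u x)) = lift_field u (fst (\<Phi> t (x, lift_field u x))))"
proof -
  have mem: "ham_flow H t (torus_proj x, lift_field u x) \<in> graph_of u \<longleftrightarrow>
      snd (\<Phi> t (x, lift_field u x)) = lift_field u (fst (\<Phi> t (x, lift_field u x)))" for t x
    by (cases "\<Phi> t (x, lift_field u x)") (simp add: ham_flow_proj in_graph_of_iff)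
  have graph: "graph_of u = range (\<lambda>x. (torus_proj x, lift_field u x))"
  proof -
    have "range (torus_proj :: real ^ 'n \<Rightarrow> _) = UNIV" by (metis torus_proj_rep surjI)
    moreover have "range (\<lambda>x. (torus_proj x, lift_field u x))
        = (\<lambda>q. (q, u q)) ` range torus_proj" by (simp add: image_image)
    ultimately show ?thesis unfolding graph_of_def by simp
  qed
  have "(\<forall>t. ham_flow H t ` graph_of u = graph_of u) \<longleftrightarrow> (\<forall>t. ham_flow H t ` graph_of u \<subseteq> graph_of u)"
  proof (intro iffI allI)
    fix t assume *: "\<forall>t. ham_flow H t ` graph_of u \<subseteq> graph_of u"
    have "graph_of u \<subseteq> ham_flow H t ` graph_of u"
    proof
      fix z assume "z \<in> graph_of u"
      then have "ham_flow H (- t) z \<in> graph_of u" using * by blast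
      moreover have "ham_flow H t (ham_flow H (- t) z) = z"
        using ham_flow_add[of t "- t" z] by (simp add: ham_flow_0)
      ultimately show "z \<in> ham_flow H t ` graph_of u" by (metis imageI)
    qed
    with * show "ham_flow H t ` graph_of u = graph_of u" by blast
  qed auto
  also have "\<dots> \<longleftrightarrow> (\<forall>t x. ham_flow H t (torus_proj x, lift_field u x) \<in> graph_of u)"
    unfolding image_subset_iff by (subst (1) graph) simp
  finally show ?thesis unfolding invariant_lagrangian_graph_def mem by simp
qed

lemma flow_on_graph:
  assumes "invariant_lagrangian_graph H u"
  shows "snd (\<Phi> t (x, lift_field u x)) = lift_field u (fst (\<Phi> t (x, lift_field u x)))"
  using assms invariant_iff by blast

text \<open>Hamilton's equations, with an arbitrary origin of time \<open>a\<close>.\<close>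

lemma flow_components:
  shows flow_fst_derivative: "((\<lambda>s. fst (\<Phi> (s + a) z)) has_vector_derivative
      Hp (fst (\<Phi> (s + a) z)) (snd (\<Phi> (s + a) z))) (at s)"
    and flow_snd_derivative: "((\<lambda>s. snd (\<Phi> (s + a) z)) has_vector_derivative
      - Hx (fst (\<Phi> (s + a) z)) (snd (\<Phi> (s + a) z))) (at s)"
proof -
  have *: "((\<lambda>s. \<Phi> (s + a) z) has_vector_derivative ham_field H (\<Phi> (s + a) z)) (at s)"
    using flow_derivative[of "\<Phi> a z" s] by (simp add: flow_add)
  have "((\<lambda>s. fst (\<Phi> (s + a) z)) has_vector_derivative fst (ham_field H (\<Phi> (s + a) z))) (at s)"
    using bounded_linear.has_vector_derivative[OF bounded_linear_fst *] .
  then show "((\<lambda>s. fst (\<Phi> (s + a) z)) has_vector_derivative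
      Hp (fst (\<Phi> (s + a) z)) (snd (\<Phi> (s + a) z))) (at s)"
    by (cases "\<Phi> (s + a) z") (simp add: ham_field_eq)
  have "((\<lambda>s. snd (\<Phi> (s + a) z)) has_vector_derivative snd (ham_field H (\<Phi> (s + a) z))) (at s)"
    using bounded_linear.has_vector_derivative[OF bounded_linear_snd *] .
  then show "((\<lambda>s. snd (\<Phi> (s + a) z)) has_vector_derivative
      - Hx (fst (\<Phi> (s + a) z)) (snd (\<Phi> (s + a) z))) (at s)"
    by (cases "\<Phi> (s + a) z") (simp add: ham_field_eq)
qed

lemma H_first_order:
  assumes C: "\<And>x p y q. norm p \<le> r \<Longrightarrow> norm q \<le> r \<Longrightarrow>
     norm (gradH (x, p) - gradH (y, q)) \<le> C * norm ((x, p) - (y, q))" and C0: "C \<ge> 0"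
    and pq: "norm p \<le> r" "norm q \<le> r"
  shows "\<bar>lift_fun H (y, p) - lift_fun H (x, q) - (Hx x q \<bullet> (y - x) + Hp x q \<bullet> (p - q))\<bar>
      \<le> C * (norm ((y, p) - (x, q)))\<^sup>2"
proof -
  have "\<bar>lift_fun H (y, p) - lift_fun H (x, q) - gradH (x, q) \<bullet> ((y, p) - (x, q))\<bar>
      \<le> C * (norm ((y, p) - (x, q)))\<^sup>2"
  proof (rule first_order_remainder[OF GDERIV_H])
    fix s :: real assume s: "s \<in> {0..1}"
    have "norm (q + s *\<^sub>R (p - q)) \<le> r" using norm_segment_le[OF pq] s by simp
    then have "norm (gradH (x + s *\<^sub>R (y - x), q + s *\<^sub>R (p - q)) - gradH (x, q))
        \<le> C * norm ((x + s *\<^sub>R (y - x), q + s *\<^sub>R (p - q)) - (x, q))"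
      using C pq by blast
    also have "(x + s *\<^sub>R (y - x), q + s *\<^sub>R (p - q)) - (x, q) = s *\<^sub>R ((y, p) - (x, q))" by simp
    also have "norm (s *\<^sub>R ((y, p) - (x, q))) \<le> norm ((y, p) - (x, q))"
      unfolding norm_scaleR using s mult_right_mono[of "\<bar>s\<bar>" 1 "norm ((y, p) - (x, q))"] by simp
    finally show "norm (gradH ((x, q) + s *\<^sub>R ((y, p) - (x, q))) - gradH (x, q)) \<le> C * norm ((y, p) - (x, q))"
      using C0 by (simp add: mult_left_mono)
  qed
  then show ?thesis by (simp add: inner_prod_def)
qed

text \<open>The energy \<open>F x = H (x, u x)\<close> is constant because \<open>F y - F x = O(\<bar>y - x\<bar>\<^sup>2)\<close>. Let \<open>X\<close> and \<open>Y\<close> be the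
  orbits through \<open>x\<close> and \<open>y\<close>, let \<open>f\<close> be a primitive of \<open>u\<close>, and consider
  \<open>D s = f (Y s) - f (X s) - u (X s) \<bullet> (Y s - X s)\<close>. Since \<open>u\<close> is Lipschitz and the flow depends in
  a Lipschitz way on the starting point, \<open>D s\<close> is quadratic in \<open>\<bar>y - x\<bar>\<close> for \<open>s\<close> in the unit
  interval. By Hamilton's equations the derivative of \<open>D\<close> is the first order expansion of the
  energy difference of the two orbits, which is \<open>F y - F x\<close> for all times, up to a quadratic
  error. Comparing increments in this way avoids differentiating \<open>u\<close>, which is only Lipschitz.\<close>

theorem hamilton_jacobi:
  assumes inv: "invariant_lagrangian_graph H u"
  shows "lift_fun H (x, lift_field u x) = lift_fun H (y, lift_field u y)"
proof -
  let ?u = "lift_field u" and ?f = "field_primitive u"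
  define r where "r = norm u"
  have r: "norm (?u x) \<le> r" for x unfolding r_def by (rule norm_bounded)
  have lag: "lagrangian_graph u" using inv by (simp add: invariant_lagrangian_graph_def)
  obtain L where L: "L \<ge> 0" "\<And>x y. norm (?u x - ?u y) \<le> L * norm (x - y)"
    using lift_field_lipschitz[OF lag] by blast
  obtain C where C: "C \<ge> 0" "\<And>x p y q. norm p \<le> r \<Longrightarrow> norm q \<le> r \<Longrightarrow>
     norm (gradH (x, p) - gradH (y, q)) \<le> C * norm ((x, p) - (y, q))"
    using gradH_lipschitz[of r] by blast
  obtain E where E: "E \<ge> 0" "\<And>z w t. norm (snd z) \<le> r \<Longrightarrow> norm (snd w) \<le> r \<Longrightarrow>
    norm (\<Phi> t z - \<Phi> t w) \<le> exp (E * \<bar>t\<bar>) * norm (z - w)"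
    using flow_lipschitz[of r] by blast
  define F where "F x = lift_fun H (x, ?u x)" for x
  \<comment> \<open>up to time \<open>1\<close> the orbits through \<open>(x, u x)\<close> and \<open>(y, u y)\<close> separate by at most \<open>B \<bar>y - x\<bar>\<close>\<close>
  define B where "B = exp E * (1 + L)"
  have "\<bar>F y - F x\<bar> \<le> ((2 * C + 2 * L) * B\<^sup>2) * (norm (y - x))\<^sup>2" for x y
  proof -
    define X where "X s = fst (\<Phi> (s + 0) (x, ?u x))" for s
    define Y where "Y s = fst (\<Phi> (s + 0) (y, ?u y))" for s
    have PX: "\<Phi> s (x, ?u x) = (X s, ?u (X s))" and PY: "\<Phi> s (y, ?u y) = (Y s, ?u (Y s))" for s
      using flow_on_graph[OF inv, of s x] flow_on_graph[OF inv, of s y]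
      by (auto simp: X_def Y_def prod_eq_iff)
    have dX: "(X has_vector_derivative Hp (X s) (?u (X s))) (at s)"
      and dY: "(Y has_vector_derivative Hp (Y s) (?u (Y s))) (at s)"
      and dU: "((\<lambda>s. ?u (X s)) has_vector_derivative - Hx (X s) (?u (X s))) (at s)" for s
      using flow_fst_derivative[of 0 "(x, ?u x)" s] flow_fst_derivative[of 0 "(y, ?u y)" s]
        flow_snd_derivative[of 0 "(x, ?u x)" s]
      unfolding X_def[abs_def, symmetric] Y_def[abs_def, symmetric] by (simp_all add: PX PY)
    define \<delta> where "\<delta> s = norm ((Y s, ?u (Y s)) - (X s, ?u (X s)))" for s
    have \<delta>: "(\<delta> s)\<^sup>2 \<le> (B * norm (y - x))\<^sup>2" if "s \<in> {0..1}" for s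
    proof (rule power_mono)
      have "norm ((y, ?u y) - (x, ?u x)) \<le> norm (y - x) + norm (?u y - ?u x)"
        by (metis diff_Pair norm_Pair_le)
      also have "\<dots> \<le> (1 + L) * norm (y - x)" using L(2)[of y x] by (simp add: algebra_simps)
      finally have n: "norm ((y, ?u y) - (x, ?u x)) \<le> (1 + L) * norm (y - x)" .
      have "\<delta> s \<le> exp (E * \<bar>s\<bar>) * norm ((y, ?u y) - (x, ?u x))"
        unfolding \<delta>_def PX[symmetric] PY[symmetric] by (rule E) (auto simp: r)
      also have "\<dots> \<le> exp E * ((1 + L) * norm (y - x))"
        using that E(1) by (intro mult_mono n) (auto simp: mult_left_le)
      finally show "\<delta> s \<le> B * norm (y - x)" by (simp add: B_def mult.assoc)
    qed (simp add: \<delta>_def)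
    have YX: "(norm (Y s - X s))\<^sup>2 \<le> (\<delta> s)\<^sup>2" for s
      unfolding \<delta>_def by (simp add: norm_Pair)
    define D where "D s = ?f (Y s) - ?f (X s) - ?u (X s) \<bullet> (Y s - X s)" for s
    define D' where "D' s = (?u (Y s) - ?u (X s)) \<bullet> Hp (Y s) (?u (Y s)) + Hx (X s) (?u (X s)) \<bullet> (Y s - X s)" for s
    have dD: "(D has_real_derivative D' s) (at s)" for s
    proof -
      have "((\<lambda>s. ?u (X s) \<bullet> (Y s - X s)) has_real_derivative
          ?u (X s) \<bullet> (Hp (Y s) (?u (Y s)) - Hp (X s) (?u (X s))) + (- Hx (X s) (?u (X s))) \<bullet> (Y s - X s)) (at s)"
        using has_derivative_inner[OF dU[of s, unfolded has_vector_derivative_def]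
            has_derivative_diff[OF dY[of s, unfolded has_vector_derivative_def] dX[of s, unfolded has_vector_derivative_def]]]
        unfolding has_field_derivative_def
        by (rule has_derivative_eq_rhs) (simp add: fun_eq_iff algebra_simps)
      then have "(D has_real_derivative (?u (Y s) \<bullet> Hp (Y s) (?u (Y s)) - ?u (X s) \<bullet> Hp (X s) (?u (X s)))
          - (?u (X s) \<bullet> (Hp (Y s) (?u (Y s)) - Hp (X s) (?u (X s))) + (- Hx (X s) (?u (X s))) \<bullet> (Y s - X s))) (at s)"
        unfolding D_def
        by (intro DERIV_diff GDERIV_along_curve[OF GDERIV_field_primitive[OF lag]] dX dY)
      then show ?thesis by (simp add: D'_def algebra_simps)
    qed
    have Dsmall: "\<bar>D s\<bar> \<le> L * (B * norm (y - x))\<^sup>2" if "s \<in> {0..1}" for s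
    proof -
      have "\<bar>D s\<bar> \<le> L * (norm (Y s - X s))\<^sup>2"
        unfolding D_def
      proof (rule first_order_remainder[OF GDERIV_field_primitive[OF lag]])
        fix \<tau> :: real assume \<tau>: "\<tau> \<in> {0..1}"
        have "norm (?u (X s + \<tau> *\<^sub>R (Y s - X s)) - ?u (X s)) \<le> L * norm (\<tau> *\<^sub>R (Y s - X s))"
          using L(2)[of "X s + \<tau> *\<^sub>R (Y s - X s)" "X s"] by simp
        also have "\<dots> \<le> L * norm (Y s - X s)"
          unfolding norm_scaleR using \<tau> L(1) mult_right_mono[of "\<bar>\<tau>\<bar>" 1 "norm (Y s - X s)"]
          by (intro mult_left_mono) auto
        finally show "norm (?u (X s + \<tau> *\<^sub>R (Y s - X s)) - ?u (X s)) \<le> L * norm (Y s - X s)" .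
      qed
      also have "\<dots> \<le> L * (B * norm (y - x))\<^sup>2"
        using order_trans[OF YX \<delta>[OF that]] L(1) by (rule mult_left_mono)
      finally show ?thesis .
    qed
    obtain s where s: "0 < s" "s < 1" "D 1 - D 0 = (1 - 0) * D' s"
      using MVT2[of 0 1 D D'] dD by auto
    have s': "s \<in> {0..1}" using s by simp
    have FE: "F y = lift_fun H (Y s, ?u (Y s))" "F x = lift_fun H (X s, ?u (X s))"
      unfolding F_def PX[symmetric] PY[symmetric] by (simp_all add: flow_energy)
    have 1: "\<bar>F y - F x - (Hx (X s) (?u (X s)) \<bullet> (Y s - X s) + Hp (X s) (?u (X s)) \<bullet> (?u (Y s) - ?u (X s)))\<bar> \<le> C * (\<delta> s)\<^sup>2"
      unfolding FE \<delta>_def by (rule H_first_order[OF C(2) C(1)]) (auto simp: r)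
    have 2: "\<bar>(?u (Y s) - ?u (X s)) \<bullet> (Hp (Y s) (?u (Y s)) - Hp (X s) (?u (X s)))\<bar> \<le> C * (\<delta> s)\<^sup>2"
    proof -
      have "norm (?u (Y s) - ?u (X s)) \<le> \<delta> s"
        using norm_snd_le[of "?u (Y s) - ?u (X s)" "Y s - X s"] by (simp add: \<delta>_def)
      moreover have "norm (Hp (Y s) (?u (Y s)) - Hp (X s) (?u (X s))) \<le> C * \<delta> s"
        unfolding \<delta>_def by (rule order_trans[OF norm_snd_diff_le C(2)[OF r r]])
      ultimately have "norm (?u (Y s) - ?u (X s)) * norm (Hp (Y s) (?u (Y s)) - Hp (X s) (?u (X s))) \<le> \<delta> s * (C * \<delta> s)"
        by (rule mult_mono) (auto simp: \<delta>_def)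
      then show ?thesis
        using Cauchy_Schwarz_ineq2 by (fastforce simp: power2_eq_square mult_ac intro: order_trans)
    qed
    have 3: "C * (\<delta> s)\<^sup>2 \<le> C * (B * norm (y - x))\<^sup>2" using \<delta>[OF s'] C(1) by (rule mult_left_mono)
    have "D' s - (Hx (X s) (?u (X s)) \<bullet> (Y s - X s) + Hp (X s) (?u (X s)) \<bullet> (?u (Y s) - ?u (X s)))
        = (?u (Y s) - ?u (X s)) \<bullet> (Hp (Y s) (?u (Y s)) - Hp (X s) (?u (X s)))"
      by (simp add: D'_def inner_diff_right inner_diff_left inner_commute)
    with 1 2 3 Dsmall[of 0] Dsmall[of 1] s(3)
    have "\<bar>F y - F x\<bar> \<le> 2 * (C * (B * norm (y - x))\<^sup>2) + 2 * (L * (B * norm (y - x))\<^sup>2)" by simp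
    then show ?thesis by (simp add: power_mult_distrib algebra_simps)
  qed
  then show ?thesis
    using quadratic_variation_imp_constant[of F] unfolding F_def by blast
qed

section \<open>The a priori Lipschitz estimate\<close>

text \<open>The infinitesimal form of the comparison of a calibrated orbit with a translate. For a point
  \<open>(x, q)\<close> on the orbit and a momentum \<open>p\<close> of the same energy over the translated point
  \<open>x + s h\<close>, Taylor expansion in the base variable and strong convexity in the momentum give a
  left hand side of at most \<open>C \<bar>h\<bar>\<^sup>2 + (C + 1) \<bar>h\<bar> \<bar>p - q\<bar> - m/2 \<bar>p - q\<bar>\<^sup>2\<close>. Maximising over \<open>\<bar>p - q\<bar>\<close>
  leaves a multiple of \<open>\<bar>h\<bar>\<^sup>2\<close> that does not involve the regularity of the graph.\<close>

lemma calibration_defect: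
  assumes C: "\<And>x p y q. norm p \<le> r \<Longrightarrow> norm q \<le> r \<Longrightarrow>
      norm (gradH (x, p) - gradH (y, q)) \<le> C * norm ((x, p) - (y, q))" and C0: "C \<ge> 0"
    and m: "m > 0" "\<And>x p v. norm p \<le> r \<Longrightarrow> hessH (x, p) (0, v) \<bullet> (0, v) \<ge> m * (norm v)\<^sup>2"
    and pq: "norm p \<le> r" "norm q \<le> r" and s: "0 \<le> s" "s \<le> 1"
    and level: "lift_fun H (x + s *\<^sub>R h, p) = lift_fun H (x, q)"
  shows "(p - q) \<bullet> Hp x q + norm (p - q) * norm h + s * (Hx x q \<bullet> h)
    \<le> (C + (C + 1)\<^sup>2 / (2 * m)) * (norm h)\<^sup>2"
proof -
  define a where "a = norm (p - q)"
  define b where "b = norm h"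
  have sh: "norm (s *\<^sub>R h) \<le> b"
    using s mult_right_mono[of s 1 "norm h"] by (simp add: b_def)
  have 1: "lift_fun H (x, q) \<ge> lift_fun H (x + s *\<^sub>R h, q) + Hp (x + s *\<^sub>R h) q \<bullet> (p - q) + m / 2 * a\<^sup>2"
    using strong_convexity[OF m(2) pq, where x = "x + s *\<^sub>R h"] level by (simp add: a_def)
  have 2: "lift_fun H (x + s *\<^sub>R h, q) \<ge> lift_fun H (x, q) + s * (Hx x q \<bullet> h) - C * b\<^sup>2"
  proof -
    have "(norm (s *\<^sub>R h))\<^sup>2 \<le> b\<^sup>2" using sh by (rule power_mono) simp
    then have "C * (norm (s *\<^sub>R h))\<^sup>2 \<le> C * b\<^sup>2" using C0 by (rule mult_left_mono)
    then show ?thesis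
      using H_first_order[OF C C0 pq(2) pq(2), of "x + s *\<^sub>R h" x] by (simp add: norm_Pair abs_le_iff)
  qed
  have 3: "\<bar>(Hp (x + s *\<^sub>R h) q - Hp x q) \<bullet> (p - q)\<bar> \<le> C * b * a"
  proof -
    have "norm (Hp (x + s *\<^sub>R h) q - Hp x q) \<le> norm (gradH (x + s *\<^sub>R h, q) - gradH (x, q))"
      by (rule norm_snd_diff_le)
    also have "\<dots> \<le> C * norm ((x + s *\<^sub>R h, q) - (x, q))" using C pq by blast
    also have "\<dots> \<le> C * b" using sh C0 by (intro mult_left_mono) (auto simp: norm_Pair)
    finally have "norm (Hp (x + s *\<^sub>R h) q - Hp x q) * norm (p - q) \<le> C * b * a"
      unfolding a_def by (intro mult_right_mono) auto
    then show ?thesis using Cauchy_Schwarz_ineq2 order_trans by blast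
  qed
  have "(p - q) \<bullet> Hp x q + s * (Hx x q \<bullet> h) \<le> C * b\<^sup>2 + C * b * a - m / 2 * a\<^sup>2"
    using 1 2 3 by (simp add: inner_diff_left inner_diff_right inner_commute abs_le_iff)
  moreover have "(C + 1) * b * a \<le> m / 2 * a\<^sup>2 + (C + 1)\<^sup>2 / (2 * m) * b\<^sup>2"
  proof -
    have "0 \<le> (m * a - (C + 1) * b)\<^sup>2 / (2 * m)" using m by simp
    also have "\<dots> = m / 2 * a\<^sup>2 + (C + 1)\<^sup>2 / (2 * m) * b\<^sup>2 - (C + 1) * b * a"
      using m by (simp add: field_simps power2_eq_square)
    finally show ?thesis by simp
  qed
  ultimately show ?thesis
    unfolding a_def[symmetric] b_def[symmetric] by (simp add: algebra_simps)
qed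

text \<open>With \<open>h = y - x\<close>, the orbit that reaches \<open>x\<close> at time \<open>1\<close> is compared with the curve obtained by
  adding \<open>s h\<close> at time \<open>s\<close>, which ends at \<open>y\<close>; this bounds the remainder from above. The orbit that
  leaves \<open>x\<close> at time \<open>0\<close>, with \<open>(1 - s) h\<close> added, starts at \<open>y\<close> and bounds it from below. In both
  cases the difference of the two increments of \<open>f\<close>, corrected by \<open>K \<bar>h\<bar>\<^sup>2 s\<close>, is nonincreasing
  by \<open>calibration_defect\<close>.\<close>

theorem first_order_estimate:
  obtains K where "K \<ge> 0" "\<And>u x y. invariant_lagrangian_graph H u \<Longrightarrow> norm u \<le> r \<Longrightarrow>
    \<bar>field_primitive u y - field_primitive u x - lift_field u x \<bullet> (y - x)\<bar> \<le> K * (norm (y - x))\<^sup>2"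
proof -
  obtain C where C0: "C \<ge> 0" and C: "\<And>x p y q. norm p \<le> r \<Longrightarrow> norm q \<le> r \<Longrightarrow>
     norm (gradH (x, p) - gradH (y, q)) \<le> C * norm ((x, p) - (y, q))"
    using gradH_lipschitz[of r] by blast
  obtain m where m: "m > 0" "\<And>x p v. norm p \<le> r \<Longrightarrow> hessH (x, p) (0, v) \<bullet> (0, v) \<ge> m * (norm v)\<^sup>2"
    using strictly_positive_hessian[of r] by blast
  define K where "K = C + (C + 1)\<^sup>2 / (2 * m)"
  have "K \<ge> 0" using C0 m by (simp add: K_def)
  moreover have "\<bar>field_primitive u y - field_primitive u x - lift_field u x \<bullet> (y - x)\<bar> \<le> K * (norm (y - x))\<^sup>2"
    if inv: "invariant_lagrangian_graph H u" and ur: "norm u \<le> r" for u x y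
  proof -
    let ?u = "lift_field u" and ?f = "field_primitive u"
    have r: "norm (?u x) \<le> r" for x using norm_bounded ur order_trans by blast
    have lag: "lagrangian_graph u" using inv by (simp add: invariant_lagrangian_graph_def)
    note fd = GDERIV_along_curve[OF GDERIV_field_primitive[OF lag]]
    define h where "h = y - x"
    define X where "X a s = fst (\<Phi> (s + a) (x, ?u x))" for a s
    have PX: "\<Phi> (s + a) (x, ?u x) = (X a s, ?u (X a s))" for s a
      using flow_on_graph[OF inv, of "s + a" x] by (auto simp: X_def prod_eq_iff)
    have dX: "(X a has_vector_derivative Hp (X a s) (?u (X a s))) (at s)"
      and dU: "((\<lambda>s. ?u (X a s)) has_vector_derivative - Hx (X a s) (?u (X a s))) (at s)" for a s
      using flow_fst_derivative[of a "(x, ?u x)" s] flow_snd_derivative[of a "(x, ?u x)" s]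
      unfolding X_def[abs_def, symmetric] by (simp_all add: PX)
    have dUh: "((\<lambda>s. \<sigma> s * (?u (X a s) \<bullet> h)) has_real_derivative
        \<sigma>' * (?u (X a s) \<bullet> h) - \<sigma> s * (Hx (X a s) (?u (X a s)) \<bullet> h)) (at s)"
      if "(\<sigma> has_real_derivative \<sigma>') (at s)" for \<sigma> \<sigma>' a s
    proof -
      have "((\<lambda>s. ?u (X a s) \<bullet> h) has_real_derivative - (Hx (X a s) (?u (X a s)) \<bullet> h)) (at s)"
        using bounded_linear.has_vector_derivative[OF bounded_linear_inner_left[of h] dU[of a s]]
        by (simp add: has_real_derivative_iff_has_vector_derivative)
      from DERIV_mult[OF that this] show ?thesis by (simp add: algebra_simps)
    qed
    have defect: "(?u z - ?u (X a s)) \<bullet> Hp (X a s) (?u (X a s)) + norm (?u z - ?u (X a s)) * norm h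
        + \<sigma> * (Hx (X a s) (?u (X a s)) \<bullet> h) \<le> K * (norm h)\<^sup>2"
      if "z = X a s + \<sigma> *\<^sub>R h" "0 \<le> \<sigma>" "\<sigma> \<le> 1" for z a s \<sigma>
      unfolding K_def that(1)
      by (rule calibration_defect[OF C C0 m r r that(2,3)]) (auto intro: hamilton_jacobi[OF inv])
    have cs: "\<bar>(?u z - ?u w) \<bullet> h\<bar> \<le> norm (?u z - ?u w) * norm h" for z w by (rule Cauchy_Schwarz_ineq2)
    \<comment> \<open>\<open>X (- 1)\<close> is the orbit that reaches \<open>x\<close> at time \<open>1\<close>, when the translated curve is at \<open>y\<close>\<close>
    define U where "U s = ?f (X (-1) s + s *\<^sub>R h) - ?f (X (-1) s) - s * (?u (X (-1) s) \<bullet> h) - K * (norm h)\<^sup>2 * s" for s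
    have "U 1 \<le> U 0"
    proof (rule DERIV_nonpos_imp_nonincreasing[of 0 1 U])
      fix s :: real assume s: "0 \<le> s" "s \<le> 1"
      let ?x = "X (-1) s" let ?z = "?x + s *\<^sub>R h" let ?v = "Hp ?x (?u ?x)"
      have "(U has_real_derivative ?u ?z \<bullet> (?v + h) - ?u ?x \<bullet> ?v
          - (1 * (?u ?x \<bullet> h) - s * (Hx ?x (?u ?x) \<bullet> h)) - K * (norm h)\<^sup>2 * 1) (at s)"
        unfolding U_def
        by (intro DERIV_diff fd dUh DERIV_cmult DERIV_ident dX has_vector_derivative_add)
          (auto intro!: derivative_eq_intros)
      moreover have "?u ?z \<bullet> (?v + h) - ?u ?x \<bullet> ?v
          - (1 * (?u ?x \<bullet> h) - s * (Hx ?x (?u ?x) \<bullet> h)) - K * (norm h)\<^sup>2 * 1 \<le> 0"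
        using defect[OF refl s, of "-1" s] cs[of ?z ?x]
        by (simp add: inner_diff_left inner_add_right abs_le_iff)
      ultimately show "\<exists>y. (U has_real_derivative y) (at s) \<and> y \<le> 0" by blast
    qed simp
    moreover have "X (-1) 1 = x" by (simp add: X_def flow_0)
    ultimately have up: "?f y - ?f x - ?u x \<bullet> h \<le> K * (norm h)\<^sup>2" by (simp add: U_def h_def)
    \<comment> \<open>\<open>X 0\<close> is the orbit that leaves \<open>x\<close> at time \<open>0\<close>, when the translated curve is at \<open>y\<close>\<close>
    define V where "V s = ?f (X 0 s + (1 - s) *\<^sub>R h) - ?f (X 0 s) - (1 - s) * (?u (X 0 s) \<bullet> h) - K * (norm h)\<^sup>2 * s" for s
    have "V 1 \<le> V 0"
    proof (rule DERIV_nonpos_imp_nonincreasing[of 0 1 V])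
      fix s :: real assume s: "0 \<le> s" "s \<le> 1"
      let ?x = "X 0 s" let ?z = "?x + (1 - s) *\<^sub>R h" let ?v = "Hp ?x (?u ?x)"
      have "(V has_real_derivative ?u ?z \<bullet> (?v + - h) - ?u ?x \<bullet> ?v
          - ((-1) * (?u ?x \<bullet> h) - (1 - s) * (Hx ?x (?u ?x) \<bullet> h)) - K * (norm h)\<^sup>2 * 1) (at s)"
        unfolding V_def
        by (intro DERIV_diff fd dUh DERIV_cmult DERIV_ident dX has_vector_derivative_add)
          (auto intro!: derivative_eq_intros)
      moreover have "?u ?z \<bullet> (?v + - h) - ?u ?x \<bullet> ?v
          - ((-1) * (?u ?x \<bullet> h) - (1 - s) * (Hx ?x (?u ?x) \<bullet> h)) - K * (norm h)\<^sup>2 * 1 \<le> 0"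
        using defect[of ?z 0 s "1 - s"] s cs[of ?z ?x]
        by (simp add: inner_diff_left inner_diff_right abs_le_iff)
      ultimately show "\<exists>y. (V has_real_derivative y) (at s) \<and> y \<le> 0" by blast
    qed simp
    moreover have "X 0 0 = x" by (simp add: X_def flow_0)
    ultimately have "- (K * (norm h)\<^sup>2) \<le> ?f y - ?f x - ?u x \<bullet> h" by (simp add: V_def h_def)
    with up show ?thesis by (simp add: h_def abs_le_iff)
  qed
  ultimately show thesis by (rule that)
qed

text \<open>The first order estimate with its uniform constant survives the limit. It makes the limit of the
  primitives differentiable with gradient \<open>u\<close>, and it makes \<open>u\<close> Lipschitz with constant \<open>6 K\<close>.\<close>

theorem invariant_lagrangian_graphs_closed:
  assumes inv: "\<And>k. invariant_lagrangian_graph H (U k)" and lim: "U \<longlonglongrightarrow> u"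
  shows "invariant_lagrangian_graph H u"
proof -
  obtain r where r: "\<And>k. norm (U k) \<le> r"
    using convergent_imp_Bseq[OF convergentI[OF lim]] by (auto simp: Bseq_def)
  obtain K where K: "K \<ge> 0" "\<And>u x y. invariant_lagrangian_graph H u \<Longrightarrow> norm u \<le> r \<Longrightarrow>
    \<bar>field_primitive u y - field_primitive u x - lift_field u x \<bullet> (y - x)\<bar> \<le> K * (norm (y - x))\<^sup>2"
    using first_order_estimate[of r] by blast
  have ul: "uniform_limit UNIV (\<lambda>k. lift_field (U k)) (lift_field u) sequentially"
  proof -
    have "uniform_limit UNIV (\<lambda>k. apply_bcontfun (U k)) (apply_bcontfun u) sequentially"
      using tendsto_bcontfun_uniform_limit[OF lim] .
    from uniform_limit_compose'[OF this, of torus_proj UNIV] show ?thesis by auto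
  qed
  have fp: "(\<lambda>k. field_primitive (U k) x) \<longlonglongrightarrow> field_primitive u x" for x
    by (rule radial_primitive_limit[OF ul continuous_on_lift_field])
  have up: "(\<lambda>k. lift_field (U k) x) \<longlonglongrightarrow> lift_field u x" for x
    using tendsto_uniform_limitI[OF ul] by simp
  have est: "\<bar>field_primitive u y - field_primitive u x - lift_field u x \<bullet> (y - x)\<bar> \<le> K * (norm (y - x))\<^sup>2" for x y
  proof (rule LIMSEQ_le_const2)
    show "(\<lambda>k. \<bar>field_primitive (U k) y - field_primitive (U k) x - lift_field (U k) x \<bullet> (y - x)\<bar>)
        \<longlonglongrightarrow> \<bar>field_primitive u y - field_primitive u x - lift_field u x \<bullet> (y - x)\<bar>"
      by (intro tendsto_intros fp up)
  qed (use K(2)[OF inv r] in blast)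
  have G: "GDERIV (field_primitive u) x :> lift_field u x" for x
    by (rule GDERIV_of_first_order_remainder[OF est])
  have L: "(6 * K)-lipschitz_on UNIV (apply_bcontfun u)"
    using K(1) lipschitz_of_first_order_remainder[OF est] by (intro lipschitz_on_torusI) auto
  have "lagrangian_graph u"
    unfolding lagrangian_graph_def using L G by blast
  moreover have "snd (\<Phi> t (x, lift_field u x)) = lift_field u (fst (\<Phi> t (x, lift_field u x)))" for t x
  proof -
    let ?z = "\<lambda>k. \<Phi> t (x, lift_field (U k) x)"
    have z: "?z \<longlonglongrightarrow> \<Phi> t (x, lift_field u x)"
      by (rule continuous_on_tendsto_compose[OF continuous_on_flow]) (auto intro!: tendsto_intros up)
    have lim1: "(\<lambda>k. lift_field (U k) (fst (?z k))) \<longlonglongrightarrow> lift_field u (fst (\<Phi> t (x, lift_field u x)))"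
    proof (rule tendsto_apply_bcontfun[OF lim])
      show "(\<lambda>k. torus_proj (fst (?z k))) \<longlonglongrightarrow> torus_proj (fst (\<Phi> t (x, lift_field u x)))"
        by (rule continuous_on_tendsto_compose[OF continuous_on_torus_proj[of UNIV] tendsto_fst[OF z]]) auto
    qed
    have lim2: "(\<lambda>k. lift_field (U k) (fst (?z k))) \<longlonglongrightarrow> snd (\<Phi> t (x, lift_field u x))"
      using tendsto_snd[OF z] by (simp only: flow_on_graph[OF inv])
    show ?thesis by (rule LIMSEQ_unique[OF lim2 lim1])
  qed
  ultimately show ?thesis unfolding invariant_iff by blast
qed

lemma closure_Upsilon_invariant:
  assumes "u \<in> closure (Upsilon H)"
  shows "invariant_lagrangian_graph H u"
proof -
  obtain U where "\<And>k. U k \<in> Upsilon H" "U \<longlonglongrightarrow> u"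
    using assms unfolding closure_sequential by blast
  then show ?thesis
    by (intro invariant_lagrangian_graphs_closed[of U u]) (auto simp: Upsilon_def)
qed

end

section \<open>Ergodic linear flows\<close>

text \<open>The preimage of a nonempty open set under the projection meets the closed unit box, hence also
  its interior.\<close>

lemma torus_lebesgue_open_pos:
  fixes U :: "'n::finite torus set"
  assumes U: "open U" "U \<noteq> {}"
  shows "emeasure torus_lebesgue U > 0"
proof -
  define V where "V = (torus_proj :: real ^ 'n \<Rightarrow> _) -` U"
  let ?Q = "cbox 0 (\<chi> i. 1) :: (real ^ 'n) set" let ?B = "box 0 (\<chi> i. 1) :: (real ^ 'n) set"
  have proj: "torus_proj \<in> borel_measurable (borel :: (real ^ 'n) measure)"
    by (rule borel_measurable_continuous_onI[OF continuous_on_torus_proj])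
  have V: "open V" unfolding V_def by (rule open_vimage[OF U(1) continuous_on_torus_proj])
  obtain q where "q \<in> U" using U by blast
  moreover obtain x where "q = torus_proj x" "x \<in> ?Q" by (rule lift_to_unit_box)
  ultimately have "x \<in> V \<inter> ?Q" by (simp add: V_def)
  have "(\<chi> i. 1/2) \<in> ?B" by (simp add: mem_box_cart)
  then have "?B \<noteq> {}" by blast
  then have "closure ?B = ?Q" by (rule closure_box)
  then have ne: "V \<inter> ?B \<noteq> {}"
    using open_Int_closure_eq_empty[OF V, of ?B] \<open>x \<in> V \<inter> ?Q\<close> by auto
  have "emeasure lborel (V \<inter> ?B) > 0"
  proof -
    have "\<not> negligible (V \<inter> ?B)" using ne V by (intro open_not_negligible) auto
    then have "emeasure lebesgue (V \<inter> ?B) \<noteq> 0"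
      using V by (subst (asm) negligible_iff_emeasure0) (auto intro!: lebesgue_openin)
    then show ?thesis using V by (simp add: zero_less_iff_neq_zero)
  qed
  also have "emeasure lborel (V \<inter> ?B) \<le> emeasure lborel (?Q \<inter> V)"
    using V box_subset_cbox[of "0 :: real ^ 'n"] by (intro emeasure_mono) auto
  finally have pos: "emeasure lborel (?Q \<inter> V) > 0" .
  have "emeasure torus_lebesgue U = emeasure (uniform_measure lborel ?Q) V"
    unfolding torus_lebesgue_def V_def using U proj by (subst emeasure_distr) auto
  also have "\<dots> = emeasure lborel (?Q \<inter> V) / emeasure lborel ?Q"
    using V by (intro emeasure_uniform_measure) auto
  also have "\<dots> > 0"
    using pos emeasure_lborel_cbox_finite[of "0 :: real ^ 'n" "\<chi> i. 1"]
    by (simp add: zero_less_iff_neq_zero ennreal_divide_eq_0_iff)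
  finally show ?thesis .
qed

text \<open>If the orbit of \<open>0\<close> stays at distance at least \<open>e\<close> from \<open>q\<close>, then its open \<open>e/2\<close>-neighbourhood is invariant
  and misses a ball, so neither it nor its complement is a null set.\<close>

theorem ergodic_orbit_dense:
  fixes \<alpha> :: "real ^ 'n::finite"
  assumes erg: "ergodic_linear_flow \<alpha>" and e: "e > 0"
  shows "\<exists>t. dist (torus_proj (t *\<^sub>R \<alpha>)) q < e"
proof (rule ccontr)
  assume far: "\<not> ?thesis"
  define A where "A = (\<Union>t. ball (torus_proj (t *\<^sub>R \<alpha>)) (e / 2))"
  have "open A" unfolding A_def by blast
  then have A: "A \<in> sets borel" by simp
  have "torus_shift (s *\<^sub>R \<alpha>) -` A = A" for s
  proof -
    have "dist (torus_proj (t *\<^sub>R \<alpha>)) (torus_shift (s *\<^sub>R \<alpha>) x) = dist (torus_proj ((t - s) *\<^sub>R \<alpha>)) x" for t x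
      using dist_torus_shift[of "s *\<^sub>R \<alpha>" "torus_proj ((t - s) *\<^sub>R \<alpha>)" x]
      by (simp add: torus_shift_proj algebra_simps)
    then have "torus_shift (s *\<^sub>R \<alpha>) x \<in> A \<longleftrightarrow> (\<exists>t. dist (torus_proj ((t - s) *\<^sub>R \<alpha>)) x < e / 2)" for x
      by (simp add: A_def)
    moreover have "(\<exists>t. dist (torus_proj ((t - s) *\<^sub>R \<alpha>)) x < e / 2) \<longleftrightarrow> x \<in> A" for x
      unfolding A_def by simp (metis add_diff_cancel)
    ultimately show ?thesis by auto
  qed
  then have "emeasure torus_lebesgue A = 0 \<or> emeasure torus_lebesgue (- A) = 0"
    using erg A unfolding ergodic_linear_flow_def by blast
  moreover have "emeasure torus_lebesgue A > 0"
  proof (rule torus_lebesgue_open_pos[OF \<open>open A\<close>])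
    have "torus_proj (0 *\<^sub>R \<alpha>) \<in> A" unfolding A_def using e by (intro UN_I[of 0]) auto
    then show "A \<noteq> {}" by blast
  qed
  moreover have "emeasure torus_lebesgue (- A) > 0"
  proof -
    have "ball q (e / 2) \<subseteq> - A"
    proof
      fix x assume x: "x \<in> ball q (e / 2)"
      show "x \<in> - A"
      proof
        assume "x \<in> A"
        then obtain t where "dist (torus_proj (t *\<^sub>R \<alpha>)) x < e / 2" unfolding A_def by auto
        moreover have "dist q x < e / 2" using x by simp
        ultimately have "dist (torus_proj (t *\<^sub>R \<alpha>)) q < e"
          using dist_triangle_half_l[of "torus_proj (t *\<^sub>R \<alpha>)" x e q] by (simp add: dist_commute)
        with far show False by blast
      qed
    qed
    moreover have "emeasure torus_lebesgue (ball q (e / 2)) > 0"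
      using e by (intro torus_lebesgue_open_pos) auto
    moreover have "- A \<in> sets torus_lebesgue" using A by (auto simp: torus_lebesgue_def)
    ultimately show ?thesis using emeasure_mono[of "ball q (e / 2)" "- A" torus_lebesgue] by (metis less_le_trans)
  qed
  ultimately show False by auto
qed

text \<open>Representatives in the unit box of the finite subgroup of the torus with denominator \<open>N\<close>.\<close>

definition grid :: "nat \<Rightarrow> (real ^ 'n) set" where
  "grid N = {x. \<forall>i. 0 \<le> x $ i \<and> x $ i < 1 \<and> real N * x $ i \<in> \<int>}"

lemma grid_0: "0 \<in> grid N"
  by (simp add: grid_def)

lemma finite_grid:
  assumes N: "N > 0"
  shows "finite (grid N :: (real ^ 'n::finite) set)"
proof -
  let ?S = "(\<lambda>k. real k / real N) ` {..<N}"
  have "grid N \<subseteq> (\<lambda>f. \<chi> i. f i) ` (PiE (UNIV :: 'n set) (\<lambda>_. ?S))"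
  proof
    fix x :: "real ^ 'n" assume x: "x \<in> grid N"
    have "x $ i \<in> ?S" for i
    proof -
      obtain z where z: "real N * x $ i = of_int z" using x by (auto simp: grid_def elim: Ints_cases)
      have b: "0 \<le> x $ i" "x $ i < 1" using x by (auto simp: grid_def)
      have "0 \<le> real N * x $ i" "real N * x $ i < real N" using b N by simp_all
      then have z0: "0 \<le> z" "z < int N" using z by linarith+
      then have "x $ i = real (nat z) / real N" using z N by (simp add: field_simps)
      then show ?thesis using z0 by (intro image_eqI[of _ _ "nat z"]) auto
    qed
    then have "(\<lambda>i. x $ i) \<in> PiE UNIV (\<lambda>_. ?S)" by auto
    then show "x \<in> (\<lambda>f. \<chi> i. f i) ` (PiE (UNIV :: 'n set) (\<lambda>_. ?S))"
      by (intro image_eqI[of _ _ "\<lambda>i. x $ i"]) auto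
  qed
  moreover have "finite (PiE (UNIV :: 'n set) (\<lambda>_. ?S))" by (intro finite_PiE) auto
  ultimately show ?thesis by (meson finite_imageI finite_subset)
qed

text \<open>Up to \<open>n / N\<close>, where \<open>n\<close> is the dimension, \<open>x\<close> agrees with a point \<open>a\<close> of the subgroup with
  denominator \<open>N\<close>, and translation by \<open>a\<close> permutes this subgroup.\<close>

theorem grid_translation:
  fixes x :: "real ^ 'n::finite"
  assumes N: "N > 0"
  obtains \<sigma> where "bij_betw \<sigma> (grid N) (grid N)"
    "\<And>g. g \<in> grid N \<Longrightarrow> dist (torus_proj (x + g)) (torus_proj (\<sigma> g)) \<le> CARD('n) / N"
proof -
  define a :: "real ^ 'n" where "a = (\<chi> i. of_int \<lfloor>real N * x $ i\<rfloor> / N)"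
  have xa: "dist x a \<le> CARD('n) / N"
  proof -
    have "\<bar>(x - a) $ i\<bar> \<le> 1 / N" for i
    proof -
      have "(x - a) $ i = (real N * x $ i - of_int \<lfloor>real N * x $ i\<rfloor>) / N"
        using N by (simp add: a_def field_simps)
      moreover have "\<bar>real N * x $ i - of_int \<lfloor>real N * x $ i\<rfloor>\<bar> \<le> 1" by linarith
      ultimately show ?thesis using N by (simp add: divide_right_mono)
    qed
    then have "(\<Sum>i\<in>UNIV. \<bar>(x - a) $ i\<bar>) \<le> (\<Sum>i\<in>(UNIV :: 'n set). 1 / N)" by (intro sum_mono) auto
    then show ?thesis using norm_le_l1_cart[of "x - a"] by (simp add: dist_norm)
  qed
  \<comment> \<open>translation by \<open>a\<close>, followed by reduction to the unit box\<close>
  define \<sigma> :: "real ^ 'n \<Rightarrow> real ^ 'n" where "\<sigma> g = (\<chi> i. frac (a $ i + g $ i))" for g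
  have \<sigma>_lat: "(a + g) - \<sigma> g \<in> int_lattice" for g
    by (simp add: int_lattice_def \<sigma>_def frac_def)
  have into: "\<sigma> g \<in> grid N" if "g \<in> grid N" for g
  proof -
    have "real N * frac (a $ i + g $ i) \<in> \<int>" for i
    proof -
      have "real N * frac (a $ i + g $ i) = of_int \<lfloor>real N * x $ i\<rfloor> + real N * g $ i - real N * of_int \<lfloor>a $ i + g $ i\<rfloor>"
        using N by (simp add: frac_def a_def algebra_simps)
      moreover have "real N * g $ i \<in> \<int>" using that by (simp add: grid_def)
      ultimately show ?thesis by (auto intro: Ints_diff Ints_add Ints_mult)
    qed
    then show ?thesis by (simp add: grid_def \<sigma>_def frac_lt_1)
  qed
  have inj: "inj_on \<sigma> (grid N)"
  proof (rule inj_onI)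
    fix g g' assume g: "g \<in> grid N" "g' \<in> grid N" and eq: "\<sigma> g = \<sigma> g'"
    have "g - g' \<in> int_lattice"
      using int_lattice_diff[OF \<sigma>_lat[of g] \<sigma>_lat[of g']] eq by (simp add: algebra_simps)
    have "g $ i = g' $ i" for i
    proof -
      obtain z where z: "g $ i - g' $ i = of_int z"
        using \<open>g - g' \<in> int_lattice\<close> by (auto simp: int_lattice_def elim: Ints_cases dest: spec[of _ i])
      have "\<bar>g $ i - g' $ i\<bar> < 1"
        using g by (auto simp: grid_def abs_less_iff dest!: spec[of _ i])
      then have "z = 0" using z by linarith
      then show ?thesis using z by simp
    qed
    then show "g = g'" by (simp add: vec_eq_iff)
  qed
  have "bij_betw \<sigma> (grid N) (grid N)"
    unfolding bij_betw_def using inj into endo_inj_surj[OF finite_grid[OF N], of \<sigma>] by blast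
  moreover have "dist (torus_proj (x + g)) (torus_proj (\<sigma> g)) \<le> CARD('n) / N" for g
  proof -
    have "torus_proj (\<sigma> g) = torus_proj (a + g)"
      using \<sigma>_lat[of g] by (simp add: torus_proj_eq_iff[of "a + g", symmetric])
    then show ?thesis using dist_torus_proj_le[of "x + g" "a + g"] xa by simp
  qed
  ultimately show thesis by (rule that)
qed

section \<open>Weak limits of measures on the torus\<close>

text \<open>In base 3 this maps the binary sequences homeomorphically onto a Cantor set, in base 2 it maps
  them onto the unit interval.\<close>

definition digit_value :: "real \<Rightarrow> (nat \<Rightarrow> bool) \<Rightarrow> real" where
  "digit_value b d = (\<Sum>i. of_bool (d i) / b ^ Suc i)"

lemma summable_digits: "b > 1 \<Longrightarrow> summable (\<lambda>i. of_bool (d i) / b ^ Suc i :: real)"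
proof (rule summable_comparison_test')
  assume b: "b > 1"
  then show "summable (\<lambda>i. (1 / b) ^ Suc i)" by (subst summable_Suc_iff) (simp add: summable_geometric)
  show "norm (of_bool (d i) / b ^ Suc i) \<le> (1 / b) ^ Suc i" for i
    using b by (auto simp: power_one_over divide_simps)
qed

lemma continuous_on_digit_value:
  assumes b: "b > 1"
  shows "continuous_on UNIV (digit_value b)"
proof -
  have term_cont: "continuous_on UNIV (\<lambda>d :: nat \<Rightarrow> bool. of_bool (d i) / b ^ Suc i :: real)" for i
  proof -
    have "continuous_on UNIV (\<lambda>x::bool. of_bool x / b ^ Suc i :: real)" by (simp add: continuous_on_def at_discrete)
    from continuous_on_compose2[OF this continuous_on_product_coordinates[of i]] show ?thesis by simp
  qed
  have ul: "uniform_limit UNIV (\<lambda>n d. \<Sum>i<n. of_bool (d i) / b ^ Suc i) (digit_value b) sequentially"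
    unfolding digit_value_def
  proof (rule Weierstrass_m_test)
    show "norm (of_bool (d i) / b ^ Suc i) \<le> (1 / b) ^ Suc i" for i and d :: "nat \<Rightarrow> bool"
      using b by (auto simp: power_one_over divide_simps)
    show "summable (\<lambda>i. (1 / b) ^ Suc i)" using b by (subst summable_Suc_iff) (simp add: summable_geometric)
  qed
  have "eventually (\<lambda>n. continuous_on UNIV (\<lambda>d :: nat \<Rightarrow> bool. \<Sum>i<n. of_bool (d i) / b ^ Suc i)) sequentially"
    by (intro always_eventually allI continuous_on_sum term_cont)
  from uniform_limit_theorem[OF this ul trivial_limit_sequentially] show ?thesis .
qed

lemma digit_value_Suc:
  assumes "b > 1"
  shows "digit_value b d = (of_bool (d 0) + digit_value b (\<lambda>i. d (Suc i))) / b"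
proof -
  have "digit_value b d = of_bool (d 0) / b + (\<Sum>i. of_bool (d (Suc i)) / b ^ Suc (Suc i))"
    using suminf_split_head[OF summable_digits[OF assms, of d]] by (simp add: digit_value_def)
  also have "(\<Sum>i. of_bool (d (Suc i)) / b ^ Suc (Suc i)) = (\<Sum>i. of_bool (d (Suc i)) / b ^ Suc i / b)"
    by (simp add: divide_simps mult_ac)
  also have "\<dots> = digit_value b (\<lambda>i. d (Suc i)) / b"
    unfolding digit_value_def by (rule suminf_divide[OF summable_digits[OF assms]])
  finally show ?thesis by (simp add: add_divide_distrib)
qed

lemma ternary_digits_bounds: "0 \<le> digit_value 3 d" "digit_value 3 d \<le> 1 / 2"
proof -
  show "0 \<le> digit_value 3 d" unfolding digit_value_def by (intro suminf_nonneg summable_digits) auto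
  have geo: "(\<lambda>i. (1 / 3 :: real) ^ Suc i) sums (1 / 2)"
    using sums_mult[OF geometric_sums[of "1 / 3 :: real"], of "1 / 3"] by simp
  have "digit_value 3 d \<le> (\<Sum>i. (1 / 3) ^ Suc i)"
    unfolding digit_value_def
    by (intro suminf_le summable_digits sums_summable[OF geo]) (auto simp: power_one_over divide_simps)
  then show "digit_value 3 d \<le> 1 / 2" using geo by (simp add: sums_iff)
qed

lemma inj_ternary_digits: "inj (digit_value 3)"
proof (rule injI)
  fix d d' :: "nat \<Rightarrow> bool" assume "digit_value 3 d = digit_value 3 d'"
  then have "d n = d' n" for n
  proof (induction n arbitrary: d d')
    case 0
    then show ?case
      using digit_value_Suc[of 3 d] digit_value_Suc[of 3 d'] ternary_digits_bounds[of "\<lambda>i. d (Suc i)"]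
        ternary_digits_bounds[of "\<lambda>i. d' (Suc i)"] by (cases "d 0"; cases "d' 0") auto
  next
    case (Suc n)
    have "digit_value 3 (\<lambda>i. d (Suc i)) = digit_value 3 (\<lambda>i. d' (Suc i))"
      using Suc.prems digit_value_Suc[of 3 d] digit_value_Suc[of 3 d'] ternary_digits_bounds[of "\<lambda>i. d (Suc i)"]
        ternary_digits_bounds[of "\<lambda>i. d' (Suc i)"] by (cases "d 0"; cases "d' 0") auto
    from Suc.IH[OF this] show ?case .
  qed
  then show "d = d'" by auto
qed

lemma binary_expansion:
  fixes x :: real
  assumes "0 \<le> x" "x < 1"
  obtains d where "digit_value 2 d = x"
proof -
  \<comment> \<open>the last binary digit of the integer part of \<open>2 ^ Suc i * x\<close>\<close>
  define d where "d i \<longleftrightarrow> odd \<lfloor>2 ^ Suc i * x\<rfloor>" for i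
  have step: "\<lfloor>2 ^ Suc n * x\<rfloor> = 2 * \<lfloor>2 ^ n * x\<rfloor> + of_bool (d n)" for n
  proof -
    have "\<lfloor>2 ^ Suc n * x\<rfloor> div 2 = \<lfloor>2 ^ n * x\<rfloor>"
      using floor_divide_real_eq_div[of 2 "2 ^ Suc n * x"] by simp
    then show ?thesis unfolding d_def
      by (metis (no_types, opaque_lifting) add.commute mod_mult_div_eq odd_iff_mod_2_eq_one of_bool_def
          even_iff_mod_2_eq_zero)
  qed
  have partial: "(\<Sum>i<n. of_bool (d i) / 2 ^ Suc i) = real_of_int \<lfloor>2 ^ n * x\<rfloor> / 2 ^ n" for n
  proof (induction n)
    case 0
    have "\<lfloor>x\<rfloor> = 0" using assms by (simp add: floor_eq_iff)
    then show ?case by simp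
  next
    case (Suc n)
    then show ?case unfolding sum.lessThan_Suc step[of n] by (simp add: field_simps)
  qed
  have "(\<lambda>n. real_of_int \<lfloor>2 ^ n * x\<rfloor> / 2 ^ n) \<longlonglongrightarrow> x"
  proof (rule real_tendsto_sandwich)
    show "eventually (\<lambda>n. x - (1 / 2) ^ n \<le> real_of_int \<lfloor>2 ^ n * x\<rfloor> / 2 ^ n) sequentially"
    proof (intro always_eventually allI)
      fix n :: nat
      have "2 ^ n * x - 1 \<le> real_of_int \<lfloor>2 ^ n * x\<rfloor>" by linarith
      then show "x - (1 / 2) ^ n \<le> real_of_int \<lfloor>2 ^ n * x\<rfloor> / 2 ^ n"
        using divide_right_mono[of "2 ^ n * x - 1" "real_of_int \<lfloor>2 ^ n * x\<rfloor>" "2 ^ n"]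
        by (simp add: diff_divide_distrib power_one_over)
    qed
    show "eventually (\<lambda>n. real_of_int \<lfloor>2 ^ n * x\<rfloor> / 2 ^ n \<le> x) sequentially"
      by (intro always_eventually allI) (simp add: divide_le_eq mult.commute)
    have "(\<lambda>n. x - (1 / 2) ^ n) \<longlonglongrightarrow> x - 0" by (intro tendsto_intros LIMSEQ_power_zero) simp
    then show "(\<lambda>n. x - (1 / 2) ^ n) \<longlonglongrightarrow> x" by simp
  qed simp
  then have "(\<lambda>n. \<Sum>i<n. of_bool (d i) / 2 ^ Suc i) \<longlonglongrightarrow> x" by (simp only: partial)
  then have "(\<lambda>i. of_bool (d i) / 2 ^ Suc i) sums x" by (simp add: sums_def)
  then show thesis by (intro that[of d]) (simp add: digit_value_def sums_iff)
qed

lemma compact_bool_sequences: "compact (UNIV :: (nat \<Rightarrow> bool) set)"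
proof -
  have "compact_space (product_topology (\<lambda>i :: nat. euclidean :: bool topology) UNIV)"
    unfolding compact_space_product_topology
    using finite_imp_compact[of "UNIV :: bool set"] by (simp add: compact_space_def)
  then show ?thesis
    by (simp add: euclidean_product_topology compact_space_def)
qed

text \<open>Read a point of a Cantor set as a sequence of bits, distribute the bits over the coordinates, and
  read them as binary expansions. This allows weak limits on the torus to be taken on the real
  line.\<close>

theorem torus_image_of_compact_reals:
  obtains K :: "real set" and \<pi> :: "real \<Rightarrow> 'n::finite torus"
  where "compact K" "K \<subseteq> {0..1}" "continuous_on K \<pi>" "\<pi> ` K = UNIV"
proof -
  obtain idx :: "'n \<Rightarrow> nat" where idx: "inj idx"
    using finite_imp_inj_to_nat_seg[of "UNIV :: 'n set"] by auto
  define D :: "(nat \<Rightarrow> bool) \<Rightarrow> real ^ 'n" where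
    "D d = (\<chi> i. digit_value 2 (\<lambda>m. d (prod_encode (idx i, m))))" for d
  have cD: "continuous_on UNIV D"
    unfolding D_def
  proof (intro continuous_on_vec_lambda continuous_on_compose2[OF continuous_on_digit_value])
    show "continuous_on UNIV (\<lambda>d m. d (prod_encode (idx i, m)) :: bool)" for i
      by (intro continuous_on_coordinatewise_then_product continuous_on_product_coordinates)
  qed auto
  have surj: "\<exists>d. torus_proj (D d) = q" for q
  proof -
    obtain x where x: "q = torus_proj x" by (rule torus_cases)
    have "\<exists>d. digit_value 2 d = frac (x $ i)" for i
      using binary_expansion[of "frac (x $ i)"] frac_lt_1 by (metis frac_ge_0)
    then obtain \<beta> where \<beta>: "\<And>i. digit_value 2 (\<beta> i) = frac (x $ i)" by metis
    define d where "d k = \<beta> (inv idx (fst (prod_decode k))) (snd (prod_decode k))" for k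
    have "D d - x \<in> int_lattice"
      unfolding int_lattice_def D_def d_def using idx
      by (simp add: inv_f_f \<beta> frac_def)
    then show ?thesis unfolding x torus_proj_eq_iff by blast
  qed
  define e where "e = digit_value 3"
  have ce: "continuous_on UNIV e" unfolding e_def by (rule continuous_on_digit_value) simp
  have inv_e: "inv e (e d) = d" for d using inj_ternary_digits by (simp add: e_def inv_f_f)
  have cinv: "continuous_on (range e) (inv e)"
    using continuous_on_inv[OF ce compact_bool_sequences] inv_e by simp
  show thesis
  proof (rule that[of "range e" "\<lambda>x. torus_proj (D (inv e x))"])
    show "compact (range e)" by (rule compact_continuous_image[OF ce compact_bool_sequences])
    show "range e \<subseteq> {0..1}"
    proof
      fix x assume "x \<in> range e"
      then obtain d where "x = e d" by blast
      then show "x \<in> {0..1}" using ternary_digits_bounds[of d] by (simp add: e_def)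
    qed
    show "continuous_on (range e) (\<lambda>x. torus_proj (D (inv e x)))"
      by (intro continuous_on_torus_proj' continuous_on_compose2[OF cD cinv]) simp
    have "(\<lambda>x. torus_proj (D (inv e x))) ` range e = range (\<lambda>d. torus_proj (D d))"
      by (simp add: image_image inv_e)
    also have "\<dots> = UNIV" unfolding surj_def using surj by metis
    finally show "(\<lambda>x. torus_proj (D (inv e x))) ` range e = UNIV" .
  qed
qed

definition average :: "'i set \<Rightarrow> ('i \<Rightarrow> real) \<Rightarrow> real" where
  "average I f = (\<Sum>i\<in>I. f i) / card I"

text \<open>Choose preimages of the points in a compact set of reals that maps onto the torus. By Helly's
  selection theorem a subsequence of the averages over the preimages converges weakly, the limit
  lives on the compact set, and its image on the torus is the measure sought. A continuous
  function on the torus becomes a test function on the line by Tietze extension.\<close>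

theorem weak_limit_of_averages:
  fixes y :: "nat \<Rightarrow> 'i \<Rightarrow> 'n::finite torus"
  assumes I: "\<And>k. finite (I k)" "\<And>k. I k \<noteq> {}"
  shows "\<exists>m. \<exists>s :: nat \<Rightarrow> nat. strict_mono s \<and> prob_space m \<and> sets m = sets borel \<and>
    (\<forall>\<phi> :: 'n torus \<Rightarrow> real. continuous_on UNIV \<phi> \<longrightarrow>
       (\<lambda>k. average (I (s k)) (\<lambda>i. \<phi> (y (s k) i))) \<longlonglongrightarrow> (LINT q|m. \<phi> q))"
proof -
  obtain K :: "real set" and \<pi> :: "real \<Rightarrow> 'n torus"
    where K: "compact K" "K \<subseteq> {0..1}" and c\<pi>: "continuous_on K \<pi>" and \<pi>: "\<pi> ` K = UNIV"
    by (rule torus_image_of_compact_reals)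
  have "\<exists>x\<in>K. \<pi> x = q" for q using \<pi> by (metis UNIV_I imageE)
  then obtain c where c: "\<And>q. c q \<in> K" "\<And>q. \<pi> (c q) = q" by metis
  define M where "M k = distr (measure_pmf (pmf_of_set (I k))) borel (\<lambda>i. c (y k i))" for k
  have rd: "real_distribution (M k)" for k
  proof -
    have "prob_space (M k)" unfolding M_def by (rule measure_pmf.prob_space_distr) simp
    then show ?thesis by (simp add: real_distribution_def real_distribution_axioms_def M_def)
  qed
  have intM: "(LINT x|M k. F x) = (\<Sum>i\<in>I k. F (c (y k i))) / card (I k)"
    if "F \<in> borel_measurable borel" for F :: "real \<Rightarrow> real" and k
    unfolding M_def using that I by (subst integral_distr) (auto simp: integral_pmf_of_set)
  have "tight M"
    unfolding tight_def
  proof (intro conjI allI impI rd)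
    fix \<epsilon> :: real assume "\<epsilon> > 0"
    have "measure (M k) {- 1<..1} = 1" for k
    proof -
      have "c q \<in> {- 1<..1}" for q using c(1)[of q] K(2) by force
      then have "(\<lambda>i. c (y k i)) -` {- 1<..1} = UNIV" by blast
      then show ?thesis unfolding M_def by (subst measure_distr) auto
    qed
    then show "\<exists>a b. a < b \<and> (\<forall>k. 1 - \<epsilon> < measure (M k) {a<..b})"
      using \<open>\<epsilon> > 0\<close> by (intro exI[of _ "-1"] exI[of _ 1]) auto
  qed
  from tight_imp_convergent_subsubsequence[OF this, of id]
  obtain s N where s: "strict_mono s" and N: "real_distribution N" and wc: "weak_conv_m (\<lambda>k. M (s k)) N"
    by (auto simp: strict_mono_def o_def)
  interpret N: real_distribution N by (rule N)
  have lim: "(\<lambda>k. (\<Sum>i\<in>I (s k). F (c (y (s k) i))) / card (I (s k))) \<longlonglongrightarrow> (LINT x|N. F x)"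
    if F: "continuous_on UNIV F" "\<And>x. \<bar>F x\<bar> \<le> B" for F :: "real \<Rightarrow> real" and B
  proof -
    have "(\<lambda>k. LINT x|M (s k). F x) \<longlonglongrightarrow> (LINT x|N. F x)"
      by (rule weak_conv_imp_integral_bdd_continuous_conv[OF rd N wc])
        (use F in \<open>auto simp: continuous_on_eq_continuous_at\<close>)
    then show ?thesis using F(1) by (simp add: intM borel_measurable_continuous_onI)
  qed
  have "closed K" using K(1) by (rule compact_imp_closed)
  have "K \<noteq> {}" using c(1) by blast
  have NK: "AE x in N. x \<in> K"
  proof -
    \<comment> \<open>a bounded test function that vanishes exactly on \<open>K\<close>\<close>
    define F where "F x = min 1 (infdist x K)" for x
    have F: "continuous_on UNIV F" unfolding F_def by (intro continuous_intros)
    have F1: "\<bar>F x\<bar> \<le> 1" for x by (simp add: F_def infdist_nonneg)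
    have "F (c q) = 0" for q using c(1) by (simp add: F_def)
    then have "(LINT x|N. F x) = 0" using lim[OF F F1] by (simp add: LIMSEQ_const_iff)
    moreover have "integrable N F"
      using borel_measurable_continuous_onI[OF F] F1 by (intro N.integrable_const_bound[where B = 1]) auto
    ultimately have "AE x in N. F x = 0"
      by (subst (asm) integral_nonneg_eq_0_iff_AE) (auto simp: F_def infdist_nonneg)
    then show ?thesis
      using in_closed_iff_infdist_zero[OF \<open>closed K\<close> \<open>K \<noteq> {}\<close>] by (auto simp: F_def min_def split: if_splits)
  qed
  define p where "p x = (if x \<in> K then \<pi> x else \<pi> 0)" for x
  have p: "p \<in> borel_measurable borel"
    unfolding p_def by (rule borel_measurable_continuous_on_if)
      (use c\<pi> \<open>closed K\<close> in \<open>auto intro: continuous_on_const\<close>)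
  have pN: "p \<in> measurable N borel" using p by simp
  show ?thesis
  proof (intro exI[of _ "distr N borel p"] exI[of _ s] conjI allI impI s)
    show "prob_space (distr N borel p)" by (rule N.prob_space_distr[OF pN])
    fix \<phi> :: "'n torus \<Rightarrow> real" assume \<phi>: "continuous_on UNIV \<phi>"
    have "bounded (range \<phi>)" by (intro compact_imp_bounded compact_continuous_image \<phi> compact_torus)
    then obtain B where B: "B > 0" "\<And>q. norm (\<phi> q) \<le> B" unfolding bounded_pos by blast
    have "continuous_on K (\<lambda>x. \<phi> (\<pi> x))" by (rule continuous_on_compose2[OF \<phi> c\<pi>]) simp
    then obtain F where F: "continuous_on UNIV F" "\<And>x. x \<in> K \<Longrightarrow> F x = \<phi> (\<pi> x)" "\<And>x. norm (F x) \<le> B"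
      using Tietze[of K "\<lambda>x. \<phi> (\<pi> x)" UNIV B] \<open>closed K\<close> B by auto
    have "(LINT q|distr N borel p. \<phi> q) = (LINT x|N. \<phi> (p x))"
      by (rule integral_distr[OF pN]) (rule borel_measurable_continuous_onI[OF \<phi>])
    also have "\<dots> = (LINT x|N. F x)"
    proof (rule integral_cong_AE)
      show "(\<lambda>x. \<phi> (p x)) \<in> borel_measurable N"
        using measurable_compose[OF pN borel_measurable_continuous_onI[OF \<phi>]] .
      show "F \<in> borel_measurable N" using borel_measurable_continuous_onI[OF F(1)] by simp
      show "AE x in N. \<phi> (p x) = F x" using NK by eventually_elim (simp add: p_def F(2))
    qed
    finally show "(\<lambda>k. average (I (s k)) (\<lambda>i. \<phi> (y (s k) i))) \<longlonglongrightarrow> (LINT q|distr N borel p. \<phi> q)"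
      unfolding average_def using lim[OF F(1), of B] F(2)[OF c(1)] F(3) c(2) by simp
  qed simp
qed

text \<open>The indicator of a closed set is the decreasing limit of continuous functions of the distance to
  it, and the closed sets are an intersection-stable generator of the Borel sets.\<close>

lemma measure_eqI_continuous:
  fixes m m' :: "'a::metric_space measure"
  assumes m: "prob_space m" "sets m = sets borel" and m': "prob_space m'" "sets m' = sets borel"
    and eq: "\<And>\<phi> :: 'a \<Rightarrow> real. continuous_on UNIV \<phi> \<Longrightarrow> bounded (range \<phi>) \<Longrightarrow> (LINT q|m. \<phi> q) = (LINT q|m'. \<phi> q)"
  shows "m = m'"
proof (rule measure_eqI_generator_eq[where E = "Collect closed" and \<Omega> = UNIV and A = "\<lambda>_. UNIV"])
  have lim: "(\<lambda>n. LINT q|M. max 0 (1 - real n * infdist q C)) \<longlonglongrightarrow> measure M C"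
    if M: "prob_space M" "sets M = sets borel" and C: "closed C" "C \<noteq> {}" for M :: "'a measure" and C
  proof -
    interpret prob_space M by (rule M)
    have Cm: "C \<in> sets M" using C M by simp
    have "(\<lambda>n. LINT q|M. max 0 (1 - real n * infdist q C)) \<longlonglongrightarrow> (LINT q|M. indicat_real C q)"
    proof (rule integral_dominated_convergence[where w = "\<lambda>_. 1"])
      show "(\<lambda>q. max 0 (1 - real n * infdist q C)) \<in> borel_measurable M" for n
        unfolding measurable_cong_sets[OF M(2) refl]
        by (intro borel_measurable_continuous_onI continuous_intros)
      show "AE q in M. (\<lambda>n. max 0 (1 - real n * infdist q C)) \<longlonglongrightarrow> indicat_real C q"
      proof (intro AE_I2)
        fix q
        show "(\<lambda>n. max 0 (1 - real n * infdist q C)) \<longlonglongrightarrow> indicat_real C q"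
        proof (cases "q \<in> C")
          case False
          then have pos: "infdist q C > 0"
            using in_closed_iff_infdist_zero[OF C] infdist_nonneg[of q C] by (simp add: less_le)
          obtain N :: nat where N: "real N > 1 / infdist q C" using reals_Archimedean2 by blast
          have "max 0 (1 - real n * infdist q C) = 0" if "n \<ge> N" for n
          proof -
            have "1 / infdist q C < real n" using N that by simp
            then show ?thesis using pos by (simp add: pos_divide_less_eq)
          qed
          then have "eventually (\<lambda>n. max 0 (1 - real n * infdist q C) = 0) sequentially"
            using eventually_sequentially by blast
          then show ?thesis using False by (simp add: tendsto_eventually)
        qed simp
      qed
    qed (use Cm in \<open>auto intro!: AE_I2 simp: infdist_nonneg\<close>)
    then show ?thesis using Cm by simp
  qed
  show "emeasure m X = emeasure m' X" if "X \<in> Collect closed" for X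
  proof (cases "X = {}")
    case False
    interpret m: prob_space m by (rule m)
    interpret m': prob_space m' by (rule m')
    have X: "closed X" using that by simp
    have "(LINT q|m. max 0 (1 - real n * infdist q X)) = (LINT q|m'. max 0 (1 - real n * infdist q X))" for n
    proof (rule eq)
      show "continuous_on UNIV (\<lambda>q. max 0 (1 - real n * infdist q X))" by (intro continuous_intros)
      show "bounded (range (\<lambda>q. max 0 (1 - real n * infdist q X)))"
        by (rule boundedI[where B = 1]) (auto simp: infdist_nonneg)
    qed
    then have "measure m X = measure m' X"
      using lim[OF m X False] lim[OF m' X False] by (simp add: LIMSEQ_unique)
    then show ?thesis by (simp add: m.emeasure_eq_measure m'.emeasure_eq_measure)
  qed simp
  show "sets m = sigma_sets UNIV (Collect closed)" "sets m' = sigma_sets UNIV (Collect closed)"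
    using m m' by (auto simp: borel_eq_closed)
  show "Int_stable (Collect closed)" by (auto simp: Int_stable_def)
  show "emeasure m UNIV \<noteq> \<infinity>" for i :: nat
    using prob_space.emeasure_space_1[OF m(1)] sets_eq_imp_space_eq[OF m(2)] by simp
qed auto

section \<open>Quantitative strict ergodicity\<close>

lemma average_diff_le:
  assumes I: "finite I" "I \<noteq> {}" and le: "\<And>i. i \<in> I \<Longrightarrow> \<bar>f i - g i\<bar> \<le> \<epsilon>"
  shows "\<bar>average I f - average I g\<bar> \<le> \<epsilon>"
proof -
  have "\<bar>\<Sum>i\<in>I. f i - g i\<bar> \<le> (\<Sum>i\<in>I. \<bar>f i - g i\<bar>)" by (rule sum_abs)
  also have "\<dots> \<le> card I * \<epsilon>" using le by (intro sum_bounded_above)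
  finally have "\<bar>\<Sum>i\<in>I. f i - g i\<bar> \<le> card I * \<epsilon>" .
  moreover have "average I f - average I g = (\<Sum>i\<in>I. f i - g i) / card I"
    by (simp add: average_def sum_subtractf diff_divide_distrib)
  moreover have "card I > 0" using I by (simp add: card_gt_0_iff)
  ultimately show ?thesis by (simp add: abs_divide pos_divide_le_eq mult.commute)
qed

lemma average_reindex: "bij_betw \<sigma> I I \<Longrightarrow> average I (\<lambda>i. f (\<sigma> i)) = average I f"
  unfolding average_def by (subst sum.reindex_bij_betw[of \<sigma> I I f]) (assumption, rule refl)

context tonelli_hamiltonian
begin

text \<open>The flow on the graph, read on the torus. The definition makes sense for every covector field,
  so that its dependence on \<open>u\<close> can be studied before invariance is known.\<close>

definition proj_flow :: "'n covector_field \<Rightarrow> real \<Rightarrow> 'n torus \<Rightarrow> 'n torus" where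
  "proj_flow u t q = fst (ham_flow H t (q, u q))"

lemma ham_flow_on_graph:
  assumes "invariant_lagrangian_graph H u"
  shows "ham_flow H t (q, u q) = (proj_flow u t q, u (proj_flow u t q))"
proof -
  have "(q, u q) \<in> graph_of u" by (simp add: in_graph_of_iff)
  then have "ham_flow H t (q, u q) \<in> graph_of u"
    using assms unfolding invariant_lagrangian_graph_def by blast
  then show ?thesis
    by (cases "ham_flow H t (q, u q)") (simp add: in_graph_of_iff proj_flow_def)
qed

lemma proj_flow_0: "proj_flow u 0 q = q"
  by (simp add: proj_flow_def ham_flow_0)

lemma proj_flow_add:
  assumes "invariant_lagrangian_graph H u"
  shows "proj_flow u (s + t) q = proj_flow u s (proj_flow u t q)"
proof -
  have "proj_flow u (s + t) q = fst (ham_flow H s (ham_flow H t (q, u q)))"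
    by (simp only: proj_flow_def ham_flow_add)
  also have "\<dots> = proj_flow u s (proj_flow u t q)"
    by (simp only: ham_flow_on_graph[OF assms] fst_conv)
  finally show ?thesis .
qed

lemma continuous_on_proj_flow: "continuous_on S (proj_flow u t)"
proof -
  have "continuous_on S (\<lambda>q. (q, u q))"
    by (intro continuous_on_Pair continuous_on_id continuous_on_apply_bcontfun)
  from continuous_on_compose2[OF continuous_on_ham_flow this subset_UNIV, of t]
  have "continuous_on S (\<lambda>q. ham_flow H t (q, u q))" .
  then show ?thesis unfolding proj_flow_def by (rule continuous_on_fst)
qed

lemma tendsto_proj_flow:
  assumes u: "U \<longlonglongrightarrow> u" and q: "Q \<longlonglongrightarrow> q"
  shows "(\<lambda>k. proj_flow (U k) t (Q k)) \<longlonglongrightarrow> proj_flow u t q"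
proof -
  have "(\<lambda>k. (Q k, U k (Q k))) \<longlonglongrightarrow> (q, u q)"
    by (intro tendsto_Pair q tendsto_apply_bcontfun[OF u q])
  then have "(\<lambda>k. ham_flow H t (Q k, U k (Q k))) \<longlonglongrightarrow> ham_flow H t (q, u q)"
    by (rule continuous_on_tendsto_compose[OF continuous_on_ham_flow[of UNIV]]) auto
  then show ?thesis unfolding proj_flow_def by (rule tendsto_fst)
qed

text \<open>The index set consists of vectors because grid points serve as indices. The permutation
  replaces a comparison of averages against all test functions, and it makes the condition
  strict and finite, hence open.\<close>

definition equidistributed_with ::
  "'n covector_field \<Rightarrow> real \<Rightarrow> (real ^ 'n) set \<Rightarrow> (real ^ 'n \<Rightarrow> real) \<Rightarrow> (real ^ 'n \<Rightarrow> 'n torus) \<Rightarrow> bool" where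
  "equidistributed_with u e I t y \<longleftrightarrow> finite I \<and> I \<noteq> {} \<and> (\<forall>q. \<exists>i\<in>I. dist q (y i) < e) \<and>
     (\<forall>q. \<exists>\<sigma>. bij_betw \<sigma> I I \<and> (\<forall>i\<in>I. dist (proj_flow u (t i) q) (y (\<sigma> i)) < e))"

definition equidistributed :: "real \<Rightarrow> 'n covector_field set" where
  "equidistributed e = {u. \<exists>I t y. equidistributed_with u e I t y}"

text \<open>The data \<open>I\<close>, \<open>t\<close>, \<open>y\<close> of the limit also serve for nearby fields: otherwise there are fields
  converging to \<open>u\<close> and points at which every permutation fails, and by compactness these points
  accumulate at a point at which one permutation works with strict inequalities.\<close>

lemma open_equidistributed: "open (equidistributed e)"
proof -
  have "closed (- equidistributed e)"
    unfolding closed_sequential_limits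
  proof (intro allI impI, elim conjE)
    fix U u assume U: "\<forall>k. U k \<in> - equidistributed e" and lim: "U \<longlonglongrightarrow> u"
    show "u \<in> - equidistributed e"
    proof
      assume "u \<in> equidistributed e"
      then obtain I t y where E: "equidistributed_with u e I t y"
        unfolding equidistributed_def by blast
      then have fin: "finite I" "I \<noteq> {}" "\<forall>q. \<exists>i\<in>I. dist q (y i) < e"
        and \<sigma>: "\<And>q. \<exists>\<sigma>. bij_betw \<sigma> I I \<and> (\<forall>i\<in>I. dist (proj_flow u (t i) q) (y (\<sigma> i)) < e)"
        unfolding equidistributed_with_def by simp_all
      have notE: "\<not> equidistributed_with (U k) e I t y" for k
        using U unfolding equidistributed_def by blast
      have "\<exists>q. \<forall>\<sigma>. bij_betw \<sigma> I I \<longrightarrow> \<not> (\<forall>i\<in>I. dist (proj_flow (U k) (t i) q) (y (\<sigma> i)) < e)" for k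
        using notE[of k] fin unfolding equidistributed_with_def by simp
      then obtain Q where Q: "\<And>k \<sigma>. bij_betw \<sigma> I I \<Longrightarrow> \<not> (\<forall>i\<in>I. dist (proj_flow (U k) (t i) (Q k)) (y (\<sigma> i)) < e)"
        by metis
      obtain q s where s: "strict_mono s" and q: "(Q \<circ> s) \<longlonglongrightarrow> q"
        using seq_compactE[OF compact_imp_seq_compact[OF compact_torus], of Q] by (metis UNIV_I)
      obtain \<sigma>' where \<sigma>': "bij_betw \<sigma>' I I" "\<And>i. i \<in> I \<Longrightarrow> dist (proj_flow u (t i) q) (y (\<sigma>' i)) < e"
        using \<sigma>[of q] by blast
      have "eventually (\<lambda>k. \<forall>i\<in>I. dist (proj_flow (U (s k)) (t i) (Q (s k))) (y (\<sigma>' i)) < e) sequentially"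
      proof (rule eventually_ball_finite[OF fin(1)], rule ballI)
        fix i assume i: "i \<in> I"
        have "(\<lambda>k. proj_flow (U (s k)) (t i) (Q (s k))) \<longlonglongrightarrow> proj_flow u (t i) q"
          using LIMSEQ_subseq_LIMSEQ[OF lim s] q by (intro tendsto_proj_flow) (simp_all add: o_def)
        then have "(\<lambda>k. dist (proj_flow (U (s k)) (t i) (Q (s k))) (y (\<sigma>' i))) \<longlonglongrightarrow> dist (proj_flow u (t i) q) (y (\<sigma>' i))"
          by (intro tendsto_intros)
        then show "eventually (\<lambda>k. dist (proj_flow (U (s k)) (t i) (Q (s k))) (y (\<sigma>' i)) < e) sequentially"
          using \<sigma>'(2)[OF i] by (rule order_tendstoD)
      qed
      then show False using Q[OF \<sigma>'(1)] by (auto simp: eventually_sequentially)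
    qed
  qed
  then show ?thesis by (simp add: closed_def)
qed

text \<open>The inverse of the conjugacy is uniformly continuous, so it suffices to match points of the linear
  flow. Take the grid as index set, times at which the orbit of \<open>0\<close> is close to the given
  grid point, and the images of the grid points as reference points.\<close>

theorem Upsilon_equidistributed:
  assumes u: "u \<in> Upsilon H" and e: "e > 0"
  shows "u \<in> equidistributed e"
proof -
  have inv: "invariant_lagrangian_graph H u" using u by (simp add: Upsilon_def)
  obtain \<alpha> where erg: "ergodic_linear_flow \<alpha>" and "conjugated_to_linear_flow H u \<alpha>"
    using u unfolding Upsilon_def by blast
  then obtain h g where homeo: "homeomorphism (graph_of u) UNIV h g"
    and conj: "\<And>t z. z \<in> graph_of u \<Longrightarrow> h (ham_flow H t z) = torus_shift (t *\<^sub>R \<alpha>) (h z)"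
    unfolding conjugated_to_linear_flow_def by metis
  define \<eta> where "\<eta> q = h (q, u q)" for q
  define \<gamma> where "\<gamma> \<theta> = fst (g \<theta>)" for \<theta>
  have mem: "(q, u q) \<in> graph_of u" for q by (simp add: in_graph_of_iff)
  have \<gamma>\<eta>: "\<gamma> (\<eta> q) = q" for q
    using homeomorphism_apply1[OF homeo mem[of q]] by (simp add: \<gamma>_def \<eta>_def)
  have flow: "proj_flow u t q = \<gamma> (torus_shift (t *\<^sub>R \<alpha>) (\<eta> q))" for t q
  proof -
    have "torus_shift (t *\<^sub>R \<alpha>) (\<eta> q) = \<eta> (proj_flow u t q)"
      using conj[OF mem[of q], of t] by (simp add: \<eta>_def ham_flow_on_graph[OF inv])
    then show ?thesis by (simp add: \<gamma>\<eta>)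
  qed
  have "continuous_on UNIV \<gamma>"
    unfolding \<gamma>_def by (intro continuous_intros homeomorphism_cont2[OF homeo])
  then have "uniformly_continuous_on UNIV \<gamma>" by (rule compact_uniformly_continuous[OF _ compact_torus])
  then obtain d where d: "d > 0" "\<And>\<theta> \<theta>'. dist \<theta> \<theta>' < d \<Longrightarrow> dist (\<gamma> \<theta>) (\<gamma> \<theta>') < e"
    using e unfolding uniformly_continuous_on_def by (metis UNIV_I)
  obtain N :: nat where N: "real N > 2 * CARD('n) / d" using reals_Archimedean2 by blast
  moreover have "2 * CARD('n) / d \<ge> 0" using d(1) by simp
  ultimately have N0: "N > 0" by linarith
  have Nd: "CARD('n) / N < d / 2" using N N0 d(1) by (simp add: field_simps)
  then have Nd': "CARD('n) / N < d" using d(1) by linarith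
  define I :: "(real ^ 'n) set" where "I = grid N"
  have "\<exists>t. dist (torus_proj (t *\<^sub>R \<alpha>)) (torus_proj i) < d / 2" for i
    using ergodic_orbit_dense[OF erg, of "d / 2"] d(1) by (simp only: half_gt_zero)
  then obtain t where t: "\<And>i. dist (torus_proj (t i *\<^sub>R \<alpha>)) (torus_proj i) < d / 2" by metis
  define y where "y i = \<gamma> (torus_proj i)" for i
  have "equidistributed_with u e I t y"
    unfolding equidistributed_with_def
  proof (intro conjI allI)
    show "finite I" using finite_grid[OF N0] by (simp add: I_def)
    show "I \<noteq> {}" using grid_0 unfolding I_def by blast
    fix q
    obtain x where x: "\<eta> q = torus_proj x" by (rule torus_cases)
    obtain \<sigma> where \<sigma>: "bij_betw \<sigma> (grid N) (grid N)"
      "\<And>g. g \<in> grid N \<Longrightarrow> dist (torus_proj (x + g)) (torus_proj (\<sigma> g)) \<le> CARD('n) / N"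
      using grid_translation[OF N0, of x] by blast
    show "\<exists>i\<in>I. dist q (y i) < e"
    proof
      show "\<sigma> 0 \<in> I" using \<sigma>(1) grid_0 unfolding I_def bij_betw_def by blast
      have "dist (torus_proj x) (torus_proj (\<sigma> 0)) < d" using \<sigma>(2)[OF grid_0] Nd' by simp
      from d(2)[OF this] show "dist q (y (\<sigma> 0)) < e" by (simp add: y_def \<gamma>\<eta> flip: x)
    qed
    show "\<exists>\<sigma>. bij_betw \<sigma> I I \<and> (\<forall>i\<in>I. dist (proj_flow u (t i) q) (y (\<sigma> i)) < e)"
    proof (intro exI conjI ballI)
      show "bij_betw \<sigma> I I" using \<sigma>(1) by (simp add: I_def)
      fix i assume "i \<in> I"
      have "dist (torus_proj (x + t i *\<^sub>R \<alpha>)) (torus_proj (x + i)) = dist (torus_proj (t i *\<^sub>R \<alpha>)) (torus_proj i)"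
        by (simp add: dist_torus_proj)
      moreover have "dist (torus_proj (x + i)) (torus_proj (\<sigma> i)) < d / 2"
        using \<sigma>(2)[of i] Nd \<open>i \<in> I\<close> unfolding I_def by linarith
      ultimately have "dist (torus_proj (x + t i *\<^sub>R \<alpha>)) (torus_proj (\<sigma> i)) < d"
        using dist_triangle_half_r[of "torus_proj (x + i)" "torus_proj (x + t i *\<^sub>R \<alpha>)" d "torus_proj (\<sigma> i)"]
          t[of i] by (simp add: dist_commute)
      from d(2)[OF this] show "dist (proj_flow u (t i) q) (y (\<sigma> i)) < e"
        by (simp add: flow x torus_shift_proj y_def)
    qed
  qed
  then show ?thesis unfolding equidistributed_def by blast
qed

text \<open>Invariant measures on the graph correspond to invariant measures of the projected flow; the
  latter live on a compact space, where continuous functions are bounded.\<close>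

definition flow_invariant :: "'n covector_field \<Rightarrow> 'n torus measure \<Rightarrow> bool" where
  "flow_invariant u m \<longleftrightarrow> prob_space m \<and> sets m = sets borel \<and> (\<forall>t. distr m borel (proj_flow u t) = m)"

lemma proj_flow_measurable: "sets m = sets borel \<Longrightarrow> proj_flow u t \<in> measurable m borel"
  unfolding measurable_cong_sets[OF _ refl]
  by (rule borel_measurable_continuous_onI[OF continuous_on_proj_flow])

lemma graph_map_measurable: "sets m = sets borel \<Longrightarrow> (\<lambda>q. (q, u q)) \<in> measurable m borel"
  for u :: "'n covector_field"
  unfolding measurable_cong_sets[OF _ refl]
  by (intro borel_measurable_continuous_onI continuous_intros) auto

lemma closed_graph_of:
  fixes u :: "'n covector_field"
  shows "closed (graph_of u)"
proof -
  have "graph_of u = {z. snd z = u (fst z)}" by (auto simp: in_graph_of_iff)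
  moreover have "closed {z :: 'n phase. snd z = u (fst z)}"
    by (intro closed_Collect_eq continuous_intros continuous_on_compose2[OF continuous_on_apply_bcontfun[of UNIV]]) auto
  ultimately show ?thesis by simp
qed

lemma invariant_measure_of_flow_invariant:
  assumes inv: "invariant_lagrangian_graph H u" and m: "flow_invariant u m"
  shows "distr m borel (\<lambda>q. (q, u q)) \<in> invariant_measures_on H u"
proof -
  let ?\<iota> = "\<lambda>q. (q, u q)"
  interpret prob_space m using m by (simp add: flow_invariant_def)
  have sm: "sets m = sets borel" using m by (simp add: flow_invariant_def)
  note [measurable] = graph_map_measurable[OF sm, of u] proj_flow_measurable[OF sm]
  have sp: "space m = UNIV" using sets_eq_imp_space_eq[OF sm] by simp
  have "?\<iota> -` graph_of u = UNIV" by (auto simp: in_graph_of_iff)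
  then have 1: "emeasure (distr m borel ?\<iota>) (graph_of u) = 1"
    using closed_graph_of[of u] emeasure_space_1 sp by (subst emeasure_distr) auto
  have 2: "emeasure (distr m borel ?\<iota>) UNIV = 1"
    using emeasure_space_1 sp by (subst emeasure_distr) auto
  have 3: "distr (distr m borel ?\<iota>) borel (ham_flow H t) = distr m borel ?\<iota>" for t
  proof -
    have hf: "ham_flow H t \<in> borel_measurable borel"
      by (rule borel_measurable_continuous_onI[OF continuous_on_ham_flow])
    have "distr (distr m borel ?\<iota>) borel (ham_flow H t) = distr m borel (ham_flow H t \<circ> ?\<iota>)"
      using hf by (intro distr_distr) auto
    also have "ham_flow H t \<circ> ?\<iota> = ?\<iota> \<circ> proj_flow u t"
      by (auto simp: fun_eq_iff ham_flow_on_graph[OF inv])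
    also have "distr m borel (?\<iota> \<circ> proj_flow u t) = distr (distr m borel (proj_flow u t)) borel ?\<iota>"
      by (subst distr_distr) (auto intro: graph_map_measurable)
    also have "distr m borel (proj_flow u t) = m" using m by (simp add: flow_invariant_def)
    finally show ?thesis .
  qed
  show ?thesis unfolding invariant_measures_on_def using 1 2 3 by simp
qed

lemma flow_invariant_of_invariant_measure:
  assumes inv: "invariant_lagrangian_graph H u" and \<mu>: "\<mu> \<in> invariant_measures_on H u"
  shows "flow_invariant u (distr \<mu> borel fst)"
    and "\<mu> = distr (distr \<mu> borel fst) borel (\<lambda>q. (q, u q))"
proof -
  let ?\<iota> = "\<lambda>q. (q, u q)"
  have s\<mu>: "sets \<mu> = sets borel" using \<mu> by (simp add: invariant_measures_on_def)
  have sp: "space \<mu> = UNIV" using sets_eq_imp_space_eq[OF s\<mu>] by simp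
  interpret prob_space \<mu> using \<mu> sp by (intro prob_spaceI) (simp add: invariant_measures_on_def)
  have fst: "fst \<in> measurable \<mu> (borel :: 'n torus measure)"
    unfolding measurable_cong_sets[OF s\<mu> refl] by (intro borel_measurable_continuous_onI continuous_intros)
  have hf: "ham_flow H t \<in> measurable \<mu> borel" for t
    unfolding measurable_cong_sets[OF s\<mu> refl]
    by (rule borel_measurable_continuous_onI[OF continuous_on_ham_flow])
  have fstb: "fst \<in> measurable (borel :: 'n phase measure) (borel :: 'n torus measure)"
    by (intro borel_measurable_continuous_onI continuous_intros)
  have AE: "AE z in \<mu>. z \<in> graph_of u"
    using \<mu> by (intro AE_prob_1) (simp add: invariant_measures_on_def measure_def)
  have "distr (distr \<mu> borel fst) borel (proj_flow u t) = distr \<mu> borel fst" for t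
  proof -
    have "distr (distr \<mu> borel fst) borel (proj_flow u t) = distr \<mu> borel (proj_flow u t \<circ> fst)"
      by (intro distr_distr fst proj_flow_measurable) simp
    also have "\<dots> = distr \<mu> borel (fst \<circ> ham_flow H t)"
    proof (rule distr_cong_AE[OF refl refl])
      show "AE z in \<mu>. (proj_flow u t \<circ> fst) z = (fst \<circ> ham_flow H t) z"
        using AE
      proof eventually_elim
        case (elim z)
        then show ?case by (cases z) (simp add: in_graph_of_iff proj_flow_def)
      qed
      show "proj_flow u t \<circ> fst \<in> measurable \<mu> borel"
        by (rule measurable_comp[OF fst proj_flow_measurable]) simp
      show "fst \<circ> ham_flow H t \<in> measurable \<mu> borel"
        by (rule measurable_comp[OF hf fstb])
    qed
    also have "\<dots> = distr (distr \<mu> borel (ham_flow H t)) borel fst"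
      by (rule distr_distr[symmetric, OF fstb hf])
    also have "distr \<mu> borel (ham_flow H t) = \<mu>" using \<mu> by (simp add: invariant_measures_on_def)
    finally show ?thesis .
  qed
  then show "flow_invariant u (distr \<mu> borel fst)"
    using prob_space_distr[OF fst] by (simp add: flow_invariant_def)
  have "distr (distr \<mu> borel fst) borel ?\<iota> = distr \<mu> borel (?\<iota> \<circ> fst)"
    by (intro distr_distr fst graph_map_measurable) simp
  also have "\<dots> = distr \<mu> borel (\<lambda>z. z)"
  proof (rule distr_cong_AE[OF refl refl])
    show "AE z in \<mu>. (?\<iota> \<circ> fst) z = z"
      using AE
    proof eventually_elim
      case (elim z)
      then show ?case by (cases z) (simp add: in_graph_of_iff)
    qed
    show "?\<iota> \<circ> fst \<in> measurable \<mu> borel" by (rule measurable_comp[OF fst graph_map_measurable]) simp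
    show "(\<lambda>z. z) \<in> measurable \<mu> borel" using s\<mu> by (simp add: measurable_ident_sets)
  qed
  also have "\<dots> = \<mu>" using s\<mu> by (simp add: distr_id2)
  finally show "\<mu> = distr (distr \<mu> borel fst) borel ?\<iota>" by simp
qed

text \<open>Matched points are within the modulus of continuity, and averages do not see the permutation.\<close>

lemma uniform_averages:
  assumes eq: "\<And>k :: nat. equidistributed_with u (1 / Suc k) (I k) (t k) (y k)"
    and \<phi>: "continuous_on UNIV \<phi>" and \<epsilon>: "\<epsilon> > 0"
  shows "\<exists>N. \<forall>k\<ge>N. \<forall>q. \<bar>average (I k) (\<lambda>i. \<phi> (proj_flow u (t k i) q)) - average (I k) (\<lambda>i. \<phi> (y k i))\<bar> \<le> \<epsilon>"
proof -
  have "uniformly_continuous_on UNIV \<phi>" by (rule compact_uniformly_continuous[OF \<phi> compact_torus])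
  then obtain d where d: "d > 0" "\<And>q q'. dist q q' < d \<Longrightarrow> dist (\<phi> q) (\<phi> q') < \<epsilon>"
    using \<epsilon> unfolding uniformly_continuous_on_def by (metis UNIV_I)
  obtain N where N: "inverse (real (Suc N)) < d" using reals_Archimedean[OF d(1)] by blast
  have "\<bar>average (I k) (\<lambda>i. \<phi> (proj_flow u (t k i) q)) - average (I k) (\<lambda>i. \<phi> (y k i))\<bar> \<le> \<epsilon>" if k: "k \<ge> N" for k q
  proof -
    obtain \<sigma> where \<sigma>: "bij_betw \<sigma> (I k) (I k)" "\<And>i. i \<in> I k \<Longrightarrow> dist (proj_flow u (t k i) q) (y k (\<sigma> i)) < 1 / Suc k"
      using eq[of k] unfolding equidistributed_with_def by blast
    have "1 / Suc k \<le> inverse (real (Suc N))" using k by (simp add: divide_simps)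
    then have le: "dist (proj_flow u (t k i) q) (y k (\<sigma> i)) < d" if "i \<in> I k" for i
      using \<sigma>(2)[OF that] N by simp
    have "\<bar>average (I k) (\<lambda>i. \<phi> (proj_flow u (t k i) q)) - average (I k) (\<lambda>i. \<phi> (y k (\<sigma> i)))\<bar> \<le> \<epsilon>"
    proof (rule average_diff_le)
      show "\<bar>\<phi> (proj_flow u (t k i) q) - \<phi> (y k (\<sigma> i))\<bar> \<le> \<epsilon>" if "i \<in> I k" for i
        using d(2)[OF le[OF that]] by (simp add: dist_real_def)
    qed (use eq[of k] in \<open>auto simp: equidistributed_with_def\<close>)
    then show ?thesis using average_reindex[OF \<sigma>(1), of "\<lambda>i. \<phi> (y k i)"] by simp
  qed
  then show ?thesis by blast
qed

text \<open>Integrating the average over the times \<open>t\<^sub>i\<close> along the flow does not change the integral, while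
  the averaged function is uniformly close to the average over the \<open>y\<^sub>i\<close>.\<close>

lemma invariant_integral_limit:
  assumes eq: "\<And>k :: nat. equidistributed_with u (1 / Suc k) (I k) (t k) (y k)"
    and m: "flow_invariant u m" and \<phi>: "continuous_on UNIV \<phi>"
  shows "(\<lambda>k. average (I k) (\<lambda>i. \<phi> (y k i))) \<longlonglongrightarrow> (LINT q|m. \<phi> q)"
proof (rule LIMSEQ_I)
  fix \<epsilon> :: real assume "\<epsilon> > 0"
  interpret prob_space m using m by (simp add: flow_invariant_def)
  have sm: "sets m = sets borel" using m by (simp add: flow_invariant_def)
  have b\<phi>: "\<phi> \<in> borel_measurable borel" by (rule borel_measurable_continuous_onI[OF \<phi>])
  have "bounded (range \<phi>)" by (intro compact_imp_bounded compact_continuous_image \<phi> compact_torus)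
  then obtain B where B: "B > 0" "\<And>q. norm (\<phi> q) \<le> B" unfolding bounded_pos by blast
  have int: "integrable m (\<lambda>q. \<phi> (proj_flow u s q))" for s
    using measurable_compose[OF proj_flow_measurable[OF sm] b\<phi>] B(2)
    by (intro integrable_const_bound[where B = B]) auto
  have inv: "(LINT q|m. \<phi> (proj_flow u s q)) = (LINT q|m. \<phi> q)" for s
  proof -
    have "(LINT q|distr m borel (proj_flow u s). \<phi> q) = (LINT q|m. \<phi> (proj_flow u s q))"
      by (rule integral_distr[OF proj_flow_measurable[OF sm] b\<phi>])
    then show ?thesis using m by (simp add: flow_invariant_def)
  qed
  obtain N where N: "\<And>k q. k \<ge> N \<Longrightarrow>
      \<bar>average (I k) (\<lambda>i. \<phi> (proj_flow u (t k i) q)) - average (I k) (\<lambda>i. \<phi> (y k i))\<bar> \<le> \<epsilon> / 2"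
    using uniform_averages[OF eq \<phi>, of "\<epsilon> / 2"] \<open>\<epsilon> > 0\<close> by auto
  have "norm (average (I k) (\<lambda>i. \<phi> (y k i)) - (LINT q|m. \<phi> q)) < \<epsilon>" if k: "k \<ge> N" for k
  proof -
    let ?A = "\<lambda>q. average (I k) (\<lambda>i. \<phi> (proj_flow u (t k i) q))"
    let ?c = "average (I k) (\<lambda>i. \<phi> (y k i))"
    have card: "card (I k) > 0" using eq[of k] by (simp add: equidistributed_with_def card_gt_0_iff)
    have iA: "integrable m ?A" unfolding average_def using int by auto
    have "(LINT q|m. ?A q) = (LINT q|m. \<phi> q)"
      unfolding average_def using int card by (simp add: inv)
    then have "(LINT q|m. \<phi> q) - ?c = (LINT q|m. ?A q - ?c)"
      using iA by (simp add: prob_space)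
    also have "norm \<dots> \<le> (LINT q|m. norm (?A q - ?c))" by (rule integral_norm_bound)
    also have "\<dots> \<le> (LINT q|m. \<epsilon> / 2)"
    proof (rule integral_mono)
      show "norm (?A q - ?c) \<le> \<epsilon> / 2" for q using N[OF k, of q] by simp
    qed (use iA in auto)
    also have "\<dots> < \<epsilon>" using \<open>\<epsilon> > 0\<close> by (simp add: prob_space)
    finally show ?thesis by (simp add: abs_minus_commute)
  qed
  then show "\<exists>N. \<forall>k\<ge>N. norm (average (I k) (\<lambda>i. \<phi> (y k i)) - (LINT q|m. \<phi> q)) < \<epsilon>" by blast
qed

text \<open>For a weak limit of the averages over the \<open>y\<^sub>i\<close>, invariance under time \<open>\<tau>\<close> holds because the
  averages along the orbits of a point and of its image at time \<open>\<tau>\<close> are both close to the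
  average over the \<open>y\<^sub>i\<close>.\<close>

lemma flow_invariant_exists:
  assumes inv: "invariant_lagrangian_graph H u"
    and eq: "\<And>k :: nat. equidistributed_with u (1 / Suc k) (I k) (t k) (y k)"
  obtains m where "flow_invariant u m"
proof -
  have I: "finite (I k)" "I k \<noteq> {}" for k using eq[of k] by (simp_all add: equidistributed_with_def)
  obtain m s where s: "strict_mono s" and m: "prob_space m" "sets m = sets borel"
    and lim: "\<And>\<phi> :: 'n torus \<Rightarrow> real. continuous_on UNIV \<phi> \<Longrightarrow>
       (\<lambda>k. average (I (s k)) (\<lambda>i. \<phi> (y (s k) i))) \<longlonglongrightarrow> (LINT q|m. \<phi> q)"
    using weak_limit_of_averages[of I y, OF I] by blast
  have "distr m borel (proj_flow u \<tau>) = m" for \<tau>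
  proof (rule measure_eqI_continuous)
    show "prob_space (distr m borel (proj_flow u \<tau>))"
      by (rule prob_space.prob_space_distr[OF m(1) proj_flow_measurable[OF m(2)]])
    fix \<phi> :: "'n torus \<Rightarrow> real" assume \<phi>: "continuous_on UNIV \<phi>"
    define \<psi> where "\<psi> q = \<phi> (proj_flow u \<tau> q)" for q
    have \<psi>: "continuous_on UNIV \<psi>"
      unfolding \<psi>_def by (rule continuous_on_compose2[OF \<phi> continuous_on_proj_flow]) auto
    have "(\<lambda>k. average (I (s k)) (\<lambda>i. \<phi> (y (s k) i)) - average (I (s k)) (\<lambda>i. \<psi> (y (s k) i))) \<longlonglongrightarrow> 0"
    proof (rule LIMSEQ_I)
      fix \<epsilon> :: real assume "\<epsilon> > 0"
      obtain N1 where N1: "\<And>k q. k \<ge> N1 \<Longrightarrow>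
          \<bar>average (I k) (\<lambda>i. \<phi> (proj_flow u (t k i) q)) - average (I k) (\<lambda>i. \<phi> (y k i))\<bar> \<le> \<epsilon> / 3"
        using uniform_averages[OF eq \<phi>, of "\<epsilon> / 3"] \<open>\<epsilon> > 0\<close> by auto
      obtain N2 where N2: "\<And>k q. k \<ge> N2 \<Longrightarrow>
          \<bar>average (I k) (\<lambda>i. \<psi> (proj_flow u (t k i) q)) - average (I k) (\<lambda>i. \<psi> (y k i))\<bar> \<le> \<epsilon> / 3"
        using uniform_averages[OF eq \<psi>, of "\<epsilon> / 3"] \<open>\<epsilon> > 0\<close> by auto
      have "norm (average (I (s k)) (\<lambda>i. \<phi> (y (s k) i)) - average (I (s k)) (\<lambda>i. \<psi> (y (s k) i)) - 0) < \<epsilon>"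
        if "k \<ge> max N1 N2" for k
      proof -
        have "s k \<ge> N1" "s k \<ge> N2" using that seq_suble[OF s, of k] by linarith+
        from N1[OF this(1), of "proj_flow u \<tau> undefined"] N2[OF this(2), of undefined]
        have "\<bar>average (I (s k)) (\<lambda>i. \<phi> (proj_flow u (t (s k) i) (proj_flow u \<tau> undefined))) - average (I (s k)) (\<lambda>i. \<phi> (y (s k) i))\<bar> \<le> \<epsilon> / 3"
          "\<bar>average (I (s k)) (\<lambda>i. \<phi> (proj_flow u (t (s k) i) (proj_flow u \<tau> undefined))) - average (I (s k)) (\<lambda>i. \<psi> (y (s k) i))\<bar> \<le> \<epsilon> / 3"
          by (simp_all add: \<psi>_def add.commute flip: proj_flow_add[OF inv])
        then show ?thesis using \<open>\<epsilon> > 0\<close> unfolding real_norm_def diff_0_right by linarith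
      qed
      then show "\<exists>N. \<forall>k\<ge>N. norm (average (I (s k)) (\<lambda>i. \<phi> (y (s k) i)) - average (I (s k)) (\<lambda>i. \<psi> (y (s k) i)) - 0) < \<epsilon>"
        by blast
    qed
    with tendsto_diff[OF lim[OF \<phi>] lim[OF \<psi>]]
    have "(LINT q|m. \<phi> q) - (LINT q|m. \<psi> q) = 0" by (rule LIMSEQ_unique)
    moreover have "(LINT q|distr m borel (proj_flow u \<tau>). \<phi> q) = (LINT q|m. \<psi> q)"
      unfolding \<psi>_def
      by (rule integral_distr[OF proj_flow_measurable[OF m(2)] borel_measurable_continuous_onI[OF \<phi>]])
    ultimately show "(LINT q|distr m borel (proj_flow u \<tau>). \<phi> q) = (LINT q|m. \<phi> q)" by simp
  qed (use m in auto)
  then show thesis using m by (intro that[of m]) (simp add: flow_invariant_def)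
qed

text \<open>The times can be chosen from a finite set. This gives density of the orbits, and it shows that a
  ball has positive measure because finitely many of its preimages cover the torus.\<close>

lemma equidistributed_visits:
  assumes eq: "\<And>k :: nat. equidistributed_with u (1 / Suc k) (I k) (t k) (y k)" and e: "e > 0"
  shows "\<exists>T. finite T \<and> (\<forall>q q'. \<exists>s\<in>T. dist (proj_flow u s q) q' < e)"
proof -
  obtain k where k: "inverse (real (Suc k)) < e / 2" using reals_Archimedean[OF half_gt_zero[OF e]] by blast
  have "\<exists>s\<in>t k ` I k. dist (proj_flow u s q) q' < e" for q q'
  proof -
    obtain i where i: "i \<in> I k" "dist q' (y k i) < 1 / Suc k"
      using eq[of k] unfolding equidistributed_with_def by blast
    obtain \<sigma> where \<sigma>: "bij_betw \<sigma> (I k) (I k)" "\<And>i. i \<in> I k \<Longrightarrow> dist (proj_flow u (t k i) q) (y k (\<sigma> i)) < 1 / Suc k"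
      using eq[of k] unfolding equidistributed_with_def by blast
    have "i \<in> \<sigma> ` I k" using i(1) bij_betw_imp_surj_on[OF \<sigma>(1)] by simp
    then obtain j where j: "j \<in> I k" "\<sigma> j = i" by blast
    have "dist (proj_flow u (t k j) q) q' < e"
    proof (rule dist_triangle_half_l)
      have "1 / Suc k < e / 2" using k by (simp only: inverse_eq_divide)
      then show "dist (proj_flow u (t k j) q) (y k i) < e / 2" "dist q' (y k i) < e / 2"
        using \<sigma>(2)[OF j(1)] i(2) unfolding j(2) by linarith+
    qed
    then show ?thesis using j(1) by blast
  qed
  moreover have "finite (t k ` I k)" using eq[of k] by (simp add: equidistributed_with_def)
  ultimately show ?thesis by blast
qed

theorem equidistributed_strictly_ergodic:
  assumes inv: "invariant_lagrangian_graph H u"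
    and eq': "\<And>k :: nat. u \<in> equidistributed (1 / Suc k)"
  shows "strictly_ergodic H u"
    and "e > 0 \<Longrightarrow> \<exists>s. dist (proj_flow u s q) q' < e"
proof -
  have "\<forall>k. \<exists>I t y. equidistributed_with u (1 / Suc k) I t y" using eq' by (simp add: equidistributed_def)
  then obtain I t y where eq: "\<And>k :: nat. equidistributed_with u (1 / Suc k) (I k) (t k) (y k)" by metis
  show "\<exists>s. dist (proj_flow u s q) q' < e" if "e > 0"
    using equidistributed_visits[OF eq that] by blast
  let ?\<iota> = "\<lambda>q. (q, u q)"
  obtain m where m: "flow_invariant u m" using flow_invariant_exists[OF inv eq] .
  have sm: "sets m = sets borel" and pm: "prob_space m" using m by (simp_all add: flow_invariant_def)
  interpret prob_space m by (rule pm)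
  have unique: "m' = m" if m': "flow_invariant u m'" for m'
  proof (rule measure_eqI_continuous)
    fix \<phi> :: "'n torus \<Rightarrow> real" assume \<phi>: "continuous_on UNIV \<phi>"
    show "(LINT q|m'. \<phi> q) = (LINT q|m. \<phi> q)"
      by (rule LIMSEQ_unique[OF invariant_integral_limit[OF eq m' \<phi>] invariant_integral_limit[OF eq m \<phi>]])
  qed (use m m' in \<open>auto simp: flow_invariant_def\<close>)
  define \<mu> where "\<mu> = distr m borel ?\<iota>"
  have \<mu>: "\<mu> \<in> invariant_measures_on H u"
    unfolding \<mu>_def by (rule invariant_measure_of_flow_invariant[OF inv m])
  have single: "invariant_measures_on H u = {\<mu>}"
  proof (intro equalityI subsetI)
    fix \<nu> assume "\<nu> \<in> invariant_measures_on H u"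
    from flow_invariant_of_invariant_measure[OF inv this] unique show "\<nu> \<in> {\<mu>}"
      unfolding \<mu>_def by (metis singletonI)
  qed (use \<mu> in blast)
  have open_pos: "emeasure m V > 0" if V: "open V" "q \<in> V" for V q
  proof (rule ccontr)
    assume "\<not> ?thesis"
    then have zero: "emeasure m V = 0" by simp
    obtain r where r: "r > 0" "ball q r \<subseteq> V" using V openE by blast
    obtain T where T: "finite T" "\<And>x. \<exists>s\<in>T. dist (proj_flow u s x) q < r"
      using equidistributed_visits[OF eq r(1)] by blast
    have z: "emeasure m (proj_flow u s -` V) = 0" for s
    proof -
      have "emeasure (distr m borel (proj_flow u s)) V = emeasure m (proj_flow u s -` V \<inter> space m)"
        using V by (intro emeasure_distr proj_flow_measurable sm) auto
      then show ?thesis using zero m sets_eq_imp_space_eq[OF sm] by (simp add: flow_invariant_def)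
    qed
    have meas: "proj_flow u s -` V \<in> sets m" for s
      using V(1) open_vimage[OF V(1) continuous_on_proj_flow] sm by simp
    have "emeasure m (\<Union>s\<in>T. proj_flow u s -` V) \<le> (\<Sum>s\<in>T. emeasure m (proj_flow u s -` V))"
      by (rule emeasure_subadditive_finite[OF T(1)]) (use meas in blast)
    then have "emeasure m (\<Union>s\<in>T. proj_flow u s -` V) = 0" by (simp add: z)
    moreover have "(\<Union>s\<in>T. proj_flow u s -` V) = space m"
    proof -
      have "x \<in> (\<Union>s\<in>T. proj_flow u s -` V)" for x using T(2)[of x] r(2) by (auto simp: dist_commute)
      then show ?thesis using sets_eq_imp_space_eq[OF sm] by auto
    qed
    ultimately show False using emeasure_space_1 by simp
  qed
  have "measure_support \<mu> = graph_of u"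
  proof (intro equalityI subsetI)
    fix z assume "z \<in> graph_of u"
    then obtain q where z: "z = ?\<iota> q" unfolding graph_of_def by blast
    show "z \<in> measure_support \<mu>"
      unfolding measure_support_def
    proof (intro CollectI allI impI)
      fix U :: "'n phase set" assume U: "open U" "z \<in> U"
      have "open (?\<iota> -` U)" using U(1) by (rule open_vimage) (intro continuous_intros, auto)
      moreover have "emeasure \<mu> U = emeasure m (?\<iota> -` U)"
        unfolding \<mu>_def using U(1) graph_map_measurable[OF sm] sets_eq_imp_space_eq[OF sm] by (subst emeasure_distr) auto
      ultimately show "emeasure \<mu> U > 0" using open_pos[of "?\<iota> -` U" q] U(2) z by simp
    qed
  next
    fix z assume z: "z \<in> measure_support \<mu>"
    show "z \<in> graph_of u"
    proof (rule ccontr)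
      assume "z \<notin> graph_of u"
      then have "emeasure \<mu> (- graph_of u) > 0"
        using z closed_graph_of[of u] unfolding measure_support_def by (simp add: closed_def)
      moreover have "?\<iota> -` (- graph_of u) = {}" by (auto simp: in_graph_of_iff)
      then have "emeasure \<mu> (- graph_of u) = 0"
        unfolding \<mu>_def using closed_graph_of[of u] graph_map_measurable[OF sm] by (subst emeasure_distr) auto
      ultimately show False by simp
    qed
  qed
  with single show "strictly_ergodic H u" unfolding strictly_ergodic_def by blast
qed

section \<open>The Legendre transform\<close>

lemma Hp_inj: "Hp x p = Hp x q \<Longrightarrow> p = q"
proof -
  assume eq: "Hp x p = Hp x q"
  define r where "r = max (norm p) (norm q)"
  obtain m where m: "m > 0" "\<And>x p v. norm p \<le> r \<Longrightarrow> hessH (x, p) (0, v) \<bullet> (0, v) \<ge> m * (norm v)\<^sup>2"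
    using strictly_positive_hessian[of r] by blast
  have "(Hp x p - Hp x q) \<bullet> (p - q) \<ge> m * (norm (p - q))\<^sup>2"
    by (rule strong_monotonicity[OF m(2)]) (auto simp: r_def)
  then have "m * (norm (p - q))\<^sup>2 \<le> 0" using eq by simp
  then show "p = q" using m(1) by (simp add: mult_le_0_iff)
qed

text \<open>The concave superlinear function \<open>p \<bullet> v - H (x, p)\<close> attains its maximum, where its derivative
  vanishes.\<close>

lemma Hp_surj: "\<exists>p. Hp x p = v"
proof -
  define g where "g p = p \<bullet> v - lift_fun H (x, p)" for p
  obtain b where b: "\<And>p. norm p \<ge> b \<Longrightarrow> lift_fun H (x, p) \<ge> (norm v + 1) * norm p"
    using superlinear_at_point by blast
  define R where "R = max b (\<bar>lift_fun H (x, 0)\<bar> + 1)"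
  have cg: "continuous_on (cball 0 R) g"
    unfolding g_def by (intro continuous_intros continuous_on_compose2[OF continuous_on_liftH[of UNIV]]) auto
  have "0 \<in> cball (0 :: real ^ 'n) R" by (auto simp: R_def)
  then have "cball (0 :: real ^ 'n) R \<noteq> {}" by blast
  from continuous_attains_sup[OF compact_cball this cg]
  obtain p0 where p0: "\<And>p. p \<in> cball 0 R \<Longrightarrow> g p \<le> g p0" by blast
  have max: "g p \<le> g p0" for p
  proof (cases "p \<in> cball 0 R")
    case False
    then have big: "norm p \<ge> b" "norm p > \<bar>lift_fun H (x, 0)\<bar> + 1" by (auto simp: R_def)
    have "p \<bullet> v \<le> norm p * norm v" by (rule norm_cauchy_schwarz)
    then have "g p \<le> norm p * norm v - (norm v + 1) * norm p" using b[OF big(1)] by (simp add: g_def)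
    also have "\<dots> = - norm p" by (simp add: algebra_simps)
    also have "\<dots> \<le> g 0" using big(2) by (simp add: g_def)
    also have "\<dots> \<le> g p0" using p0[OF \<open>0 \<in> cball 0 R\<close>] .
    finally show ?thesis .
  qed (use p0 in auto)
  have "(g has_derivative (\<lambda>h. h \<bullet> v - h \<bullet> Hp x p0)) (at p0)"
    unfolding g_def
    by (intro has_derivative_diff has_derivative_inner_left has_derivative_ident gradH_partial_p[unfolded gderiv_def])
  from differential_zero_maxmin[OF UNIV_I open_UNIV this] max
  have "(\<lambda>h. h \<bullet> v - h \<bullet> Hp x p0) = (\<lambda>h. 0)" by blast
  then have "h \<bullet> v = h \<bullet> Hp x p0" for h by (simp add: fun_eq_iff)
  then show ?thesis using vector_eq_ldot by metis
qed

definition momentum :: "real ^ 'n \<Rightarrow> real ^ 'n \<Rightarrow> real ^ 'n" where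
  "momentum x v = (SOME p. Hp x p = v)"

lemma Hp_momentum: "Hp x (momentum x v) = v"
  unfolding momentum_def using someI_ex[OF Hp_surj] .

lemma momentum_Hp: "momentum x (Hp x p) = p"
  by (rule Hp_inj[OF Hp_momentum])

lemma lagrangian_eq:
  "lagrangian H (torus_proj x, v) = momentum x v \<bullet> v - lift_fun H (x, momentum x v)"
proof -
  let ?P = "momentum x v"
  have le: "p \<bullet> v - lift_fun H (x, p) \<le> ?P \<bullet> v - lift_fun H (x, ?P)" for p
    using tangent_inequality[of x ?P p] by (simp add: Hp_momentum inner_diff_right inner_commute)
  have "lagrangian H (torus_proj x, v) = Sup (range (\<lambda>p. p \<bullet> v - lift_fun H (x, p)))"
    by (simp add: lagrangian_def lift_fun_def)
  also have "\<dots> = ?P \<bullet> v - lift_fun H (x, ?P)"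
    by (rule cSup_eq_maximum) (use le in auto)
  finally show ?thesis .
qed

text \<open>Strong monotonicity of \<open>Hp x\<close> in a ball around the momentum of \<open>v\<close> gives the estimate as long
  as the momentum of \<open>w\<close> lies in this ball. If it did not, monotonicity along the segment would
  give \<open>\<bar>w - v\<bar> \<ge> m\<close>.\<close>

lemma momentum_lipschitz_at:
  obtains \<delta> where "\<delta> > 0" "\<And>w. norm (w - v) < \<delta> \<Longrightarrow> norm (momentum x w - momentum x v) \<le> norm (w - v) / \<delta>"
proof -
  let ?P = "momentum x"
  define r where "r = norm (?P v) + 1"
  obtain m where m: "m > 0" "\<And>x p v. norm p \<le> r \<Longrightarrow> hessH (x, p) (0, v) \<bullet> (0, v) \<ge> m * (norm v)\<^sup>2"
    using strictly_positive_hessian[of r] by blast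
  have rv: "norm (?P v) \<le> r" by (simp add: r_def)
  show thesis
  proof (rule that[OF m(1)])
    fix w assume w: "norm (w - v) < m"
    define d where "d = norm (?P w - ?P v)"
    have cs: "(w - v) \<bullet> (?P w - ?P v) \<le> norm (w - v) * d" unfolding d_def by (rule norm_cauchy_schwarz)
    have d1: "d \<le> 1"
    proof (rule ccontr)
      assume "\<not> d \<le> 1"
      then have d: "d > 1" by simp
      \<comment> \<open>the point on the segment from \<open>?P v\<close> to \<open>?P w\<close> at distance \<open>1\<close> from \<open>?P v\<close>, hence in the ball\<close>
      define p where "p = ?P v + (1 / d) *\<^sub>R (?P w - ?P v)"
      have pv: "p - ?P v = (1 / d) *\<^sub>R (?P w - ?P v)" by (simp add: p_def)
      have n1: "norm (p - ?P v) = 1" unfolding pv norm_scaleR d_def[symmetric] using d by simp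
      have rp: "norm p \<le> r" using norm_triangle_ineq2[of p "?P v"] n1 by (simp add: r_def)
      have "m * 1\<^sup>2 \<le> (Hp x p - v) \<bullet> (p - ?P v)"
        using strong_monotonicity[OF m(2) rp rv, of x] by (simp add: n1 Hp_momentum)
      then have 1: "m \<le> (Hp x p - v) \<bullet> (?P w - ?P v) / d" unfolding pv by simp
      have wp: "?P w - p = (1 - 1 / d) *\<^sub>R (?P w - ?P v)"
        by (simp add: p_def algebra_simps)
      have "0 \<le> (w - Hp x p) \<bullet> (?P w - p)"
        using tangent_inequality[of x "?P w" p] tangent_inequality[of x p "?P w"]
        by (simp add: Hp_momentum inner_diff_left inner_diff_right)
      then have "0 \<le> (1 - 1 / d) * ((w - Hp x p) \<bullet> (?P w - ?P v))" unfolding wp by simp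
      then have "0 \<le> (w - Hp x p) \<bullet> (?P w - ?P v)" using d by (simp add: zero_le_mult_iff)
      then have "(Hp x p - v) \<bullet> (?P w - ?P v) \<le> (w - v) \<bullet> (?P w - ?P v)" by (simp add: inner_diff_left)
      also have "\<dots> \<le> norm (w - v) * d" by (rule cs)
      finally have "(Hp x p - v) \<bullet> (?P w - ?P v) / d \<le> norm (w - v)" using d by (simp add: pos_divide_le_eq)
      with 1 have "m \<le> norm (w - v)" by (rule order_trans)
      with w show False by simp
    qed
    then have rw: "norm (?P w) \<le> r"
      using norm_triangle_ineq2[of "?P w" "?P v"] by (simp add: d_def r_def)
    have "m * d\<^sup>2 \<le> (w - v) \<bullet> (?P w - ?P v)"
      using strong_monotonicity[OF m(2) rw rv, of x] by (simp add: d_def Hp_momentum)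
    with cs have "(m * d) * d \<le> norm (w - v) * d" by (simp add: power2_eq_square mult_ac)
    then have "m * d \<le> norm (w - v)" by (cases "d = 0") (auto simp: d_def)
    then show "norm (?P w - ?P v) \<le> norm (w - v) / m"
      using m(1) by (simp add: pos_le_divide_eq mult.commute flip: d_def)
  qed
qed

text \<open>The remainder lies between \<open>0\<close> and \<open>(momentum x w - momentum x v) \<bullet> (w - v)\<close>, because each of
  the two momenta is a competitor in the supremum for the other velocity.\<close>

lemma lagrangian_gradient: "GDERIV (\<lambda>w. lagrangian H (torus_proj x, w)) v :> momentum x v"
  unfolding gderiv_def
proof -
  let ?L = "\<lambda>w. lagrangian H (torus_proj x, w)" and ?P = "momentum x"
  obtain \<delta> where \<delta>: "\<delta> > 0" "\<And>w. norm (w - v) < \<delta> \<Longrightarrow> norm (?P w - ?P v) \<le> norm (w - v) / \<delta>"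
    using momentum_lipschitz_at by blast
  show "(?L has_derivative (\<lambda>h. h \<bullet> ?P v)) (at v)"
  proof (rule has_derivativeI_sandwich[where e = \<delta> and H = "\<lambda>w. norm (w - v) / \<delta>"])
    show "bounded_linear (\<lambda>h. h \<bullet> ?P v)" by (rule bounded_linear_inner_left)
    show "norm (?L w - ?L v - (w - v) \<bullet> ?P v) / norm (w - v) \<le> norm (w - v) / \<delta>"
      if "w \<noteq> v" "dist w v < \<delta>" for w
    proof -
      have lo: "?L w - ?L v - (w - v) \<bullet> ?P v \<ge> 0"
        using tangent_inequality[of x "?P w" "?P v"]
        by (simp add: lagrangian_eq Hp_momentum inner_diff_left inner_diff_right inner_commute)
      have hi: "?L w - ?L v - (w - v) \<bullet> ?P v \<le> (?P w - ?P v) \<bullet> (w - v)"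
        using tangent_inequality[of x "?P v" "?P w"]
        by (simp add: lagrangian_eq Hp_momentum inner_diff_left inner_diff_right inner_commute)
      have "(?P w - ?P v) \<bullet> (w - v) \<le> norm (?P w - ?P v) * norm (w - v)" by (rule norm_cauchy_schwarz)
      also have "\<dots> \<le> (norm (w - v) / \<delta>) * norm (w - v)"
        using \<delta>(2)[of w] that by (intro mult_right_mono) (auto simp: dist_norm)
      finally show ?thesis using lo hi that by (simp add: divide_le_eq)
    qed
    have "((\<lambda>w. norm (w - v) / \<delta>) \<longlongrightarrow> norm (v - v) / \<delta>) (at v within UNIV)"
      using \<delta>(1) by (intro tendsto_intros) auto
    then show "((\<lambda>w. norm (w - v) / \<delta>) \<longlongrightarrow> 0) (at v within UNIV)" by simp
  qed (use \<delta> in auto)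
qed

lemma legendre_proj: "legendre H (torus_proj x, v) = (torus_proj x, momentum x v)"
  by (simp add: legendre_def GDERIV_unique_gradient[OF lagrangian_gradient])

definition velocity :: "'n phase \<Rightarrow> real ^ 'n" where
  "velocity = (\<lambda>(q, p). Hp (rep_torus q) p)"

lemma velocity_proj: "velocity (torus_proj x, p) = Hp x p"
proof -
  have "rep_torus (torus_proj x) - x \<in> int_lattice" by (simp flip: torus_proj_eq_iff)
  from gradH_periodic[OF this, of x p] show ?thesis by (simp add: velocity_def)
qed

text \<open>The rotation vector of a measure on the cotangent bundle is defined through the inverse Legendre
  transform, which is explicit in terms of \<open>H\<close>.\<close>

lemma inv_legendre: "inv (legendre H) (q, p) = (q, velocity (q, p))"
proof (rule inv_f_eq)
  show "inj (legendre H)"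
  proof (rule injI)
    fix z z' assume eq: "legendre H z = legendre H z'"
    obtain x v where z: "z = (torus_proj x, v)" by (metis surj_pair torus_proj_rep)
    obtain x' v' where z': "z' = (torus_proj x', v')" by (metis surj_pair torus_proj_rep)
    have x: "torus_proj x = torus_proj x'" using eq by (simp add: z z' legendre_proj)
    then have "momentum x v = momentum x v'"
      using eq unfolding z z' by (simp flip: x) (simp add: legendre_proj)
    then have "v = v'" using Hp_momentum by metis
    then show "z = z'" using x by (simp add: z z')
  qed
  obtain x where x: "q = torus_proj x" by (rule torus_cases)
  show "legendre H (q, velocity (q, p)) = (q, p)"
    by (simp add: x velocity_proj legendre_proj momentum_Hp)
qed

lemma continuous_on_velocity: "continuous_on UNIV velocity"
proof (rule continuous_on_torus_timesI)
  have "continuous_on UNIV (\<lambda>z. snd (gradH z))" by (intro continuous_intros)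
  then show "continuous_on UNIV (\<lambda>(x, p). velocity (torus_proj x, p))"
    by (simp add: velocity_proj case_prod_beta)
qed

section \<open>Rotation vectors\<close>

definition base_velocity :: "'n covector_field \<Rightarrow> 'n torus \<Rightarrow> real ^ 'n" where
  "base_velocity u q = velocity (q, u q)"

lemma continuous_on_base_velocity: "continuous_on UNIV (base_velocity u)"
proof -
  have "continuous_on UNIV (\<lambda>q. (q, u q))"
    by (intro continuous_on_Pair continuous_on_id continuous_on_apply_bcontfun)
  from continuous_on_compose2[OF continuous_on_velocity this] show ?thesis
    unfolding base_velocity_def by simp
qed

lemma torus_integrable:
  fixes f :: "'n torus \<Rightarrow> 'b::{banach, second_countable_topology}"
  assumes m: "prob_space m" "sets m = sets borel" and f: "continuous_on UNIV f"
  shows "integrable m f"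
proof -
  interpret prob_space m by (rule m)
  have "bounded (range f)" by (intro compact_imp_bounded compact_continuous_image f compact_torus)
  then obtain B where B: "\<And>q. norm (f q) \<le> B" unfolding bounded_iff by blast
  have "f \<in> borel_measurable m"
    unfolding measurable_cong_sets[OF m(2) refl] by (rule borel_measurable_continuous_onI[OF f])
  then show ?thesis using B by (intro integrable_const_bound[where B = B]) auto
qed

lemma derivative_along_flow:
  assumes inv: "invariant_lagrangian_graph H u"
    and F: "\<And>x. F (torus_proj x) = f x" and f: "\<And>x. GDERIV f x :> W (torus_proj x)"
  shows "((\<lambda>s. F (proj_flow u s q)) has_real_derivative
      W (proj_flow u s q) \<bullet> base_velocity u (proj_flow u s q)) (at s)"
proof -
  obtain x where x: "q = torus_proj x" by (rule torus_cases)
  define X where "X s = fst (\<Phi> (s + 0) (x, lift_field u x))" for s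
  have PX: "\<Phi> s (x, lift_field u x) = (X s, lift_field u (X s))" for s
    using flow_on_graph[OF inv, of s x] by (auto simp: X_def prod_eq_iff)
  have flow: "proj_flow u s q = torus_proj (X s)" for s
    unfolding proj_flow_def x ham_flow_proj PX by simp
  have "(X has_vector_derivative Hp (X s) (lift_field u (X s))) (at s)"
    using flow_fst_derivative[of 0 "(x, lift_field u x)" s]
    unfolding X_def[abs_def, symmetric] by (simp add: PX)
  from GDERIV_along_curve[OF f this]
  show ?thesis by (simp add: flow F base_velocity_def velocity_proj)
qed

text \<open>By invariance the difference quotients of \<open>F\<close> along the flow have integral zero. They converge to
  the integrand, boundedly by the mean value theorem.\<close>

lemma exact_form_integral:
  assumes inv: "invariant_lagrangian_graph H u" and m: "flow_invariant u m"
    and F: "\<And>x. F (torus_proj x) = f x" and f: "\<And>x. GDERIV f x :> W (torus_proj x)"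
    and W: "continuous_on UNIV W"
  shows "(LINT q|m. W q \<bullet> base_velocity u q) = 0"
proof -
  have pm: "prob_space m" and sm: "sets m = sets borel" using m by (simp_all add: flow_invariant_def)
  interpret prob_space m by (rule pm)
  let ?g = "\<lambda>q. W q \<bullet> base_velocity u q"
  have cg: "continuous_on UNIV ?g" by (intro continuous_intros W continuous_on_base_velocity)
  have "bounded (range ?g)" by (intro compact_imp_bounded compact_continuous_image cg compact_torus)
  then obtain B where B: "\<And>q. norm (?g q) \<le> B" unfolding bounded_iff by blast
  have cF: "continuous_on UNIV F"
  proof (rule continuous_on_torusI)
    show "continuous_on UNIV (\<lambda>x. F (torus_proj x))"
      unfolding F using f unfolding gderiv_def
      by (meson continuous_at_imp_continuous_on has_derivative_continuous)
  qed
  define D where "D n q = (F (proj_flow u (1 / Suc n) q) - F q) / (1 / Suc n)" for n :: nat and q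
  have intF: "integrable m F" by (rule torus_integrable[OF pm sm cF])
  have cFs: "continuous_on UNIV (\<lambda>q. F (proj_flow u s q))" for s
    by (rule continuous_on_compose2[OF cF continuous_on_proj_flow]) auto
  have D0: "(LINT q|m. D n q) = 0" for n
  proof -
    have "(LINT q|distr m borel (proj_flow u (1 / Suc n)). F q) = (LINT q|m. F (proj_flow u (1 / Suc n) q))"
      by (rule integral_distr[OF proj_flow_measurable[OF sm] borel_measurable_continuous_onI[OF cF]])
    then have "(LINT q|m. F (proj_flow u (1 / Suc n) q)) = (LINT q|m. F q)"
      using m by (simp add: flow_invariant_def)
    then show ?thesis
      unfolding D_def using torus_integrable[OF pm sm cFs] intF by simp
  qed
  have cD: "continuous_on UNIV (D n)" for n
    unfolding D_def by (intro continuous_intros cF cFs) auto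
  have "(\<lambda>n. LINT q|m. D n q) \<longlonglongrightarrow> (LINT q|m. ?g q)"
  proof (rule integral_dominated_convergence[where w = "\<lambda>_. B"])
    show "?g \<in> borel_measurable m" "D n \<in> borel_measurable m" for n
      unfolding measurable_cong_sets[OF sm refl]
      using borel_measurable_continuous_onI[OF cg] borel_measurable_continuous_onI[OF cD] by blast+
    show "AE q in m. norm (D n q) \<le> B" for n
    proof (intro AE_I2)
      fix q
      obtain s where "F (proj_flow u (1 / Suc n) q) - F (proj_flow u 0 q) = (1 / Suc n - 0) * ?g (proj_flow u s q)"
        using MVT2[of 0 "1 / Suc n" "\<lambda>s. F (proj_flow u s q)" "\<lambda>s. ?g (proj_flow u s q)"]
          derivative_along_flow[OF inv F f] by auto
      then have "D n q = ?g (proj_flow u s q)" by (simp add: D_def proj_flow_0)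
      then show "norm (D n q) \<le> B" using B by simp
    qed
    show "AE q in m. (\<lambda>n. D n q) \<longlonglongrightarrow> ?g q"
    proof (intro AE_I2)
      fix q
      have "((\<lambda>h. (F (proj_flow u h q) - F q) / h) \<longlongrightarrow> ?g q) (at 0)"
        using derivative_along_flow[OF inv F f, of q 0] by (simp add: DERIV_def proj_flow_0)
      moreover have "filterlim (\<lambda>n. 1 / real (Suc n)) (at 0) sequentially"
        unfolding filterlim_at using LIMSEQ_inverse_real_of_nat by (simp add: inverse_eq_divide)
      ultimately show "(\<lambda>n. D n q) \<longlonglongrightarrow> ?g q"
        unfolding D_def by (rule filterlim_compose)
    qed
  qed simp
  then show ?thesis by (simp add: D0 LIMSEQ_const_iff)
qed

definition periods :: "(real ^ 'n \<Rightarrow> real) \<Rightarrow> real ^ 'n" where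
  "periods f = (\<chi> i. f (axis i 1) - f 0)"

text \<open>The increments of \<open>f\<close> under a coordinate translation are constant because \<open>W\<close> is periodic; the
  linear function with the same increments is subtracted.\<close>

lemma subtract_periods:
  fixes f :: "real ^ 'n \<Rightarrow> real"
  assumes f: "\<And>x. GDERIV f x :> W (torus_proj x)" and a: "a \<in> int_lattice"
  shows "f (x + a) - periods f \<bullet> (x + a) = f x - periods f \<bullet> x"
proof -
  define S where "S = {a. \<forall>x. f (x + a) - periods f \<bullet> (x + a) = f x - periods f \<bullet> x}"
  have "int_lattice \<subseteq> S"
  proof (rule int_lattice_generated_by_axes)
    show "0 \<in> S" by (simp add: S_def)
    show "a + b \<in> S" if "a \<in> S" "b \<in> S" for a b
    proof -
      have "f (x + (a + b)) - periods f \<bullet> (x + (a + b)) = f x - periods f \<bullet> x" for x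
        using that(1)[unfolded S_def mem_Collect_eq, rule_format, of x]
          that(2)[unfolded S_def mem_Collect_eq, rule_format, of "x + a"] by (simp add: add.assoc)
      then show ?thesis by (simp add: S_def)
    qed
    show "- a \<in> S" if "a \<in> S" for a
    proof -
      have "f (x + - a) - periods f \<bullet> (x + - a) = f x - periods f \<bullet> x" for x
        using that[unfolded S_def mem_Collect_eq, rule_format, of "x + - a"] by simp
      then show ?thesis by (simp add: S_def)
    qed
    show "axis i 1 \<in> S" for i
    proof -
      let ?e = "axis i 1 :: real ^ 'n"
      have d: "GDERIV (\<lambda>x. f (x + ?e) - f x) x :> 0" for x
      proof -
        have "((\<lambda>x. x + ?e) has_derivative (\<lambda>h. h)) (at x)" by (auto intro!: derivative_eq_intros)
        from has_derivative_compose[OF this f[of "x + ?e", unfolded gderiv_def]]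
        have "GDERIV (\<lambda>x. f (x + ?e)) x :> W (torus_proj x)"
          by (simp add: gderiv_def torus_proj_add_lattice)
        from GDERIV_diff[OF this f] show ?thesis by simp
      qed
      have "f (x + ?e) - f x = f (0 + ?e) - f 0" for x
        using GDERIV_mean_value[of "\<lambda>x. f (x + ?e) - f x" 0 x "\<lambda>_. 0"] d by force
      then have "f (x + ?e) - f x = periods f \<bullet> ?e" for x
        by (simp add: periods_def inner_axis)
      then show ?thesis unfolding S_def by (simp add: inner_add_right algebra_simps)
    qed
  qed
  then show ?thesis using a unfolding S_def by blast
qed

text \<open>After subtracting the constant form with the same periods, the form is exact on the torus.\<close>

theorem closed_form_integral:
  assumes inv: "invariant_lagrangian_graph H u" and m: "flow_invariant u m"
    and f: "\<And>x. GDERIV f x :> W (torus_proj x)" and W: "continuous_on UNIV W"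
  shows "(LINT q|m. W q \<bullet> base_velocity u q) = periods f \<bullet> (LINT q|m. base_velocity u q)"
proof -
  have pm: "prob_space m" and sm: "sets m = sets borel" using m by (simp_all add: flow_invariant_def)
  let ?c = "periods f"
  obtain F where F: "\<And>x. F (torus_proj x) = f x - ?c \<bullet> x"
    using periodic_descends[of "\<lambda>x. f x - ?c \<bullet> x"] subtract_periods[OF f] by metis
  have d: "GDERIV (\<lambda>x. f x - ?c \<bullet> x) x :> W (torus_proj x) - ?c" for x
  proof -
    have "GDERIV (\<lambda>x. ?c \<bullet> x) x :> ?c"
      unfolding gderiv_def by (auto intro!: derivative_eq_intros simp: inner_commute)
    from GDERIV_diff[OF f this] show ?thesis .
  qed
  have "(LINT q|m. (W q - ?c) \<bullet> base_velocity u q) = 0"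
    by (rule exact_form_integral[where W = "\<lambda>q. W q - ?c", OF inv m F d])
      (intro continuous_intros W)
  moreover have "integrable m (\<lambda>q. W q \<bullet> base_velocity u q)" "integrable m (base_velocity u)"
    by (intro torus_integrable[OF pm sm] continuous_intros W continuous_on_base_velocity)+
  ultimately show ?thesis by (simp add: inner_diff_left)
qed

lemma closed_one_formD:
  assumes "closed_one_form \<eta>"
  shows "continuous_on UNIV \<eta>" "GDERIV (radial_primitive (\<lambda>x. \<eta> (torus_proj x))) x :> \<eta> (torus_proj x)"
proof -
  let ?\<eta> = "\<lambda>x. \<eta> (torus_proj x)"
  have C: "class_C k ?\<eta>" for k using assms by (simp add: closed_one_form_def)
  show "continuous_on UNIV \<eta>" using C[of 0] by (intro continuous_on_torusI) simp
  have "class_C (Suc 0) ?\<eta>" by (rule C)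
  then have d: "?\<eta> differentiable (at x)" and c: "continuous_on UNIV (\<lambda>x. frechet_derivative ?\<eta> (at x) v)" for x v
    by simp_all
  show "GDERIV (radial_primitive ?\<eta>) x :> ?\<eta> x"
  proof (rule radial_primitive_of_closed_form[where D = "\<lambda>x. frechet_derivative ?\<eta> (at x)"])
    show "(?\<eta> has_derivative frechet_derivative ?\<eta> (at x)) (at x)" for x
      using d frechet_derivative_works by blast
    show "frechet_derivative ?\<eta> (at x) v \<bullet> w = frechet_derivative ?\<eta> (at x) w \<bullet> v" for x v w
      using assms by (simp add: closed_one_form_def)
  qed (rule c)
qed

lemma cohomology_class_eq_periods:
  assumes "closed_one_form \<eta>"
  shows "cohomology_class \<eta> = periods (radial_primitive (\<lambda>x. \<eta> (torus_proj x)))"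
proof -
  let ?f = "radial_primitive (\<lambda>x. \<eta> (torus_proj x))"
  have "integral {0..1} (\<lambda>t. \<eta> (torus_proj (t *\<^sub>R axis i 1)) $ i) = ?f (axis i 1) - ?f 0" for i
    using fundamental_theorem_along_ray[of 0 1 ?f "axis i 1" "\<lambda>x. \<eta> (torus_proj x)"] closed_one_formD(2)[OF assms]
    by (simp add: integral_unique inner_axis)
  then show ?thesis by (simp add: cohomology_class_def periods_def)
qed

text \<open>The rotation vector exists and equals the mean velocity by \<open>closed_form_integral\<close>; testing
  against constant forms shows that no other vector qualifies.\<close>

lemma has_rotation_vector_dual_iff:
  assumes inv: "invariant_lagrangian_graph H u" and \<mu>: "\<mu> \<in> invariant_measures_on H u"
  shows "has_rotation_vector_dual H \<mu> \<rho> \<longleftrightarrow> \<rho> = (LINT q|distr \<mu> borel fst. base_velocity u q)"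
proof -
  define m where "m = distr \<mu> borel fst"
  let ?\<iota> = "\<lambda>q. (q, u q)" and ?\<kappa> = "\<lambda>q. (q, base_velocity u q)"
  have m: "flow_invariant u m" and \<mu>m: "\<mu> = distr m borel ?\<iota>"
    using flow_invariant_of_invariant_measure[OF inv \<mu>] by (simp_all add: m_def)
  have pm: "prob_space m" and sm: "sets m = sets borel" using m by (simp_all add: flow_invariant_def)
  have "continuous_on UNIV (inv (legendre H))"
  proof -
    have "inv (legendre H) = (\<lambda>z. (fst z, velocity z))" by (auto simp: fun_eq_iff inv_legendre)
    then show ?thesis by (simp add: continuous_on_Pair continuous_on_fst continuous_on_id continuous_on_velocity)
  qed
  then have L: "inv (legendre H) \<in> borel_measurable borel" by (rule borel_measurable_continuous_onI)
  have \<kappa>: "?\<kappa> \<in> measurable m borel"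
    unfolding measurable_cong_sets[OF sm refl]
    by (intro borel_measurable_continuous_onI continuous_on_Pair continuous_on_id continuous_on_base_velocity)
  have "distr \<mu> borel (inv (legendre H)) = distr m borel (inv (legendre H) \<circ> ?\<iota>)"
    unfolding \<mu>m by (rule distr_distr[OF L graph_map_measurable[OF sm]])
  also have "inv (legendre H) \<circ> ?\<iota> = ?\<kappa>" by (auto simp: fun_eq_iff inv_legendre base_velocity_def)
  finally have push: "distr \<mu> borel (inv (legendre H)) = distr m borel ?\<kappa>" .
  have form: "integrable (distr m borel ?\<kappa>) (\<lambda>(q, v). \<eta> q \<bullet> v)"
      "(LINT (q, v)|distr m borel ?\<kappa>. \<eta> q \<bullet> v) = (LINT q|m. \<eta> q \<bullet> base_velocity u q)"
    if \<eta>: "continuous_on UNIV \<eta>" for \<eta> :: "'n torus \<Rightarrow> real ^ 'n"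
  proof -
    have "continuous_on UNIV (\<lambda>z :: 'n phase. \<eta> (fst z) \<bullet> snd z)"
      by (intro continuous_intros continuous_on_compose2[OF \<eta>]) auto
    then have b: "(\<lambda>(q, v). \<eta> q \<bullet> v) \<in> borel_measurable borel"
      by (simp add: case_prod_beta borel_measurable_continuous_onI)
    have i: "integrable m (\<lambda>q. \<eta> q \<bullet> base_velocity u q)"
      by (intro torus_integrable[OF pm sm] continuous_intros \<eta> continuous_on_base_velocity)
    show "integrable (distr m borel ?\<kappa>) (\<lambda>(q, v). \<eta> q \<bullet> v)"
      using i by (subst integrable_distr_eq[OF \<kappa> b]) simp
    show "(LINT (q, v)|distr m borel ?\<kappa>. \<eta> q \<bullet> v) = (LINT q|m. \<eta> q \<bullet> base_velocity u q)"
      by (subst integral_distr[OF \<kappa> b]) simp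
  qed
  define V where "V = (LINT q|m. base_velocity u q)"
  have rot: "(LINT (q, v)|distr m borel ?\<kappa>. \<eta> q \<bullet> v) = cohomology_class \<eta> \<bullet> V"
    if \<eta>: "closed_one_form \<eta>" for \<eta>
    unfolding form(2)[OF closed_one_formD(1)[OF \<eta>]] cohomology_class_eq_periods[OF \<eta>] V_def
    by (rule closed_form_integral[OF inv m closed_one_formD(2)[OF \<eta>] closed_one_formD(1)[OF \<eta>]])
  have const: "closed_one_form (\<lambda>_. w)" for w :: "real ^ 'n"
  proof -
    have "class_C k (\<lambda>_ :: real ^ 'n. w)" for k and w :: "real ^ 'n"
      by (induction k arbitrary: w) (simp_all add: frechet_derivative_const)
    then show ?thesis by (simp add: closed_one_form_def frechet_derivative_const)
  qed
  have class_const: "cohomology_class (\<lambda>_. w) = w" for w :: "real ^ 'n"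
    by (simp add: cohomology_class_def vec_eq_iff)
  have "has_rotation_vector_dual H \<mu> \<rho> \<longleftrightarrow> (\<forall>\<eta>. closed_one_form \<eta> \<longrightarrow> cohomology_class \<eta> \<bullet> V = cohomology_class \<eta> \<bullet> \<rho>)"
    unfolding has_rotation_vector_dual_def has_rotation_vector_def push
    using form(1) closed_one_formD(1) rot by (metis (no_types, lifting))
  also have "\<dots> \<longleftrightarrow> \<rho> = V"
  proof
    assume *: "\<forall>\<eta>. closed_one_form \<eta> \<longrightarrow> cohomology_class \<eta> \<bullet> V = cohomology_class \<eta> \<bullet> \<rho>"
    have "w \<bullet> V = w \<bullet> \<rho>" for w using *[rule_format, OF const[of w]] by (simp add: class_const)
    then show "\<rho> = V" using vector_eq_ldot by metis
  qed simp
  finally show ?thesis by (simp add: V_def m_def)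
qed

section \<open>Rigidity of strictly ergodic graphs\<close>

text \<open>The two graphs share the orbit through the common point.\<close>

lemma graphs_meeting_dense_orbit_coincide:
  assumes u: "invariant_lagrangian_graph H u" and v: "invariant_lagrangian_graph H v"
    and dense: "\<And>e q q'. e > 0 \<Longrightarrow> \<exists>s. dist (proj_flow u s q) q' < e"
    and meet: "v q = u q"
  shows "v = u"
proof (rule bcontfun_eqI)
  fix q'
  let ?Z = "{z. v z = u z}"
  have "closed ?Z" by (intro closed_Collect_eq continuous_on_apply_bcontfun)
  have orbit: "proj_flow u s q \<in> ?Z" for s
  proof -
    have "(proj_flow v s q, v (proj_flow v s q)) = (proj_flow u s q, u (proj_flow u s q))"
      unfolding ham_flow_on_graph[OF u, symmetric] ham_flow_on_graph[OF v, symmetric] meet ..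
    then show ?thesis by (elim Pair_inject) simp
  qed
  have "q' \<in> closure ?Z"
    unfolding closure_approachable using dense orbit by blast
  then have "q' \<in> ?Z" using \<open>closed ?Z\<close> by simp
  then show "v q' = u q'" by simp
qed

text \<open>By the Hamilton-Jacobi equation the two energies are constants, and the remaining term is the
  pairing of a closed form with the velocity. The right hand side changes sign when \<open>u\<close> and \<open>v\<close>
  are exchanged and the mean velocity is kept.\<close>

lemma energy_gap_integral:
  assumes u: "invariant_lagrangian_graph H u" and v: "invariant_lagrangian_graph H v"
    and m: "flow_invariant u m"
  shows "(LINT q|m. H (q, v q) - H (q, u q)
        - base_velocity u q \<bullet> (v q - u q))
      = lift_fun H (0, lift_field v 0) - lift_fun H (0, lift_field u 0)
        - (periods (field_primitive v) - periods (field_primitive u)) \<bullet> (LINT q|m. base_velocity u q)"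
proof -
  have pm: "prob_space m" and sm: "sets m = sets borel" using m by (simp_all add: flow_invariant_def)
  interpret prob_space m by (rule pm)
  have lag: "lagrangian_graph u" "lagrangian_graph v"
    using u v by (simp_all add: invariant_lagrangian_graph_def)
  have level: "H (q, w q) = lift_fun H (0, lift_field w 0)"
    if w: "invariant_lagrangian_graph H w" for w q
  proof -
    obtain x where x: "q = torus_proj x" by (rule torus_cases)
    show ?thesis using hamilton_jacobi[OF w, of x 0] by (simp add: x lift_fun_def)
  qed
  have int: "integrable m (\<lambda>q. w q \<bullet> base_velocity u q)" for w :: "'n covector_field"
    by (intro torus_integrable[OF pm sm] continuous_intros continuous_on_apply_bcontfun continuous_on_base_velocity)
  have per: "(LINT q|m. w q \<bullet> base_velocity u q)
      = periods (field_primitive w) \<bullet> (LINT q|m. base_velocity u q)" if "lagrangian_graph w" for w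
    by (rule closed_form_integral[OF u m GDERIV_field_primitive[OF that]]) (rule continuous_on_apply_bcontfun)
  let ?d = "lift_fun H (0, lift_field v 0) - lift_fun H (0, lift_field u 0)"
  have "(LINT q|m. H (q, v q) - H (q, u q)
        - base_velocity u q \<bullet> (v q - u q))
      = (LINT q|m. ?d - (v q \<bullet> base_velocity u q - u q \<bullet> base_velocity u q))"
    unfolding level[OF u] level[OF v] by (simp only: inner_diff_right inner_commute)
  also have "\<dots> = ?d - ((LINT q|m. v q \<bullet> base_velocity u q) - (LINT q|m. u q \<bullet> base_velocity u q))"
    using int[of u] int[of v] by (simp add: prob_space)
  finally show ?thesis by (simp add: per lag inner_diff_left)
qed

lemma energy_gap_lower_bound:
  fixes u v :: "'n covector_field"
  obtains \<kappa> where "\<kappa> > 0" "\<And>q. H (q, v q) - H (q, u q)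
     - base_velocity u q \<bullet> (v q - u q)
     \<ge> \<kappa> * (norm (v q - u q))\<^sup>2"
proof -
  define r where "r = max (norm u) (norm v)"
  obtain m where m: "m > 0" "\<And>x p w. norm p \<le> r \<Longrightarrow> hessH (x, p) (0, w) \<bullet> (0, w) \<ge> m * (norm w)\<^sup>2"
    using strictly_positive_hessian[of r] by blast
  show thesis
  proof (rule that[of "m / 2"])
    fix q :: "'n torus"
    obtain x where x: "q = torus_proj x" by (rule torus_cases)
    have "norm (lift_field v x) \<le> r" "norm (lift_field u x) \<le> r"
      unfolding r_def using norm_bounded[of u] norm_bounded[of v] by (simp_all add: le_max_iff_disj)
    from strong_convexity[OF m(2) this, where x = x]
    show "m / 2 * (norm (v q - u q))\<^sup>2
      \<le> H (q, v q) - H (q, u q)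
        - base_velocity u q \<bullet> (v q - u q)"
      by (simp add: x base_velocity_def velocity_proj lift_fun_def)
  qed (use m in simp)
qed

text \<open>The integrals of the two energy gaps are nonnegative and add up to zero, so the gap at \<open>v\<close> over \<open>u\<close>
  vanishes almost everywhere for \<open>m\<close>, and strong convexity gives \<open>v = u\<close> almost everywhere.\<close>

theorem equal_rotation_vectors_meet:
  assumes u: "invariant_lagrangian_graph H u" and v: "invariant_lagrangian_graph H v"
    and m: "flow_invariant u m" and m': "flow_invariant v m'"
    and rot: "(LINT q|m. base_velocity u q) = (LINT q|m'. base_velocity v q)"
  shows "\<exists>q. v q = u q"
proof -
  have pm: "prob_space m" and sm: "sets m = sets borel" using m by (simp_all add: flow_invariant_def)
  interpret prob_space m by (rule pm)
  obtain \<kappa> where \<kappa>: "\<kappa> > 0" "\<And>q. H (q, v q) - H (q, u q)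
     - base_velocity u q \<bullet> (v q - u q)
     \<ge> \<kappa> * (norm (v q - u q))\<^sup>2"
    using energy_gap_lower_bound[of v u] by blast
  obtain \<kappa>' where \<kappa>': "\<kappa>' > 0" "\<And>q. H (q, u q) - H (q, v q)
     - base_velocity v q \<bullet> (u q - v q)
     \<ge> \<kappa>' * (norm (u q - v q))\<^sup>2"
    using energy_gap_lower_bound[of u v] by blast
  let ?g = "\<lambda>q. H (q, v q) - H (q, u q)
     - base_velocity u q \<bullet> (v q - u q)"
  let ?g' = "\<lambda>q. H (q, u q) - H (q, v q)
     - base_velocity v q \<bullet> (u q - v q)"
  let ?s = "\<lambda>q. \<kappa> * (norm (v q - u q))\<^sup>2"
  have cH: "continuous_on UNIV H"
    by (rule continuous_on_torus_timesI) (use continuous_on_liftH[of UNIV] in \<open>simp add: lift_fun_def\<close>)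
  have "continuous_on UNIV ?g"
    by (intro continuous_intros continuous_on_compose2[OF cH] continuous_on_apply_bcontfun continuous_on_base_velocity) auto
  then have ig: "integrable m ?g" by (rule torus_integrable[OF pm sm])
  have int_s: "integrable m ?s"
    by (intro torus_integrable[OF pm sm] continuous_intros continuous_on_apply_bcontfun)
  have "(LINT q|m'. ?g' q) \<ge> 0"
  proof (rule Bochner_Integration.integral_nonneg)
    show "0 \<le> ?g' q" for q
      using order_trans[OF mult_nonneg_nonneg \<kappa>'(2)[of q]] \<kappa>'(1) by simp
  qed
  moreover have "(LINT q|m'. ?g' q) = - (LINT q|m. ?g q)"
    unfolding energy_gap_integral[OF u v m] energy_gap_integral[OF v u m'] rot by (simp add: inner_diff_left)
  moreover have "(LINT q|m. ?s q) \<le> (LINT q|m. ?g q)" by (rule integral_mono[OF int_s ig]) (rule \<kappa>(2))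
  moreover have "(LINT q|m. ?s q) \<ge> 0" using \<kappa>(1) by (intro Bochner_Integration.integral_nonneg) simp
  ultimately have "(LINT q|m. ?s q) = 0" by linarith
  then have "AE q in m. ?s q = 0"
    using \<kappa>(1) by (subst (asm) integral_nonneg_eq_0_iff_AE[OF int_s]) auto
  then have "AE q in m. v q = u q" using \<kappa>(1) by simp
  then have "AE q in m. False" if "\<nexists>q. v q = u q"
    by (rule eventually_mono) (use that in blast)
  then show ?thesis by auto
qed

end

section \<open>The generic set\<close>

theorem proposition4p1:
  fixes H :: "'n::finite phase \<Rightarrow> real" and k :: nat
  assumes "tonelli k H"
  shows "\<exists>G \<subseteq> closure (Upsilon H).
    gdelta_in (top_of_set (closure (Upsilon H))) G \<and>
    top_of_set (closure (Upsilon H)) closure_of G = closure (Upsilon H) \<and>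
    (\<forall>\<Lambda> \<in> G.
       invariant_lagrangian_graph H \<Lambda> \<and> strictly_ergodic H \<Lambda> \<and>
       (\<exists>!\<rho>. graph_has_rotation_vector H \<Lambda> \<rho>) \<and>
       (\<forall>\<Lambda>'. invariant_lagrangian_graph H \<Lambda>' \<and> graph_of \<Lambda>' \<inter> graph_of \<Lambda> \<noteq> {} \<longrightarrow> \<Lambda>' = \<Lambda>) \<and>
       (\<forall>\<rho> \<Lambda>' \<mu>. graph_has_rotation_vector H \<Lambda> \<rho> \<and> invariant_lagrangian_graph H \<Lambda>' \<and>
          \<mu> \<in> invariant_measures_on H \<Lambda>' \<and> has_rotation_vector_dual H \<mu> \<rho> \<longrightarrow> \<Lambda>' = \<Lambda>))"
proof -
  interpret tonelli_hamiltonian H k by (rule tonelli_hamiltonian.intro[OF assms])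
  define C where "C = closure (Upsilon H)"
  define E where "E = (\<Inter>j. equidistributed (1 / Suc j))"
  define G where "G = E \<inter> C"
  have "Upsilon H \<subseteq> G"
    using Upsilon_equidistributed closure_subset[of "Upsilon H"] unfolding G_def E_def C_def by auto
  have "gdelta_in euclidean E"
    unfolding E_def by (intro gdelta_in_Inter) (auto intro!: open_imp_gdelta_in open_equidistributed)
  then have 1: "gdelta_in (top_of_set C) G"
    unfolding gdelta_in_subtopology G_def by blast
  have 2: "top_of_set C closure_of G = C"
  proof -
    have "C \<subseteq> closure G" unfolding C_def using \<open>Upsilon H \<subseteq> G\<close> by (rule closure_mono)
    moreover have "C \<inter> G = G" by (auto simp: G_def)
    ultimately show ?thesis by (auto simp: closure_of_subtopology)
  qed
  have 3: "invariant_lagrangian_graph H u \<and> strictly_ergodic H u \<and>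
       (\<exists>!\<rho>. graph_has_rotation_vector H u \<rho>) \<and>
       (\<forall>v. invariant_lagrangian_graph H v \<and> graph_of v \<inter> graph_of u \<noteq> {} \<longrightarrow> v = u) \<and>
       (\<forall>\<rho> v \<mu>. graph_has_rotation_vector H u \<rho> \<and> invariant_lagrangian_graph H v \<and>
          \<mu> \<in> invariant_measures_on H v \<and> has_rotation_vector_dual H \<mu> \<rho> \<longrightarrow> v = u)"
    if uG: "u \<in> G" for u
  proof -
    have inv: "invariant_lagrangian_graph H u"
      using uG closure_Upsilon_invariant unfolding G_def C_def by blast
    have eq: "u \<in> equidistributed (1 / Suc j)" for j using uG unfolding G_def E_def by blast
    note se = equidistributed_strictly_ergodic(1)[OF inv eq]
    note dense = equidistributed_strictly_ergodic(2)[OF inv eq]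
    obtain \<mu> where \<mu>: "invariant_measures_on H u = {\<mu>}" using se unfolding strictly_ergodic_def by blast
    define \<rho>0 where "\<rho>0 = (LINT q|distr \<mu> borel fst. base_velocity u q)"
    have rot: "graph_has_rotation_vector H u \<rho> \<longleftrightarrow> \<rho> = \<rho>0" for \<rho>
      unfolding graph_has_rotation_vector_def \<mu> \<rho>0_def
      using has_rotation_vector_dual_iff[OF inv, of \<mu>] \<mu> by simp
    have meet: "v = u" if "invariant_lagrangian_graph H v" "v q = u q" for v q
      by (rule graphs_meeting_dense_orbit_coincide[OF inv that(1) dense that(2)])
    have ii: "v = u" if v: "invariant_lagrangian_graph H v" and ne: "graph_of v \<inter> graph_of u \<noteq> {}" for v
    proof -
      obtain z where "z \<in> graph_of v" "z \<in> graph_of u" using ne by blast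
      then have "v (fst z) = u (fst z)" by (cases z) (simp add: in_graph_of_iff)
      then show ?thesis by (rule meet[OF v])
    qed
    have iii: "v = u" if r: "graph_has_rotation_vector H u \<rho>" and v: "invariant_lagrangian_graph H v"
      and \<nu>: "\<nu> \<in> invariant_measures_on H v" and d: "has_rotation_vector_dual H \<nu> \<rho>" for \<rho> v \<nu>
    proof -
      have "(LINT q|distr \<mu> borel fst. base_velocity u q) = (LINT q|distr \<nu> borel fst. base_velocity v q)"
        using r d unfolding rot has_rotation_vector_dual_iff[OF v \<nu>] \<rho>0_def by simp
      moreover have "flow_invariant u (distr \<mu> borel fst)"
        using \<mu> by (intro flow_invariant_of_invariant_measure(1)[OF inv]) simp
      ultimately obtain q where "v q = u q"
        using equal_rotation_vectors_meet[OF inv v _ flow_invariant_of_invariant_measure(1)[OF v \<nu>]] by blast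
      then show ?thesis by (rule meet[OF v])
    qed
    have i: "\<exists>!\<rho>. graph_has_rotation_vector H u \<rho>" by (simp add: rot)
    show ?thesis
    proof (intro conjI allI impI)
      show "invariant_lagrangian_graph H u" by (rule inv)
      show "strictly_ergodic H u" by (rule se)
      show "\<exists>!\<rho>. graph_has_rotation_vector H u \<rho>" by (rule i)
    qed (elim conjE, rule ii iii; assumption)+
  qed
  have sub: "G \<subseteq> C" by (simp add: G_def)
  show ?thesis
    unfolding C_def[symmetric]
    by (rule exI[of _ G], rule conjI[OF sub conjI[OF 1 conjI[OF 2 ballI[OF 3]]]])
qed

end
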